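(* Let $R$ be a noetherian graded commutative ring and $\mathsf{T}$ an essentially small $R$-linear triangulated category. Suppose that for each object $X$ in $\mathsf{T}$ the endomorphism ring $\operatorname{End}^*_{\mathsf{T}}(X)$ is finitely generated over $R$. If $\mathsf{T}$ is not stratified by $R$, then there are objects $X,Y\in\mathsf{T}$ such that $\operatorname{supp}_RX=\operatorname{supp}_RY$ but $\operatorname{\mathsf{Thick}}(X)\neq\operatorname{\mathsf{Thick}}(Y)$.
   Context: A graded commutative ring $R$ is $\mathbb{Z}$-graded with $rs=(-1)^{|r||s|}sr$ for homogeneous $r,s$. $\operatorname{Spec}R$ is the set of homogeneous prime ideals. A triangulated category $\mathsf{T}$ with suspension $\Sigma$ is $R$-linear if there is a given homomorphism of graded rings $R\to Z^*(\mathsf{T})$, where $Z^*(\mathsf{T})=\bigoplus_{n\in\mathbb{Z}}\{\eta\colon \mathrm{Id}_{\mathsf{T}}\to\Sigma^n\mid \eta\Sigma=(-1)^n\Sigma\eta\}$ is the graded centre. Then $\operatorname{Hom}^*_{\mathsf{T}}(X,Y)=\bigoplus_{n}\operatorname{Hom}_{\mathsf{T}}(X,\Sigma^nY)$ is a graded $R$-module, and $\operatorname{End}^*_{\mathsf{T}}(X)=\operatorname{Hom}^*_{\mathsf{T}}(X,X)$; "finitely generated over $R$" means as an $R$-module. The action passes to Verdier quotients. $\operatorname{\mathsf{Thick}}(Y)$ is the smallest thick subcategory containing $Y$. Localisation: for $\mathfrak p\in\operatorname{Spec}R$, $\mathsf{T}_{\mathfrak p}$ is the Verdier quotient of $\mathsf{T}$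 by $\{X\in\mathsf{T}\mid \operatorname{End}^*_{\mathsf{T}}(X)_{\mathfrak q}=0 \text{ for all } \mathfrak q\in\operatorname{Spec}R,\ \mathfrak q\subseteq\mathfrak p\}$, and $X_{\mathfrak p}$ is the image of $X$ in $\mathsf{T}_{\mathfrak p}$. Koszul objects: for $r\in R$ homogeneous of degree $d$, $X/\!\!/r$ is the cone of $X\xrightarrow{r}\Sigma^dX$. For a finitely generated homogeneous ideal $\mathfrak a$, choose homogeneous generators $r_1,\dots,r_n$, put $X_0=X$, $X_i=X_{i-1}/\!\!/r_i$, and $X/\!\!/\mathfrak a=X_n$; the thick subcategory it generates is independent of the choice. Set $X(\mathfrak p)=(X_{\mathfrak p})/\!\!/\mathfrak p\in\mathsf{T}_{\mathfrak p}$. Support: $\operatorname{supp}_RX=\{\mathfrak p\in\operatorname{Spec}R\mid X(\mathfrak p)\neq0\}$. Stratification: $\varGamma_{\mathfrak p}\mathsf{T}=\{X\in\mathsf{T}_{\mathfrak p}\mid\operatorname{End}^*_{\mathsf{T}_{\mathfrak p}}(X)_{\mathfrak q}=0\text{ for all }\mathfrak q\in\operatorname{Spec}R\text{ with }\mathfrak q\not\supseteq\mathfrak p\}$, a thick subcategory of $\mathsf{T}_{\mathfrak p}$. A triangulated category is minimal if each of its thick subcategories is either $0$ or the whole category. $\mathsf{T}$ is stratified by the action of $R$ if $\varGamma_{\mathfrak p}\mathsf{T}$ is minimal for each $\mathfrak p\in\operatorname{Spec}R$. *)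

theory Defs
  imports "HOL-Algebra.Ring_Divisibility" "HOL-Algebra.Module"
begin

section \<open>Graded commutative rings\<close>

text \<open>Rings are graded internally: \<open>G n\<close> is the subgroup of elements of degree \<open>n\<close>.\<close>

locale graded_ring = ring R for R (structure) +
  fixes G :: "int \<Rightarrow> 'a set"
  assumes homogeneous_subgroup: "\<And>n. additive_subgroup (G n) R"
    and homogeneous_mult: "\<And>m n r s. r \<in> G m \<Longrightarrow> s \<in> G n \<Longrightarrow> r \<otimes> s \<in> G (m + n)"
    and homogeneous_one: "\<one> \<in> G 0"
    and homogeneous_decomposition:
      "\<And>x. x \<in> carrier R \<Longrightarrow>
        \<exists>!c. (\<forall>n. c n \<in> G n) \<and> finite {n. c n \<noteq> \<zero>} \<and> x = (\<Oplus>n\<in>{n. c n \<noteq> \<zero>}. c n)"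

locale graded_commutative_ring = graded_ring +
  assumes graded_commutative:
    "\<And>m n r s. r \<in> G m \<Longrightarrow> s \<in> G n \<Longrightarrow>
      r \<otimes> s = (if even (m * n) then s \<otimes> r else \<ominus> (s \<otimes> r))"

definition homogeneous_ideal :: "('r, 'k) ring_scheme \<Rightarrow> (int \<Rightarrow> 'r set) \<Rightarrow> 'r set \<Rightarrow> bool" where
  "homogeneous_ideal R G I \<longleftrightarrow> ideal I R \<and> I = Idl\<^bsub>R\<^esub> (I \<inter> (\<Union>n. G n))"

text \<open>The conditions on \<open>P\<close> besides homogeneity are those of the locale \<^locale>\<open>primeideal\<close>,
  which cannot be used itself because it requires the ring to be strictly commutative. It makes no
  difference whether primality is tested on all elements or on the homogeneous ones.\<close>

definition Spec :: "('r, 'k) ring_scheme \<Rightarrow> (int \<Rightarrow> 'r set) \<Rightarrow> 'r set set" where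
  "Spec R G = {P. homogeneous_ideal R G P \<and> P \<noteq> carrier R \<and>
     (\<forall>a\<in>carrier R. \<forall>b\<in>carrier R. a \<otimes>\<^bsub>R\<^esub> b \<in> P \<longrightarrow> a \<in> P \<or> b \<in> P)}"

definition homogeneous_generators ::
  "('r, 'k) ring_scheme \<Rightarrow> (int \<Rightarrow> 'r set) \<Rightarrow> 'r set \<Rightarrow> (int \<times> 'r) list \<Rightarrow> bool" where
  "homogeneous_generators R G I ds \<longleftrightarrow>
     (\<forall>(d, r)\<in>set ds. r \<in> G d) \<and> I = Idl\<^bsub>R\<^esub> (snd ` set ds)"


section \<open>Modules over graded commutative rings\<close>

text \<open>The library's \<^locale>\<open>module\<close> locale asks for a strictly commutative ring, so only its record
  type is used.\<close>

definition fin_gen_module :: "('r, 'k) ring_scheme \<Rightarrow> ('r, 'x, 'l) module_scheme \<Rightarrow> bool" where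
  "fin_gen_module R M \<longleftrightarrow> (\<exists>A. finite A \<and> A \<subseteq> carrier M \<and>
     (\<forall>x\<in>carrier M. \<exists>c\<in>A \<rightarrow> carrier R. x = (\<Oplus>\<^bsub>M\<^esub>a\<in>A. c a \<odot>\<^bsub>M\<^esub> a)))"

text \<open>The localisation \<open>M\<^sub>\<pp>\<close> inverts the homogeneous elements outside \<open>\<pp>\<close>. The pair
  \<open>(m, s)\<close> stands for \<open>s\<^sup>-\<^sup>1 m\<close>. Elements of odd degree commute only up to sign, so two fractions are
  compared as in an Ore localisation, by expanding them to a common denominator on the left.\<close>

definition loc_denominators :: "(int \<Rightarrow> 'r set) \<Rightarrow> 'r set \<Rightarrow> 'r set" where
  "loc_denominators G P = (\<Union>n. G n) - P"

definition loc_rel :: "('r, 'k) ring_scheme \<Rightarrow> (int \<Rightarrow> 'r set) \<Rightarrow> ('r, 'x, 'l) module_scheme \<Rightarrow> 'r set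
    \<Rightarrow> (('x \<times> 'r) \<times> ('x \<times> 'r)) set" where
  "loc_rel R G M P = {((m, s), (m', s')).
     m \<in> carrier M \<and> m' \<in> carrier M \<and> s \<in> loc_denominators G P \<and> s' \<in> loc_denominators G P \<and>
     (\<exists>u\<in>carrier R. \<exists>u'\<in>carrier R.
        u \<otimes>\<^bsub>R\<^esub> s = u' \<otimes>\<^bsub>R\<^esub> s' \<and> u \<otimes>\<^bsub>R\<^esub> s \<in> loc_denominators G P \<and> u \<odot>\<^bsub>M\<^esub> m = u' \<odot>\<^bsub>M\<^esub> m')}"

definition localisation :: "('r, 'k) ring_scheme \<Rightarrow> (int \<Rightarrow> 'r set) \<Rightarrow> ('r, 'x, 'l) module_scheme
    \<Rightarrow> 'r set \<Rightarrow> ('x \<times> 'r) set set" where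
  "localisation R G M P = (carrier M \<times> loc_denominators G P) // loc_rel R G M P"

definition localisation_zero :: "('r, 'k) ring_scheme \<Rightarrow> (int \<Rightarrow> 'r set) \<Rightarrow> ('r, 'x, 'l) module_scheme
    \<Rightarrow> 'r set \<Rightarrow> ('x \<times> 'r) set" where
  "localisation_zero R G M P = loc_rel R G M P `` {(\<zero>\<^bsub>M\<^esub>, \<one>\<^bsub>R\<^esub>)}"

definition localisation_vanishes :: "('r, 'k) ring_scheme \<Rightarrow> (int \<Rightarrow> 'r set)
    \<Rightarrow> ('r, 'x, 'l) module_scheme \<Rightarrow> 'r set \<Rightarrow> bool" where
  "localisation_vanishes R G M P \<longleftrightarrow> localisation R G M P = {localisation_zero R G M P}"


section \<open>Triangulated categories\<close>

text \<open>Objects and arrows are the elements of two sets, so every category here is small.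
  \<open>Add\<close> is the addition of parallel arrows, \<open>Zer X Y\<close> the zero arrow \<open>X \<rightarrow> Y\<close>, \<open>ShO\<close> and \<open>ShA\<close> are
  the suspension on objects and arrows. A triple \<open>(f, g, h)\<close> in \<open>Tri\<close> is the exact triangle
  \<open>X \<rightarrow> Y \<rightarrow> Z \<rightarrow> \<Sigma>X\<close> with these three arrows.\<close>

record ('o, 'm) tcat =
  Obj :: "'o set"
  Arr :: "'m set"
  Dom :: "'m \<Rightarrow> 'o"
  Cod :: "'m \<Rightarrow> 'o"
  Ide :: "'o \<Rightarrow> 'm"
  Cmp :: "'m \<Rightarrow> 'm \<Rightarrow> 'm" (infixl "\<cdot>\<index>" 70)
  Add :: "'m \<Rightarrow> 'm \<Rightarrow> 'm"
  Zer :: "'o \<Rightarrow> 'o \<Rightarrow> 'm"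
  ShO :: "'o \<Rightarrow> 'o"
  ShA :: "'m \<Rightarrow> 'm"
  Tri :: "('m \<times> 'm \<times> 'm) set"

definition Hom :: "('o, 'm) tcat \<Rightarrow> 'o \<Rightarrow> 'o \<Rightarrow> 'm set" where
  "Hom C X Y = {f \<in> Arr C. Dom C f = X \<and> Cod C f = Y}"

text \<open>Only the additive structure of this record is meaningful.\<close>

definition hom_group :: "('o, 'm) tcat \<Rightarrow> 'o \<Rightarrow> 'o \<Rightarrow> 'm ring" where
  "hom_group C X Y =
     \<lparr>carrier = Hom C X Y, mult = undefined, one = undefined, zero = Zer C X Y, add = Add C\<rparr>"

definition neg :: "('o, 'm) tcat \<Rightarrow> 'm \<Rightarrow> 'm" where
  "neg C f = \<ominus>\<^bsub>hom_group C (Dom C f) (Cod C f)\<^esub> f"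

definition is_iso :: "('o, 'm) tcat \<Rightarrow> 'm \<Rightarrow> bool" where
  "is_iso C f \<longleftrightarrow> f \<in> Arr C \<and>
     (\<exists>g\<in>Hom C (Cod C f) (Dom C f). g \<cdot>\<^bsub>C\<^esub> f = Ide C (Dom C f) \<and> f \<cdot>\<^bsub>C\<^esub> g = Ide C (Cod C f))"

definition zero_obj :: "('o, 'm) tcat \<Rightarrow> 'o \<Rightarrow> bool" where
  "zero_obj C Z \<longleftrightarrow> Z \<in> Obj C \<and>
     (\<forall>X\<in>Obj C. (\<exists>!f. f \<in> Hom C Z X) \<and> (\<exists>!f. f \<in> Hom C X Z))"

definition is_biproduct :: "('o, 'm) tcat \<Rightarrow> 'o \<Rightarrow> 'o \<Rightarrow> 'o \<Rightarrow> bool" where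
  "is_biproduct C X Y B \<longleftrightarrow> X \<in> Obj C \<and> Y \<in> Obj C \<and> B \<in> Obj C \<and>
     (\<exists>i\<in>Hom C X B. \<exists>j\<in>Hom C Y B. \<exists>p\<in>Hom C B X. \<exists>q\<in>Hom C B Y.
        p \<cdot>\<^bsub>C\<^esub> i = Ide C X \<and> q \<cdot>\<^bsub>C\<^esub> j = Ide C Y \<and>
        q \<cdot>\<^bsub>C\<^esub> i = Zer C X Y \<and> p \<cdot>\<^bsub>C\<^esub> j = Zer C Y X \<and>
        Add C (i \<cdot>\<^bsub>C\<^esub> p) (j \<cdot>\<^bsub>C\<^esub> q) = Ide C B)"

locale additive_category =
  fixes C :: "('o, 'm) tcat" (structure)
  assumes Dom_Obj: "f \<in> Arr C \<Longrightarrow> Dom C f \<in> Obj C"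
    and Cod_Obj: "f \<in> Arr C \<Longrightarrow> Cod C f \<in> Obj C"
    and Ide_Hom: "X \<in> Obj C \<Longrightarrow> Ide C X \<in> Hom C X X"
    and Cmp_Hom: "f \<in> Hom C X Y \<Longrightarrow> g \<in> Hom C Y Z \<Longrightarrow> g \<cdot> f \<in> Hom C X Z"
    and Cmp_Ide_left: "f \<in> Hom C X Y \<Longrightarrow> Ide C Y \<cdot> f = f"
    and Cmp_Ide_right: "f \<in> Hom C X Y \<Longrightarrow> f \<cdot> Ide C X = f"
    and Cmp_assoc: "f \<in> Hom C W X \<Longrightarrow> g \<in> Hom C X Y \<Longrightarrow> h \<in> Hom C Y Z \<Longrightarrow>
      (h \<cdot> g) \<cdot> f = h \<cdot> (g \<cdot> f)"
    and hom_abelian_group: "X \<in> Obj C \<Longrightarrow> Y \<in> Obj C \<Longrightarrow> abelian_group (hom_group C X Y)"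
    and Cmp_Add_left: "f \<in> Hom C X Y \<Longrightarrow> g \<in> Hom C Y Z \<Longrightarrow> g' \<in> Hom C Y Z \<Longrightarrow>
      Add C g g' \<cdot> f = Add C (g \<cdot> f) (g' \<cdot> f)"
    and Cmp_Add_right: "f \<in> Hom C X Y \<Longrightarrow> f' \<in> Hom C X Y \<Longrightarrow> g \<in> Hom C Y Z \<Longrightarrow>
      g \<cdot> Add C f f' = Add C (g \<cdot> f) (g \<cdot> f')"
    and zero_obj_exists: "\<exists>Z. zero_obj C Z"
    and biproduct_exists: "X \<in> Obj C \<Longrightarrow> Y \<in> Obj C \<Longrightarrow> \<exists>B. is_biproduct C X Y B"

definition tri_iso :: "('o, 'm) tcat \<Rightarrow> 'm \<times> 'm \<times> 'm \<Rightarrow> 'm \<times> 'm \<times> 'm \<Rightarrow> bool" where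
  "tri_iso C = (\<lambda>(f, g, h) (f', g', h').
     f' \<in> Arr C \<and> g' \<in> Hom C (Cod C f') (Dom C h') \<and> h' \<in> Hom C (Cod C g') (ShO C (Dom C f')) \<and>
     (\<exists>a b c. is_iso C a \<and> is_iso C b \<and> is_iso C c \<and>
        a \<in> Hom C (Dom C f) (Dom C f') \<and> b \<in> Hom C (Cod C f) (Cod C f') \<and>
        c \<in> Hom C (Cod C g) (Cod C g') \<and>
        b \<cdot>\<^bsub>C\<^esub> f = f' \<cdot>\<^bsub>C\<^esub> a \<and> c \<cdot>\<^bsub>C\<^esub> g = g' \<cdot>\<^bsub>C\<^esub> b \<and> ShA C a \<cdot>\<^bsub>C\<^esub> h = h' \<cdot>\<^bsub>C\<^esub> c))"

text \<open>The suspension is an automorphism, not merely an equivalence: the powers \<open>\<Sigma>\<^sup>n\<close> with \<open>n < 0\<close> and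
  the equation \<open>\<eta>\<Sigma> = (-1)\<^sup>n \<Sigma>\<eta>\<close> in the graded centre are meant on the nose.\<close>

locale triangulated_category = additive_category +
  assumes ShO_bij: "bij_betw (ShO C) (Obj C) (Obj C)"
    and ShA_bij: "bij_betw (ShA C) (Arr C) (Arr C)"
    and ShA_Hom: "f \<in> Hom C X Y \<Longrightarrow> ShA C f \<in> Hom C (ShO C X) (ShO C Y)"
    and ShA_Ide: "X \<in> Obj C \<Longrightarrow> ShA C (Ide C X) = Ide C (ShO C X)"
    and ShA_Cmp: "f \<in> Hom C X Y \<Longrightarrow> g \<in> Hom C Y Z \<Longrightarrow> ShA C (g \<cdot> f) = ShA C g \<cdot> ShA C f"
    and ShA_Add: "f \<in> Hom C X Y \<Longrightarrow> f' \<in> Hom C X Y \<Longrightarrow>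
      ShA C (Add C f f') = Add C (ShA C f) (ShA C f')"
    and Tri_typed: "(f, g, h) \<in> Tri C \<Longrightarrow>
      f \<in> Arr C \<and> g \<in> Hom C (Cod C f) (Dom C h) \<and> h \<in> Hom C (Cod C g) (ShO C (Dom C f))"
    and Tri_iso_closed: "t \<in> Tri C \<Longrightarrow> tri_iso C t t' \<Longrightarrow> t' \<in> Tri C"
    and Tri_Ide: "X \<in> Obj C \<Longrightarrow> zero_obj C Z \<Longrightarrow>
      (Ide C X, Zer C X Z, Zer C Z (ShO C X)) \<in> Tri C"
    and Tri_exists: "f \<in> Arr C \<Longrightarrow> \<exists>g h. (f, g, h) \<in> Tri C"
    and Tri_rotate: "f \<in> Arr C \<Longrightarrow> g \<in> Hom C (Cod C f) (Dom C h) \<Longrightarrow>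
      h \<in> Hom C (Cod C g) (ShO C (Dom C f)) \<Longrightarrow>
      (f, g, h) \<in> Tri C \<longleftrightarrow> (g, h, neg C (ShA C f)) \<in> Tri C"
    and Tri_fill: "(f, g, h) \<in> Tri C \<Longrightarrow> (f', g', h') \<in> Tri C \<Longrightarrow>
      a \<in> Hom C (Dom C f) (Dom C f') \<Longrightarrow> b \<in> Hom C (Cod C f) (Cod C f') \<Longrightarrow> b \<cdot> f = f' \<cdot> a \<Longrightarrow>
      \<exists>c\<in>Hom C (Cod C g) (Cod C g'). c \<cdot> g = g' \<cdot> b \<and> ShA C a \<cdot> h = h' \<cdot> c"
    and Tri_octahedral: "(f, f1, f2) \<in> Tri C \<Longrightarrow> (g, g1, g2) \<in> Tri C \<Longrightarrow> Cod C f = Dom C g \<Longrightarrow>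
      (g \<cdot> f, h1, h2) \<in> Tri C \<Longrightarrow>
      \<exists>u\<in>Hom C (Cod C f1) (Cod C h1). \<exists>v\<in>Hom C (Cod C h1) (Cod C g1).
        (u, v, ShA C f1 \<cdot> g2) \<in> Tri C \<and>
        u \<cdot> f1 = h1 \<cdot> g \<and> h2 \<cdot> u = f2 \<and> v \<cdot> h1 = g1 \<and> g2 \<cdot> v = ShA C f \<cdot> h2"

definition thick :: "('o, 'm) tcat \<Rightarrow> 'o set \<Rightarrow> bool" where
  "thick C S \<longleftrightarrow> S \<subseteq> Obj C \<and> (\<forall>Z. zero_obj C Z \<longrightarrow> Z \<in> S) \<and>
     (\<forall>X\<in>Obj C. X \<in> S \<longleftrightarrow> ShO C X \<in> S) \<and>
     (\<forall>(f, g, h)\<in>Tri C. Dom C f \<in> S \<longrightarrow> Cod C f \<in> S \<longrightarrow> Cod C g \<in> S) \<and>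
     (\<forall>X Y B. is_biproduct C X Y B \<longrightarrow> B \<in> S \<longrightarrow> X \<in> S)"

definition Thick :: "('o, 'm) tcat \<Rightarrow> 'o \<Rightarrow> 'o set" where
  "Thick C X = \<Inter>{S. thick C S \<and> X \<in> S}"

definition full_sub :: "('o, 'm) tcat \<Rightarrow> 'o set \<Rightarrow> ('o, 'm) tcat" where
  "full_sub C S = (let A = {f \<in> Arr C. Dom C f \<in> S \<and> Cod C f \<in> S} in
     C\<lparr>Obj := S, Arr := A, Tri := Tri C \<inter> A \<times> A \<times> A\<rparr>)"

definition minimal_tcat :: "('o, 'm) tcat \<Rightarrow> bool" where
  "minimal_tcat C \<longleftrightarrow> (\<forall>S. thick C S \<longrightarrow> S = {Z. zero_obj C Z} \<or> S = Obj C)"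

definition cone :: "('o, 'm) tcat \<Rightarrow> 'm \<Rightarrow> 'o" where
  "cone C f = (SOME Z. \<exists>g h. (f, g, h) \<in> Tri C \<and> Z = Cod C g)"


section \<open>Verdier quotients\<close>

text \<open>The quotient by \<open>S\<close> has the same objects. An arrow \<open>X \<rightarrow> Y\<close> is a class of roofs
  \<open>X \<leftarrow> W \<rightarrow> Y\<close>, where the cone of the left leg lies in \<open>S\<close>; a roof is the pair of its legs, left
  leg first.\<close>

definition weak_eq :: "('o, 'm) tcat \<Rightarrow> 'o set \<Rightarrow> 'm set" where
  "weak_eq C S = {s. \<exists>g h. (s, g, h) \<in> Tri C \<and> Cod C g \<in> S}"

definition roofs :: "('o, 'm) tcat \<Rightarrow> 'o set \<Rightarrow> ('m \<times> 'm) set" where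
  "roofs C S = {(s, f). s \<in> weak_eq C S \<and> f \<in> Arr C \<and> Dom C f = Dom C s}"

definition roof_rel :: "('o, 'm) tcat \<Rightarrow> 'o set \<Rightarrow> (('m \<times> 'm) \<times> ('m \<times> 'm)) set" where
  "roof_rel C S = {((s, f), (t, g)). (s, f) \<in> roofs C S \<and> (t, g) \<in> roofs C S \<and>
     (\<exists>W. \<exists>u\<in>Hom C W (Dom C s). \<exists>v\<in>Hom C W (Dom C t).
        s \<cdot>\<^bsub>C\<^esub> u = t \<cdot>\<^bsub>C\<^esub> v \<and> s \<cdot>\<^bsub>C\<^esub> u \<in> weak_eq C S \<and> f \<cdot>\<^bsub>C\<^esub> u = g \<cdot>\<^bsub>C\<^esub> v)}"

definition roof_class :: "('o, 'm) tcat \<Rightarrow> 'o set \<Rightarrow> 'm \<Rightarrow> 'm \<Rightarrow> ('m \<times> 'm) set" where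
  "roof_class C S s f = roof_rel C S `` {(s, f)}"

definition quotient_arr :: "('o, 'm) tcat \<Rightarrow> 'o set \<Rightarrow> 'm \<Rightarrow> ('m \<times> 'm) set" where
  "quotient_arr C S f = roof_class C S (Ide C (Dom C f)) f"

text \<open>Before closing the triangles under isomorphism, those of the quotient are the images of
  the exact triangles of \<open>C\<close>.\<close>

definition verdier_pre :: "('o, 'm) tcat \<Rightarrow> 'o set \<Rightarrow> ('o, ('m \<times> 'm) set) tcat" where
  "verdier_pre C S = \<lparr>
     Obj = Obj C,
     Arr = roofs C S // roof_rel C S,
     Dom = (\<lambda>a. Cod C (fst (SOME r. r \<in> a))),
     Cod = (\<lambda>a. Cod C (snd (SOME r. r \<in> a))),
     Ide = (\<lambda>X. quotient_arr C S (Ide C X)),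
     Cmp = (\<lambda>b a. \<Union>{roof_class C S (s \<cdot>\<^bsub>C\<^esub> u) (g \<cdot>\<^bsub>C\<^esub> v) | s f t g u v.
              (s, f) \<in> a \<and> (t, g) \<in> b \<and> Cod C f = Cod C t \<and>
              u \<in> weak_eq C S \<and> u \<in> Hom C (Dom C v) (Dom C f) \<and> v \<in> Hom C (Dom C u) (Dom C t) \<and>
              f \<cdot>\<^bsub>C\<^esub> u = t \<cdot>\<^bsub>C\<^esub> v}),
     Add = (\<lambda>a b. \<Union>{roof_class C S s (Add C f g) | s f g.
              (s, f) \<in> a \<and> (s, g) \<in> b \<and> Cod C f = Cod C g}),
     Zer = (\<lambda>X Y. quotient_arr C S (Zer C X Y)),
     ShO = ShO C,
     ShA = (\<lambda>a. map_prod (ShA C) (ShA C) ` a),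
     Tri = {(quotient_arr C S f, quotient_arr C S g, quotient_arr C S h) | f g h. (f, g, h) \<in> Tri C}\<rparr>"

definition verdier :: "('o, 'm) tcat \<Rightarrow> 'o set \<Rightarrow> ('o, ('m \<times> 'm) set) tcat" where
  "verdier C S = (let Q = verdier_pre C S in Q\<lparr>Tri := {t'. \<exists>t\<in>Tri Q. tri_iso Q t t'}\<rparr>)"


section \<open>Graded centre and graded endomorphism rings\<close>

definition ShO_pow :: "('o, 'm) tcat \<Rightarrow> int \<Rightarrow> 'o \<Rightarrow> 'o" where
  "ShO_pow C n X =
     (if 0 \<le> n then (ShO C ^^ nat n) X else (inv_into (Obj C) (ShO C) ^^ nat (- n)) X)"

definition ShA_pow :: "('o, 'm) tcat \<Rightarrow> int \<Rightarrow> 'm \<Rightarrow> 'm" where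
  "ShA_pow C n f =
     (if 0 \<le> n then (ShA C ^^ nat n) f else (inv_into (Arr C) (ShA C) ^^ nat (- n)) f)"

text \<open>An element of a direct sum over the degrees is the family of its homogeneous components.
  For homogeneous \<open>f : X \<rightarrow> \<Sigma>\<^sup>jX\<close> and \<open>g : X \<rightarrow> \<Sigma>\<^sup>iX\<close> the product \<open>g f\<close> is \<open>\<Sigma>\<^sup>j(g) \<circ> f\<close>.\<close>

definition graded_cmp :: "('o, 'm) tcat \<Rightarrow> 'o \<Rightarrow> (int \<Rightarrow> 'm) \<Rightarrow> (int \<Rightarrow> 'm) \<Rightarrow> int \<Rightarrow> 'm" where
  "graded_cmp C X g f = (\<lambda>k. \<Oplus>\<^bsub>hom_group C X (ShO_pow C k X)\<^esub> j \<in> {j. f j \<noteq> Zer C X (ShO_pow C j X)}.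
     ShA_pow C j (g (k - j)) \<cdot>\<^bsub>C\<^esub> f j)"

definition graded_one :: "('o, 'm) tcat \<Rightarrow> 'o \<Rightarrow> int \<Rightarrow> 'm" where
  "graded_one C X = (\<lambda>k. if k = 0 then Ide C X else Zer C X (ShO_pow C k X))"

definition centre_degree :: "('o, 'm) tcat \<Rightarrow> int \<Rightarrow> ('o \<Rightarrow> 'm) set" where
  "centre_degree C n = {\<eta> \<in> (\<Pi>\<^sub>E X\<in>Obj C. Hom C X (ShO_pow C n X)).
     (\<forall>f\<in>Arr C. ShA_pow C n f \<cdot>\<^bsub>C\<^esub> \<eta> (Dom C f) = \<eta> (Cod C f) \<cdot>\<^bsub>C\<^esub> f) \<and>
     (\<forall>X\<in>Obj C. \<eta> (ShO C X) = (if even n then ShA C (\<eta> X) else neg C (ShA C (\<eta> X))))}"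

definition graded_centre :: "('o, 'm) tcat \<Rightarrow> (int \<Rightarrow> 'o \<Rightarrow> 'm) ring" where
  "graded_centre C = \<lparr>
     carrier = {\<eta>. (\<forall>n. \<eta> n \<in> centre_degree C n) \<and>
                   finite {n. \<exists>X\<in>Obj C. \<eta> n X \<noteq> Zer C X (ShO_pow C n X)}},
     mult = (\<lambda>\<eta> \<theta> n. \<lambda>X\<in>Obj C. graded_cmp C X (\<lambda>i. \<eta> i X) (\<lambda>j. \<theta> j X) n),
     one = (\<lambda>n. \<lambda>X\<in>Obj C. graded_one C X n),
     zero = (\<lambda>n. \<lambda>X\<in>Obj C. Zer C X (ShO_pow C n X)),
     add = (\<lambda>\<eta> \<theta> n. \<lambda>X\<in>Obj C. Add C (\<eta> n X) (\<theta> n X))\<rparr>"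

text \<open>The ring \<open>End\<^sup>*(X)\<close> with the \<open>R\<close>-action induced by \<open>\<phi> : R \<rightarrow> Z\<^sup>*(C)\<close>; here \<open>\<phi> r n X\<close> is the value
  at \<open>X\<close> of the degree \<open>n\<close> component of \<open>\<phi> r\<close>.\<close>

definition End_star :: "('o, 'm) tcat \<Rightarrow> ('r \<Rightarrow> int \<Rightarrow> 'o \<Rightarrow> 'm) \<Rightarrow> 'o \<Rightarrow> ('r, int \<Rightarrow> 'm) module" where
  "End_star C \<phi> X = \<lparr>
     carrier = {f. (\<forall>n. f n \<in> Hom C X (ShO_pow C n X)) \<and> finite {n. f n \<noteq> Zer C X (ShO_pow C n X)}},
     mult = graded_cmp C X,
     one = graded_one C X,
     zero = (\<lambda>n. Zer C X (ShO_pow C n X)),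
     add = (\<lambda>f g n. Add C (f n) (g n)),
     smult = (\<lambda>r f. graded_cmp C X (\<lambda>n. \<phi> r n X) f)\<rparr>"

locale linear_triangulated_category =
  graded_commutative_ring R G + triangulated_category C
  for R :: "('r, 'k) ring_scheme" (structure) and G :: "int \<Rightarrow> 'r set"
    and C :: "('o, 'm) tcat" +
  fixes \<phi> :: "'r \<Rightarrow> int \<Rightarrow> 'o \<Rightarrow> 'm"
  assumes action_hom: "\<phi> \<in> ring_hom R (graded_centre C)"
    and action_degree: "\<And>d r n X. r \<in> G d \<Longrightarrow> n \<noteq> d \<Longrightarrow> X \<in> Obj C \<Longrightarrow>
      \<phi> r n X = Zer C X (ShO_pow C n X)"

definition quotient_action ::
  "('o, 'm) tcat \<Rightarrow> 'o set \<Rightarrow> ('r \<Rightarrow> int \<Rightarrow> 'o \<Rightarrow> 'm) \<Rightarrow> 'r \<Rightarrow> int \<Rightarrow> 'o \<Rightarrow> ('m \<times> 'm) set" where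
  "quotient_action C S \<phi> = (\<lambda>r n. \<lambda>X\<in>Obj C. quotient_arr C S (\<phi> r n X))"


section \<open>Localisation, support and stratification\<close>

text \<open>The arguments \<open>R G C \<phi>\<close> below are the graded ring \<open>R\<close> with its grading \<open>G\<close> and the triangulated
  category \<open>C\<close> with its \<open>R\<close>-action \<open>\<phi>\<close>.\<close>

definition local_kernel :: "('r, 'k) ring_scheme \<Rightarrow> (int \<Rightarrow> 'r set) \<Rightarrow> ('o, 'm) tcat
    \<Rightarrow> ('r \<Rightarrow> int \<Rightarrow> 'o \<Rightarrow> 'm) \<Rightarrow> 'r set \<Rightarrow> 'o set" where
  "local_kernel R G C \<phi> P =
     {X \<in> Obj C. \<forall>Q\<in>Spec R G. Q \<subseteq> P \<longrightarrow> localisation_vanishes R G (End_star C \<phi> X) Q}"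

definition local_cat :: "('r, 'k) ring_scheme \<Rightarrow> (int \<Rightarrow> 'r set) \<Rightarrow> ('o, 'm) tcat
    \<Rightarrow> ('r \<Rightarrow> int \<Rightarrow> 'o \<Rightarrow> 'm) \<Rightarrow> 'r set \<Rightarrow> ('o, ('m \<times> 'm) set) tcat" where
  "local_cat R G C \<phi> P = verdier C (local_kernel R G C \<phi> P)"

definition local_action :: "('r, 'k) ring_scheme \<Rightarrow> (int \<Rightarrow> 'r set) \<Rightarrow> ('o, 'm) tcat
    \<Rightarrow> ('r \<Rightarrow> int \<Rightarrow> 'o \<Rightarrow> 'm) \<Rightarrow> 'r set \<Rightarrow> 'r \<Rightarrow> int \<Rightarrow> 'o \<Rightarrow> ('m \<times> 'm) set" where
  "local_action R G C \<phi> P = quotient_action C (local_kernel R G C \<phi> P) \<phi>"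

primrec koszul_list ::
  "('o, 'm) tcat \<Rightarrow> ('r \<Rightarrow> int \<Rightarrow> 'o \<Rightarrow> 'm) \<Rightarrow> 'o \<Rightarrow> (int \<times> 'r) list \<Rightarrow> 'o" where
  "koszul_list C \<phi> X [] = X"
| "koszul_list C \<phi> X (dr # ds) = koszul_list C \<phi> (cone C (\<phi> (snd dr) (fst dr) X)) ds"

definition koszul :: "('r, 'k) ring_scheme \<Rightarrow> (int \<Rightarrow> 'r set) \<Rightarrow> ('o, 'm) tcat
    \<Rightarrow> ('r \<Rightarrow> int \<Rightarrow> 'o \<Rightarrow> 'm) \<Rightarrow> 'o \<Rightarrow> 'r set \<Rightarrow> 'o" where
  "koszul R G C \<phi> X I = koszul_list C \<phi> X (SOME ds. homogeneous_generators R G I ds)"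

text \<open>The quotient functor is the identity on objects, so \<open>X\<close> also denotes its image \<open>X\<^sub>\<pp>\<close>.\<close>

definition koszul_at :: "('r, 'k) ring_scheme \<Rightarrow> (int \<Rightarrow> 'r set) \<Rightarrow> ('o, 'm) tcat
    \<Rightarrow> ('r \<Rightarrow> int \<Rightarrow> 'o \<Rightarrow> 'm) \<Rightarrow> 'o \<Rightarrow> 'r set \<Rightarrow> 'o" where
  "koszul_at R G C \<phi> X P = koszul R G (local_cat R G C \<phi> P) (local_action R G C \<phi> P) X P"

definition supp :: "('r, 'k) ring_scheme \<Rightarrow> (int \<Rightarrow> 'r set) \<Rightarrow> ('o, 'm) tcat
    \<Rightarrow> ('r \<Rightarrow> int \<Rightarrow> 'o \<Rightarrow> 'm) \<Rightarrow> 'o \<Rightarrow> 'r set set" where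
  "supp R G C \<phi> X =
     {P \<in> Spec R G. \<not> zero_obj (local_cat R G C \<phi> P) (koszul_at R G C \<phi> X P)}"

definition Gamma_obj :: "('r, 'k) ring_scheme \<Rightarrow> (int \<Rightarrow> 'r set) \<Rightarrow> ('o, 'm) tcat
    \<Rightarrow> ('r \<Rightarrow> int \<Rightarrow> 'o \<Rightarrow> 'm) \<Rightarrow> 'r set \<Rightarrow> 'o set" where
  "Gamma_obj R G C \<phi> P =
     {X \<in> Obj (local_cat R G C \<phi> P). \<forall>Q\<in>Spec R G. \<not> P \<subseteq> Q \<longrightarrow>
        localisation_vanishes R G (End_star (local_cat R G C \<phi> P) (local_action R G C \<phi> P) X) Q}"

definition Gamma :: "('r, 'k) ring_scheme \<Rightarrow> (int \<Rightarrow> 'r set) \<Rightarrow> ('o, 'm) tcat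
    \<Rightarrow> ('r \<Rightarrow> int \<Rightarrow> 'o \<Rightarrow> 'm) \<Rightarrow> 'r set \<Rightarrow> ('o, ('m \<times> 'm) set) tcat" where
  "Gamma R G C \<phi> P = full_sub (local_cat R G C \<phi> P) (Gamma_obj R G C \<phi> P)"

definition stratified :: "('r, 'k) ring_scheme \<Rightarrow> (int \<Rightarrow> 'r set) \<Rightarrow> ('o, 'm) tcat
    \<Rightarrow> ('r \<Rightarrow> int \<Rightarrow> 'o \<Rightarrow> 'm) \<Rightarrow> bool" where
  "stratified R G C \<phi> \<longleftrightarrow> (\<forall>P\<in>Spec R G. minimal_tcat (Gamma R G C \<phi> P))"

end

theory Submission
  imports Defs
begin

text \<open>
  Let \<open>\<pp>\<close> be a prime such that \<open>\<Gamma>\<^sub>\<pp> T\<close> has a thick subcategory \<open>S\<close> that is neither zero nor everything,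
  and choose \<open>X' \<noteq> 0\<close> in \<open>S\<close> and \<open>Y'\<close> in \<open>\<Gamma>\<^sub>\<pp> T\<close> outside \<open>S\<close>. Both are objects of \<open>T\<close>; put
  \<open>X = X'//\<pp>\<close> and \<open>Y = Y'//\<pp>\<close>, formed in \<open>T\<close>. An object and its Koszul object on \<open>\<pp>\<close> generate the same
  thick subcategory of \<open>T\<^sub>\<pp>\<close> if the object is \<open>\<pp>\<close>-torsion, so \<open>X\<close> and \<open>Y\<close> are nonzero at \<open>\<pp>\<close>; as the
  elements of \<open>\<pp>\<close> act nilpotently on them, both have support \<open>{\<qq>. \<pp> \<subseteq> \<qq>}\<close>. The preimage of \<open>S\<close> in
  \<open>T\<close> is thick and contains \<open>X\<close> but not \<open>Y\<close>.

  Finite generation enters only through Nakayama's lemma, which shows that \<open>X(\<pp>) = 0\<close> exactly if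
  \<open>X\<^sub>\<pp> = 0\<close>, that is, if some homogeneous element outside \<open>\<pp>\<close> acts as zero on \<open>X\<close>. The local
  categories are used only as additive categories with suspension; all triangles are taken in \<open>T\<close>.
\<close>

section \<open>Homogeneous ideals and primes\<close>

text \<open>That the local categories are triangulated is never proved. Instead, an arrow vanishes
  in the quotient at P exactly if a homogeneous element outside P annihilates it; by this criterion
  vanishing at P, support and torsion all say that some element of a multiplicative set kills an
  object of T (\<open>kernel\<close>), and one lemma makes all these classes thick. Koszul objects
  are needed because an object that is torsion in the local category at P is arbitrary at primes not
  contained in P, so X' and Y' themselves may have different supports; taking cones on P in T
  removes the primes that do not contain P, and vanishing at a prime containing P would imply
  vanishing at P. Two obstacles shape the details. The definition of support takes cones chosen
  inside the quotient, which must be compared with cones of T. And odd elements commute only up to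
  sign, so ideals are two-sided, primes come from Zorn's lemma applied to graded ideals, and
  Nakayama's lemma is proved by eliminating generators. Exact signs are mostly left open, since only
  vanishing or membership in an ideal is asked.\<close>

context graded_ring
begin

lemma G_carrier: "x \<in> G n \<Longrightarrow> x \<in> carrier R"
  using additive_subgroup.a_subset[OF homogeneous_subgroup] by blast

lemma G_zero: "\<zero> \<in> G n"
  using additive_subgroup.zero_closed[OF homogeneous_subgroup] .

lemma G_add: "x \<in> G n \<Longrightarrow> y \<in> G n \<Longrightarrow> x \<oplus> y \<in> G n"
  using additive_subgroup.a_closed[OF homogeneous_subgroup] .

lemma G_minus: "x \<in> G n \<Longrightarrow> \<ominus> x \<in> G n"
  using additive_subgroup.a_inv_closed[OF homogeneous_subgroup] by (simp add: a_inv_def)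

section \<open>Homogeneous components of ring elements\<close>

definition component :: "'a \<Rightarrow> int \<Rightarrow> 'a" where
  "component x = (THE c. (\<forall>n. c n \<in> G n) \<and> finite {n. c n \<noteq> \<zero>} \<and> x = (\<Oplus>n\<in>{n. c n \<noteq> \<zero>}. c n))"

lemma component_spec:
  assumes "x \<in> carrier R"
  shows "component x n \<in> G n" "finite {n. component x n \<noteq> \<zero>}"
    "x = (\<Oplus>n\<in>{n. component x n \<noteq> \<zero>}. component x n)"
  using theI'[OF homogeneous_decomposition[OF assms]] unfolding component_def by blast+

lemma finsum_support:
  assumes "finite B" "{n. c n \<noteq> \<zero>} \<subseteq> B" "\<And>n. c n \<in> carrier R"
  shows "(\<Oplus>n\<in>B. c n) = (\<Oplus>n\<in>{n. c n \<noteq> \<zero>}. c n)"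
  using assms by (intro add.finprod_mono_neutral_cong_right) (auto simp: subset_eq)

lemma component_eqI:
  assumes c: "\<And>n. c n \<in> G n" and B: "finite B" "{n. c n \<noteq> \<zero>} \<subseteq> B" and x: "x = (\<Oplus>n\<in>B. c n)"
  shows "component x = c"
proof -
  have "x \<in> carrier R"
    using x c G_carrier by (auto intro!: finsum_closed)
  moreover have "(\<forall>n. c n \<in> G n) \<and> finite {n. c n \<noteq> \<zero>} \<and> x = (\<Oplus>n\<in>{n. c n \<noteq> \<zero>}. c n)"
    using c B x finsum_support[OF B] G_carrier by (auto intro: finite_subset)
  ultimately show ?thesis
    unfolding component_def using the1_equality[OF homogeneous_decomposition] by blast
qed

lemma component_carrier: "x \<in> carrier R \<Longrightarrow> component x n \<in> carrier R"
  using component_spec(1) G_carrier by blast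

lemma component_sum:
  assumes "x \<in> carrier R" "finite B" "{n. component x n \<noteq> \<zero>} \<subseteq> B"
  shows "x = (\<Oplus>n\<in>B. component x n)"
  using finsum_support[of B "component x"] assms component_spec(3) component_carrier by simp

text \<open>The expansion of \<open>x\<close> has \<open>x\<close> on both sides, so rewriting with
  it would loop. The one controlled substitution is packaged here, with the index set generalised so
  that the premise can be proved by set induction.\<close>

lemma component_sum_induct:
  assumes x: "x \<in> carrier R" and P: "\<And>B. finite B \<Longrightarrow> P (\<Oplus>n\<in>B. component x n)"
  shows "P x"
  by (rule ssubst[OF component_spec(3)[OF x], of P], rule P[OF component_spec(2)[OF x]])

lemma ideal_memI:
  assumes J: "ideal J R" and x: "x \<in> carrier R" and comp: "\<And>n. component x n \<in> J"
  shows "x \<in> J"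
proof -
  interpret J: ideal J R by (rule J)
  have "(\<Oplus>n\<in>B. component x n) \<in> J" if "finite B" for B
    using that x by (induction B rule: finite_induct) (auto simp: component_carrier Pi_iff
        J.a_closed comp)
  then show ?thesis
    by (rule component_sum_induct[OF x, where P = "\<lambda>y. y \<in> J"])
qed

lemma component_homogeneous:
  assumes "x \<in> G d"
  shows "component x n = (if n = d then x else \<zero>)"
proof -
  have "component x = (\<lambda>n. if n = d then x else \<zero>)"
  proof (rule component_eqI[where B = "{d}"])
    show "x = (\<Oplus>n\<in>{d}. if n = d then x else \<zero>)"
      using assms G_carrier by simp
  qed (use assms G_zero in \<open>auto split: if_splits\<close>)
  then show ?thesis by simp
qed

lemma component_add:
  assumes "x \<in> carrier R" "y \<in> carrier R"
  shows "component (x \<oplus> y) n = component x n \<oplus> component y n"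
proof -
  let ?B = "{n. component x n \<noteq> \<zero>} \<union> {n. component y n \<noteq> \<zero>}"
  have B: "finite ?B" using component_spec(2) assms by auto
  have "component (x \<oplus> y) = (\<lambda>n. component x n \<oplus> component y n)"
  proof (rule component_eqI[OF _ B])
    have "x \<oplus> y = (\<Oplus>n\<in>?B. component x n) \<oplus> (\<Oplus>n\<in>?B. component y n)"
      using component_sum[OF assms(1) B] component_sum[OF assms(2) B] by auto
    then show "x \<oplus> y = (\<Oplus>n\<in>?B. component x n \<oplus> component y n)"
      using assms component_carrier by (simp add: finsum_addf Pi_iff)
  qed (use assms component_spec(1) G_add in auto)
  then show ?thesis by simp
qed

lemma component_finsum:
  assumes "finite A" "f \<in> A \<rightarrow> carrier R"
  shows "component (\<Oplus>i\<in>A. f i) n = (\<Oplus>i\<in>A. component (f i) n)"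
  using assms
proof (induction A rule: finite_induct)
  case empty
  then show ?case using component_homogeneous[OF G_zero] by simp
next
  case (insert a A)
  then show ?case
    by (simp add: component_add component_carrier Pi_iff)
qed

lemma homogeneous_induct [consumes 1, case_names homogeneous add]:
  assumes "x \<in> carrier R"
    and hom: "\<And>d y. y \<in> G d \<Longrightarrow> P y"
    and add: "\<And>y z. y \<in> carrier R \<Longrightarrow> z \<in> carrier R \<Longrightarrow> P y \<Longrightarrow> P z \<Longrightarrow> P (y \<oplus> z)"
  shows "P x"
proof -
  have "P (\<Oplus>n\<in>B. component x n)" if "finite B" for B
    using that
  proof (induction B rule: finite_induct)
    case empty
    then show ?case using hom[OF G_zero] by simp
  next
    case (insert n B)
    then show ?case
      using assms(1) component_carrier hom[OF component_spec(1)[OF assms(1), of n]]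
      by (simp add: Pi_iff add)
  qed
  then show ?thesis
    by (rule component_sum_induct[OF assms(1)])
qed

text \<open>Both sides are proved at once by decomposing \<open>x\<close>: for homogeneous
  \<open>x\<close> there is only one component to compare, and the factor \<open>a\<close> shifts
  its degree by \<open>d\<close>.\<close>

lemma component_mult_homogeneous:
  assumes a: "a \<in> G d" and x: "x \<in> carrier R"
  shows "component (a \<otimes> x) n = a \<otimes> component x (n - d)"
    and "component (x \<otimes> a) n = component x (n - d) \<otimes> a"
proof -
  have [simp]: "a \<in> carrier R" using a G_carrier by blast
  have "component (a \<otimes> x) n = a \<otimes> component x (n - d) \<and>
    component (x \<otimes> a) n = component x (n - d) \<otimes> a"
    using x
  proof (induction x rule: homogeneous_induct)
    case (homogeneous e y)
    then have "y \<in> carrier R" "a \<otimes> y \<in> G (d + e)" "y \<otimes> a \<in> G (e + d)"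
      using G_carrier homogeneous_mult a by auto
    then show ?case
      using component_homogeneous homogeneous by auto
  next
    case (add y z)
    then show ?case
      by (simp add: r_distr l_distr component_add component_carrier)
  qed
  then show "component (a \<otimes> x) n = a \<otimes> component x (n - d)"
    and "component (x \<otimes> a) n = component x (n - d) \<otimes> a" by auto
qed

lemma component_mult:
  assumes a: "a \<in> carrier R" and b: "b \<in> carrier R"
    and K: "finite K" "{n. component a n \<noteq> \<zero>} \<subseteq> K"
  shows "component (a \<otimes> b) n = (\<Oplus>k\<in>K. component a k \<otimes> component b (n - k))"
proof -
  have "a \<otimes> b = (\<Oplus>k\<in>K. component a k) \<otimes> b"
    using component_sum[OF a K] by simp
  also have "\<dots> = (\<Oplus>k\<in>K. component a k \<otimes> b)"
    using K a b component_carrier by (simp add: finsum_ldistr)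
  finally have "component (a \<otimes> b) n = (\<Oplus>k\<in>K. component (component a k \<otimes> b) n)"
    using component_finsum[OF K(1), of "\<lambda>k. component a k \<otimes> b" n] a b component_carrier by simp
  also have "\<dots> = (\<Oplus>k\<in>K. component a k \<otimes> component b (n - k))"
    using component_mult_homogeneous(1)[OF component_spec(1)[OF a] b] by simp
  finally show ?thesis .
qed

section \<open>Graded ideals, and primality tested on homogeneous elements\<close>

definition graded_set :: "'a set \<Rightarrow> bool" where
  "graded_set I \<longleftrightarrow> (\<forall>x\<in>I. \<forall>n. component x n \<in> I)"

text \<open>The elements all of whose components lie in \<open>Idl H\<close> form an ideal
  containing \<open>H\<close>, so they exhaust \<open>Idl H\<close>. The generators need not be
  homogeneous, since later \<open>H\<close> is a graded ideal with one homogeneous element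
  added.\<close>

lemma graded_genideal:
  assumes H: "H \<subseteq> carrier R" and comp: "\<And>h n. h \<in> H \<Longrightarrow> component h n \<in> Idl H"
  shows "graded_set (Idl H)"
proof -
  interpret I: ideal "Idl H" R by (rule genideal_ideal[OF H])
  define J where "J = {x \<in> carrier R. \<forall>n. component x n \<in> Idl H}"
  \<comment> \<open>Arbitrary multipliers are reduced to homogeneous ones, which only shift the
    components.\<close>
  have mult: "y \<otimes> x \<in> J \<and> x \<otimes> y \<in> J" if x: "x \<in> J" and y: "y \<in> carrier R" for x y
    using y
  proof (induction y rule: homogeneous_induct)
    case (homogeneous d y)
    then show ?case
      using x G_carrier by (auto simp: J_def component_mult_homogeneous I.I_l_closed I.I_r_closed)
  next
    case (add y z)
    then show ?case
      using x by (auto simp: J_def r_distr l_distr component_add I.a_closed)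
  qed
  have "ideal J R"
  proof (rule idealI[OF ring_axioms])
    show "subgroup J (add_monoid R)"
    proof (rule add.subgroupI)
      show "J \<noteq> {}"
        using component_homogeneous[OF G_zero] I.zero_closed by (force simp: J_def)
      show "\<ominus> a \<in> J" if "a \<in> J" for a
      proof -
        have "\<ominus> \<one> \<otimes> a \<in> J" using mult[OF that, of "\<ominus> \<one>"] by simp
        moreover have "\<ominus> \<one> \<otimes> a = \<ominus> a" using that by (simp add: J_def l_minus)
        ultimately show ?thesis by simp
      qed
    qed (auto simp: J_def component_add I.a_closed)
  qed (use mult in auto)
  moreover have "H \<subseteq> J"
    using H comp by (auto simp: J_def)
  ultimately have "Idl H \<subseteq> J" by (rule genideal_minimal)
  then show ?thesis by (auto simp: graded_set_def J_def)
qed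

text \<open>The components of a homogeneous generator are zero or the generator itself, so
  \<open>graded_genideal\<close> gives one direction; conversely an element is the sum of its
  components. Closure under components is the form in which homogeneity is checked for annihilators
  and in Zorn's lemma.\<close>

lemma homogeneous_ideal_iff: "homogeneous_ideal R G I \<longleftrightarrow> ideal I R \<and> graded_set I"
proof
  assume hom: "homogeneous_ideal R G I"
  let ?H = "I \<inter> (\<Union>n. G n)"
  have I: "I = Idl ?H" and "ideal I R"
    using hom unfolding homogeneous_ideal_def by blast+
  have "?H \<subseteq> carrier R" using G_carrier by blast
  moreover have "component h n \<in> Idl ?H" if "h \<in> ?H" for h n
    using that I \<open>ideal I R\<close> additive_subgroup.zero_closed[OF ideal.axioms(1)]
    by (auto simp: component_homogeneous)
  ultimately have "graded_set (Idl ?H)" by (rule graded_genideal)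
  then show "ideal I R \<and> graded_set I" using \<open>ideal I R\<close> by (simp flip: I)
next
  assume I: "ideal I R \<and> graded_set I"
  let ?H = "I \<inter> (\<Union>n. G n)"
  have H: "?H \<subseteq> carrier R" using G_carrier by blast
  interpret J: ideal "Idl ?H" R by (rule genideal_ideal[OF H])
  have "x \<in> Idl ?H" if "x \<in> I" for x
  proof -
    have x: "x \<in> carrier R"
      using that I ideal.Icarr[of I R x] by blast
    have comp: "component x n \<in> Idl ?H" for n
      using that I x component_spec(1) genideal_self[OF H] unfolding graded_set_def by blast
    show ?thesis
      by (rule ideal_memI[OF J.ideal_axioms x comp])
  qed
  then show "homogeneous_ideal R G I"
    using I genideal_minimal[of I ?H] unfolding homogeneous_ideal_def by blast
qed

lemma Spec_ideal: "P \<in> Spec R G \<Longrightarrow> ideal P R"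
  by (simp add: Spec_def homogeneous_ideal_def)

lemma Spec_prime:
  "P \<in> Spec R G \<Longrightarrow> a \<in> carrier R \<Longrightarrow> b \<in> carrier R \<Longrightarrow> a \<otimes> b \<in> P \<Longrightarrow> a \<in> P \<or> b \<in> P"
  by (simp add: Spec_def)

lemma Spec_one: "P \<in> Spec R G \<Longrightarrow> \<one> \<notin> P"
  using ideal.one_imp_carrier by (auto simp: Spec_def homogeneous_ideal_def)

text \<open>Compare the highest components outside \<open>Q\<close>: in the component of
  \<open>a \<otimes> b\<close> of degree \<open>top a + top b\<close> every other summand has a
  factor in \<open>Q\<close>, so the product of the two top components lies in \<open>Q\<close> as
  well.\<close>

lemma homogeneous_prime_imp_prime:
  assumes Q: "ideal Q R" "graded_set Q"
    and prime: "\<And>d e a b. a \<in> G d \<Longrightarrow> b \<in> G e \<Longrightarrow> a \<otimes> b \<in> Q \<Longrightarrow> a \<in> Q \<or> b \<in> Q"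
    and a: "a \<in> carrier R" and b: "b \<in> carrier R" and ab: "a \<otimes> b \<in> Q"
  shows "a \<in> Q \<or> b \<in> Q"
proof (rule ccontr)
  assume "\<not> ?thesis"
  then have aQ: "a \<notin> Q" and bQ: "b \<notin> Q" by auto
  interpret Q: ideal Q R by (rule Q(1))
  define top where "top x = Max {n. component x n \<notin> Q}" for x
  have fin: "finite {n. component x n \<notin> Q}" if "x \<in> carrier R" for x
  proof (rule finite_subset[OF _ component_spec(2)[OF that]])
    show "{n. component x n \<notin> Q} \<subseteq> {n. component x n \<noteq> \<zero>}"
      using Q.zero_closed by (auto simp del: Q.zero_closed)
  qed
  have finsum_Q: "(\<Oplus>i\<in>B. f i) \<in> Q" if "finite B" "\<And>i. i \<in> B \<Longrightarrow> f i \<in> Q" for B :: "int set" and f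
    using that by (induction B rule: finite_induct) (auto simp: Pi_iff Q.Icarr Q.a_closed)
  have ne: "{n. component x n \<notin> Q} \<noteq> {}" if "x \<in> carrier R" "x \<notin> Q" for x
  proof
    assume "{n. component x n \<notin> Q} = {}"
    then have "x \<in> Q"
      by (intro ideal_memI[OF Q(1) that(1)]) auto
    then show False using that by blast
  qed
  have top: "component x (top x) \<notin> Q" "\<And>n. component x n \<notin> Q \<Longrightarrow> n \<le> top x"
    if "x \<in> carrier R" "x \<notin> Q" for x
    using Max_in[OF fin ne] Max_ge[OF fin] that unfolding top_def by blast+
  let ?i = "top a" and ?j = "top b"
  \<comment> \<open>\<open>?i\<close> is inserted so that its summand can be split off without first
    showing that it belongs to the support.\<close>
  let ?K = "insert ?i {n. component a n \<noteq> \<zero>}"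
  let ?f = "\<lambda>k. component a k \<otimes> component b (?i + ?j - k)"
  have K: "finite ?K" using component_spec(2)[OF a] by auto
  have f: "?f k \<in> carrier R" for k using a b component_carrier by auto
  \<comment> \<open>If \<open>k\<close> is below \<open>?i\<close>, the index
    \<open>?i + ?j - k\<close> exceeds \<open>?j\<close>, so the second factor lies in
    \<open>Q\<close>; if \<open>k\<close> is above \<open>?i\<close>, the first factor does.\<close>
  have rest: "?f k \<in> Q" if "k \<noteq> ?i" for k
  proof (cases "k < ?i")
    case True
    then have "component b (?i + ?j - k) \<in> Q"
      using top(2)[OF b bQ, of "?i + ?j - k"] by force
    then show ?thesis using a component_carrier by (simp add: Q.I_l_closed)
  next
    case False
    then have "component a k \<in> Q"
      using that top(2)[OF a aQ, of k] by force
    then show ?thesis using b component_carrier by (simp add: Q.I_r_closed)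
  qed
  have "component (a \<otimes> b) (?i + ?j) = (\<Oplus>k\<in>?K. ?f k)"
    by (rule component_mult[OF a b K]) auto
  also have "?K = insert ?i (?K - {?i})" by auto
  also have "(\<Oplus>k\<in>\<dots>. ?f k) = ?f ?i \<oplus> (\<Oplus>k\<in>?K - {?i}. ?f k)"
    using K f a b component_carrier by (intro finsum_insert) auto
  finally have sum: "component (a \<otimes> b) (?i + ?j) = ?f ?i \<oplus> (\<Oplus>k\<in>?K - {?i}. ?f k)" .
  have r: "(\<Oplus>k\<in>?K - {?i}. ?f k) \<in> Q" using K rest by (intro finsum_Q) auto
  have "(\<Oplus>k\<in>?K - {?i}. ?f k) \<in> carrier R" using f by simp
  then have "?f ?i = component (a \<otimes> b) (?i + ?j) \<ominus> (\<Oplus>k\<in>?K - {?i}. ?f k)"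
    unfolding sum using f[of ?i] by (simp only: minus_eq a_assoc r_neg a_inv_closed r_zero)
  moreover have "\<dots> \<in> Q"
    using r ab Q(2) unfolding graded_set_def minus_eq
    by (simp add: Q.a_closed)
  ultimately have "?f ?i \<in> Q" by simp
  then show False
    using prime[OF component_spec(1)[OF a] component_spec(1)[OF b]] top(1) aQ bQ a b by fastforce
qed

end

section \<open>Existence of homogeneous primes and of homogeneous generators\<close>

context graded_commutative_ring
begin

text \<open>The sign is forgotten on purpose: ideals are closed under negation, so membership does
  not depend on it.\<close>

lemma homogeneous_swap:
  assumes "a \<in> G d" "b \<in> G e"
  shows "a \<otimes> b = b \<otimes> a \<or> a \<otimes> b = \<ominus> (b \<otimes> a)"
  using graded_commutative[OF assms] by (auto split: if_splits)

text \<open>Multiplying through an arbitrary middle factor makes the colon sets below two-sided ideals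
  without any appeal to the grading.\<close>

lemma prime_of_maximal:
  assumes noeth: "noetherian_ring R"
    and I: "ideal I R" "graded_set I"
    and U: "U \<subseteq> (\<Union>n. G n)" "\<one> \<in> U" "\<And>x y. x \<in> U \<Longrightarrow> y \<in> U \<Longrightarrow> x \<otimes> y \<in> U"
    and disj: "I \<inter> U = {}"
  shows "\<exists>Q\<in>Spec R G. I \<subseteq> Q \<and> Q \<inter> U = {}"
proof -
  define \<A> where "\<A> = {J. ideal J R \<and> graded_set J \<and> I \<subseteq> J \<and> J \<inter> U = {}}"
  have "\<exists>Q\<in>\<A>. \<forall>J\<in>\<A>. Q \<subseteq> J \<longrightarrow> J = Q"
  proof (rule subset_Zorn)
    fix C assume C: "subset.chain \<A> C"
    show "\<exists>M\<in>\<A>. \<forall>J\<in>C. J \<subseteq> M"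
    proof (cases "C = {}")
      case True
      then show ?thesis using I disj by (auto simp: \<A>_def)
    next
      case False
      \<comment> \<open>In a noetherian ring a nonempty chain of ideals contains its union, so the
        upper bound is a member of the chain and inherits all its properties.\<close>
      have "subset.chain {J. ideal J R} C"
        using C by (auto simp: subset.chain_def \<A>_def)
      then have "\<Union>C \<in> C"
        using noetherian_ring.ideal_chain_is_trivial[OF noeth False] by blast
      then show ?thesis
        using C by (auto simp: subset.chain_def)
    qed
  qed
  then obtain Q where Q: "Q \<in> \<A>" and max: "\<And>J. J \<in> \<A> \<Longrightarrow> Q \<subseteq> J \<Longrightarrow> J = Q" by blast
  interpret Q: ideal Q R using Q by (simp add: \<A>_def)
  have Qg: "graded_set Q" and QU: "Q \<inter> U = {}" and IQ: "I \<subseteq> Q"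
    using Q by (auto simp: \<A>_def)
  \<comment> \<open>By maximality of \<open>Q\<close>, the graded ideal generated by
    \<open>Q\<close> and one more homogeneous element must meet \<open>U\<close>.\<close>
  have meets: "Idl (insert a Q) \<inter> U \<noteq> {}" if a: "a \<in> G d" "a \<notin> Q" for a d
  proof
    assume empty: "Idl (insert a Q) \<inter> U = {}"
    have H: "insert a Q \<subseteq> carrier R" using a G_carrier Q.a_subset by blast
    have H': "insert a Q \<subseteq> Idl (insert a Q)" by (rule genideal_self[OF H])
    have "component h n \<in> Idl (insert a Q)" if "h \<in> insert a Q" for h n
      using that H' Qg Q.zero_closed component_homogeneous[OF a(1)] unfolding graded_set_def
      by (metis insert_iff subset_iff)
    then have "Idl (insert a Q) \<in> \<A>"
      using graded_genideal[OF H] genideal_ideal[OF H] empty H' IQ by (auto simp: \<A>_def)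
    then show False using max[of "Idl (insert a Q)"] H' a by blast
  qed
  have prime: "a \<in> Q \<or> b \<in> Q" if a: "a \<in> G d" and b: "b \<in> G e" and ab: "a \<otimes> b \<in> Q" for a b d e
  proof (rule ccontr)
    assume "\<not> ?thesis"
    then have "a \<notin> Q" "b \<notin> Q" by auto
    have [simp]: "a \<in> carrier R" "b \<in> carrier R" using a b G_carrier by auto
    have arb: "a \<otimes> r \<otimes> b \<in> Q" if "r \<in> carrier R" for r
      using that
    proof (induction r rule: homogeneous_induct)
      case (homogeneous f r)
      then have [simp]: "r \<in> carrier R" using G_carrier by blast
      have "r \<otimes> a \<otimes> b \<in> Q" using ab by (simp add: m_assoc Q.I_l_closed)
      then show ?case
        using homogeneous_swap[OF a homogeneous] by (auto simp: l_minus)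
    next
      case (add y z)
      then show ?case by (simp add: r_distr l_distr Q.a_closed)
    qed
    define A where "A = {x \<in> carrier R. \<forall>r\<in>carrier R. x \<otimes> r \<otimes> b \<in> Q}"
    have "ideal A R"
    proof (rule idealI[OF ring_axioms])
      show "subgroup A (add_monoid R)"
        by (rule add.subgroupI)
          (use Q.zero_closed in \<open>auto simp: A_def l_distr Q.a_closed l_minus Q.a_inv_closed simp
              flip: a_inv_def intro!: exI[of _ \<zero>]\<close>)
      show "y \<otimes> x \<in> A" if "x \<in> A" "y \<in> carrier R" for x y
        using that by (auto simp: A_def m_assoc Q.I_l_closed)
      show "x \<otimes> y \<in> A" if "x \<in> A" "y \<in> carrier R" for x y
      proof -
        have "x \<otimes> (y \<otimes> r) \<otimes> b \<in> Q" if "r \<in> carrier R" for r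
          using that \<open>x \<in> A\<close> \<open>y \<in> carrier R\<close> by (simp add: A_def)
        then show ?thesis using that by (auto simp: A_def m_assoc)
      qed
    qed
    moreover have "insert a Q \<subseteq> A"
      using arb by (auto simp: A_def Q.I_r_closed Q.Icarr)
    ultimately have IA: "Idl (insert a Q) \<subseteq> A" by (rule genideal_minimal)
    \<comment> \<open>\<open>B\<close> is taken relative to all of \<open>A\<close> and not just to
      \<open>a\<close>, so that any element of the ideal generated by \<open>a\<close> and
      \<open>Q\<close> can be multiplied with any element of the one generated by \<open>b\<close>
      and \<open>Q\<close>.\<close>
    define B where "B = {y \<in> carrier R. \<forall>x\<in>A. \<forall>r\<in>carrier R. x \<otimes> r \<otimes> y \<in> Q}"
    have "ideal B R"
    proof (rule idealI[OF ring_axioms])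
      show "subgroup B (add_monoid R)"
        by (rule add.subgroupI)
          (use Q.zero_closed in \<open>auto simp: A_def B_def r_distr Q.a_closed r_minus Q.a_inv_closed
              simp flip: a_inv_def intro!: exI[of _ \<zero>]\<close>)
      show "y \<otimes> x \<in> B" if "x \<in> B" "y \<in> carrier R" for x y
      proof -
        have "z \<otimes> (r \<otimes> y) \<otimes> x \<in> Q" if "z \<in> A" "r \<in> carrier R" for z r
          using that \<open>x \<in> B\<close> \<open>y \<in> carrier R\<close> by (simp add: B_def)
        then have "z \<otimes> r \<otimes> (y \<otimes> x) \<in> Q" if "z \<in> A" "r \<in> carrier R" for z r
          using that \<open>x \<in> B\<close> \<open>y \<in> carrier R\<close> by (simp add: A_def B_def m_assoc)
        then show ?thesis using that by (simp add: B_def)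
      qed
      show "x \<otimes> y \<in> B" if "x \<in> B" "y \<in> carrier R" for x y
      proof -
        have "z \<otimes> r \<otimes> x \<otimes> y \<in> Q" if "z \<in> A" "r \<in> carrier R" for z r
          using that \<open>x \<in> B\<close> \<open>y \<in> carrier R\<close> by (simp add: B_def Q.I_r_closed)
        then have "z \<otimes> r \<otimes> (x \<otimes> y) \<in> Q" if "z \<in> A" "r \<in> carrier R" for z r
          using that \<open>x \<in> B\<close> \<open>y \<in> carrier R\<close> by (simp add: A_def B_def m_assoc)
        then show ?thesis using that by (simp add: B_def)
      qed
    qed
    moreover have "insert b Q \<subseteq> B"
      by (auto simp: A_def B_def Q.I_l_closed Q.Icarr)
    ultimately have IB: "Idl (insert b Q) \<subseteq> B" by (rule genideal_minimal)
    \<comment> \<open>With middle factor \<open>\<one>\<close> the product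
      \<open>u \<otimes> v\<close> lies in \<open>Q\<close>, whereas closure under products puts it
      into \<open>U\<close>.\<close>
    obtain u v where u: "u \<in> A" "u \<in> U" and v: "v \<in> B" "v \<in> U"
      using meets[OF a \<open>a \<notin> Q\<close>] meets[OF b \<open>b \<notin> Q\<close>] IA IB by blast
    then have "u \<otimes> \<one> \<otimes> v \<in> Q" unfolding B_def by blast
    then have "u \<otimes> v \<in> Q" using u by (simp add: A_def)
    then show False using U(3) u v QU by blast
  qed
  have "Q \<in> Spec R G"
    unfolding Spec_def mem_Collect_eq homogeneous_ideal_iff
    using Q.ideal_axioms Qg QU U(2) homogeneous_prime_imp_prime[OF Q.ideal_axioms Qg prime]
    by auto
  then show ?thesis using IQ QU by blast
qed

text \<open>Noetherianity gives finitely many generators of mixed degrees; their nonzero components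
  lie in \<open>P\<close> because \<open>P\<close> is graded, and they generate the same
  ideal.\<close>

lemma homogeneous_generators_exist:
  assumes noeth: "noetherian_ring R" and P: "homogeneous_ideal R G P"
  shows "\<exists>ds. homogeneous_generators R G P ds"
proof -
  let ?H = "P \<inter> (\<Union>n. G n)"
  have I: "ideal P R" "graded_set P" using P by (auto simp: homogeneous_ideal_iff)
  obtain A where A: "A \<subseteq> carrier R" "finite A" "P = Idl A"
    using noetherian_ring.finetely_gen[OF noeth I(1)] by blast
  define D where "D = (\<Union>a\<in>A. (\<lambda>n. (n, component a n)) ` {n. component a n \<noteq> \<zero>})"
  have "finite D" using A component_spec(2) by (auto simp: D_def)
  then obtain ds where ds: "set ds = D" using finite_list by blast
  have "A \<subseteq> P" using A genideal_self by blast
  then have DP: "snd ` D \<subseteq> P"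
    using I(2) by (auto simp: D_def graded_set_def)
  then have Dc: "snd ` D \<subseteq> carrier R" using ideal.Icarr[OF I(1)] by blast
  interpret J: ideal "Idl (snd ` D)" R by (rule genideal_ideal[OF Dc])
  have "a \<in> Idl (snd ` D)" if "a \<in> A" for a
  proof -
    have a: "a \<in> carrier R" using that A by blast
    have comp: "component a n \<in> Idl (snd ` D)" for n
    proof (cases "component a n = \<zero>")
      case False
      then have "component a n \<in> snd ` D" using that by (force simp: D_def)
      then show ?thesis using genideal_self[OF Dc] by blast
    qed simp
    show ?thesis
      by (rule ideal_memI[OF J.ideal_axioms a comp])
  qed
  then have "P \<subseteq> Idl (snd ` D)"
    using genideal_minimal[OF J.ideal_axioms] A(3) by blast
  moreover have "Idl (snd ` D) \<subseteq> P" using genideal_minimal[OF I(1) DP] .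
  moreover have "\<forall>(d, r)\<in>set ds. r \<in> G d"
    using A component_spec(1) by (auto simp: ds D_def)
  ultimately have "homogeneous_generators R G P ds"
    unfolding homogeneous_generators_def ds by (intro conjI equalityI)
  then show ?thesis ..
qed

end

section \<open>Additive categories with a suspension\<close>

lemma Hom_iff: "f \<in> Hom C X Y \<longleftrightarrow> f \<in> Arr C \<and> Dom C f = X \<and> Cod C f = Y"
  by (simp add: Hom_def)

lemma ArrI: "f \<in> Hom C X Y \<Longrightarrow> f \<in> Arr C"
  by (simp add: Hom_iff)

context additive_category
begin

lemma Dom_in_Obj [simp]: "f \<in> Arr C \<Longrightarrow> Dom C f \<in> Obj C"
  by (rule Dom_Obj)

lemma Cod_in_Obj [simp]: "f \<in> Arr C \<Longrightarrow> Cod C f \<in> Obj C"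
  by (rule Cod_Obj)

lemma Hom_Obj: "f \<in> Hom C X Y \<Longrightarrow> X \<in> Obj C" "f \<in> Hom C X Y \<Longrightarrow> Y \<in> Obj C"
  by (auto simp: Hom_iff)

lemma Ide_typed [simp]:
  assumes "X \<in> Obj C"
  shows "Ide C X \<in> Arr C" "Dom C (Ide C X) = X" "Cod C (Ide C X) = X"
  using Ide_Hom[OF assms] by (auto simp: Hom_iff)

text \<open>Typing is rephrased as equations between domains and codomains, which the simplifier can
  decide; membership in \<open>Hom\<close> would leave the endpoints to be guessed.\<close>

lemma Cmp_typed [simp]:
  assumes "f \<in> Arr C" "g \<in> Arr C" "Cod C f = Dom C g"
  shows "g \<cdot> f \<in> Arr C" "Dom C (g \<cdot> f) = Dom C f" "Cod C (g \<cdot> f) = Cod C g"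
  using Cmp_Hom[of f "Dom C f" "Dom C g" g "Cod C g"] assms by (auto simp: Hom_iff)

lemma Cmp_Ide [simp]:
  assumes "f \<in> Arr C"
  shows "Cod C f = Y \<Longrightarrow> Ide C Y \<cdot> f = f" "Dom C f = X \<Longrightarrow> f \<cdot> Ide C X = f"
  using Cmp_Ide_left[of f] Cmp_Ide_right[of f] assms by (auto simp: Hom_iff)

lemma Cmp_assoc_Arr [simp]:
  assumes "f \<in> Arr C" "g \<in> Arr C" "h \<in> Arr C" "Cod C f = Dom C g" "Cod C g = Dom C h"
  shows "(h \<cdot> g) \<cdot> f = h \<cdot> (g \<cdot> f)"
  using Cmp_assoc[of f "Dom C f" "Dom C g" g "Dom C h" h "Cod C h"] assms by (auto simp: Hom_iff)

lemma Cmp_cancel_left: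
  assumes "f \<in> Arr C" "g \<in> Arr C" "h \<in> Arr C" "Cod C f = Dom C g" "Cod C g = Dom C h"
    "h \<cdot> g = Ide C (Cod C f)"
  shows "h \<cdot> (g \<cdot> f) = f"
  using Cmp_assoc_Arr[OF assms(1-5), symmetric] assms by simp

lemma Cmp_cancel_right:
  assumes "f \<in> Arr C" "g \<in> Arr C" "h \<in> Arr C" "Cod C f = Dom C g" "Cod C g = Dom C h"
    "g \<cdot> f = Ide C (Dom C h)"
  shows "(h \<cdot> g) \<cdot> f = h"
  using Cmp_assoc_Arr[OF assms(1-5)] assms by simp

text \<open>Composites are simplified to right-nested form, in which \<open>f \<cdot> u\<close> is
  no longer a subterm of \<open>f \<cdot> (u \<cdot> w)\<close>; commuting squares are therefore
  prolonged by this rule instead of by rewriting.\<close>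

lemma Cmp_eq_extend:
  assumes "f \<cdot> u = g \<cdot> v" "u \<in> Arr C" "v \<in> Arr C" "f \<in> Arr C" "g \<in> Arr C" "w \<in> Arr C"
    "Cod C u = Dom C f" "Cod C v = Dom C g" "Cod C w = Dom C u" "Dom C u = Dom C v"
  shows "f \<cdot> (u \<cdot> w) = g \<cdot> (v \<cdot> w)"
  using assms Cmp_assoc_Arr[of w u f] Cmp_assoc_Arr[of w v g] by simp

lemma hom_group_simps [simp]:
  "carrier (hom_group C X Y) = Hom C X Y" "add (hom_group C X Y) = Add C"
  "zero (hom_group C X Y) = Zer C X Y"
  by (simp_all add: hom_group_def)

lemma Zer_Hom: "X \<in> Obj C \<Longrightarrow> Y \<in> Obj C \<Longrightarrow> Zer C X Y \<in> Hom C X Y"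
  using abelian_group.axioms(1)[OF hom_abelian_group] abelian_monoid.zero_closed by fastforce

lemma Zer_typed [simp]:
  assumes "X \<in> Obj C" "Y \<in> Obj C"
  shows "Zer C X Y \<in> Arr C" "Dom C (Zer C X Y) = X" "Cod C (Zer C X Y) = Y"
  using Zer_Hom[OF assms] by (auto simp: Hom_iff)

lemma Add_Hom: "f \<in> Hom C X Y \<Longrightarrow> g \<in> Hom C X Y \<Longrightarrow> Add C f g \<in> Hom C X Y"
  using abelian_monoid.a_closed[OF abelian_group.axioms(1)[OF hom_abelian_group], of X Y f g]
      Hom_Obj
  by fastforce

lemma Add_typed [simp]:
  assumes "f \<in> Arr C" "g \<in> Arr C" "Dom C f = Dom C g" "Cod C f = Cod C g"
  shows "Add C f g \<in> Arr C" "Dom C (Add C f g) = Dom C g" "Cod C (Add C f g) = Cod C g"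
  using Add_Hom[of f "Dom C g" "Cod C g" g] assms by (auto simp: Hom_iff)

lemma Add_assoc: "f \<in> Hom C X Y \<Longrightarrow> g \<in> Hom C X Y \<Longrightarrow> h \<in> Hom C X Y \<Longrightarrow>
    Add C (Add C f g) h = Add C f (Add C g h)"
  using abelian_monoid.a_assoc[OF abelian_group.axioms(1)[OF hom_abelian_group], of X Y f g h]
      Hom_Obj
  by fastforce

lemma Add_commute: "f \<in> Hom C X Y \<Longrightarrow> g \<in> Hom C X Y \<Longrightarrow> Add C f g = Add C g f"
  using abelian_monoid.a_comm[OF abelian_group.axioms(1)[OF hom_abelian_group], of X Y f g] Hom_Obj
  by fastforce

lemma Add_Zer:
  assumes "f \<in> Hom C X Y"
  shows "Add C (Zer C X Y) f = f" "Add C f (Zer C X Y) = f"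
  using abelian_monoid.l_zero[OF abelian_group.axioms(1)[OF hom_abelian_group], of X Y f]
    abelian_monoid.r_zero[OF abelian_group.axioms(1)[OF hom_abelian_group], of X Y f]
    Hom_Obj[OF assms] assms by auto

lemma neg_Hom: "f \<in> Hom C X Y \<Longrightarrow> neg C f \<in> Hom C X Y"
  using abelian_group.a_inv_closed[OF hom_abelian_group, of X Y f] Hom_Obj[of f X Y]
  by (auto simp: neg_def Hom_iff)

lemma neg_typed [simp]:
  assumes "f \<in> Arr C"
  shows "neg C f \<in> Arr C" "Dom C (neg C f) = Dom C f" "Cod C (neg C f) = Cod C f"
  using neg_Hom[of f "Dom C f" "Cod C f"] assms by (auto simp: Hom_iff)

lemma Add_neg:
  assumes "f \<in> Hom C X Y"
  shows "Add C f (neg C f) = Zer C X Y" "Add C (neg C f) f = Zer C X Y"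
  using abelian_group.r_neg[OF hom_abelian_group, of X Y f]
    abelian_group.l_neg[OF hom_abelian_group, of X Y f] Hom_Obj[OF assms] assms
  by (auto simp: neg_def Hom_iff)

lemma Add_eq_Zer:
  assumes f: "f \<in> Hom C X Y" and g: "g \<in> Hom C X Y" and z: "Add C f g = Zer C X Y"
  shows "g = neg C f"
proof -
  have "g = Add C (Add C (neg C f) f) g"
    using f g by (simp add: Add_neg Add_Zer)
  also have "\<dots> = Add C (neg C f) (Zer C X Y)"
    using Add_assoc[OF neg_Hom[OF f] f g] z by simp
  also have "\<dots> = neg C f" using neg_Hom[OF f] Add_Zer by blast
  finally show ?thesis .
qed

lemma neg_neg [simp]:
  assumes "f \<in> Arr C"
  shows "neg C (neg C f) = f"
proof -
  have f: "f \<in> Hom C (Dom C f) (Cod C f)" using assms by (simp add: Hom_iff)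
  show ?thesis
    using Add_eq_Zer[OF neg_Hom[OF f] f Add_neg(2)[OF f]] by simp
qed

lemma neg_inject: "neg C f = neg C g \<Longrightarrow> f \<in> Arr C \<Longrightarrow> g \<in> Arr C \<Longrightarrow> f = g"
  by (metis neg_neg)

lemma neg_Zer [simp]:
  assumes "X \<in> Obj C" "Y \<in> Obj C"
  shows "neg C (Zer C X Y) = Zer C X Y"
  using Add_eq_Zer[OF Zer_Hom Zer_Hom Add_Zer(1)[OF Zer_Hom]] assms by simp

text \<open>An idempotent of a group is neutral; this is how additive maps are seen to preserve zero
  arrows.\<close>

lemma Add_self_imp_Zer:
  assumes f: "f \<in> Hom C X Y" and eq: "Add C f f = f"
  shows "f = Zer C X Y"
  using Add_assoc[OF f f neg_Hom[OF f]] f eq by (simp add: Add_neg Add_Zer)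

lemma Cmp_Zer_left [simp]:
  assumes "f \<in> Arr C" "Z \<in> Obj C" "Cod C f = Y"
  shows "Zer C Y Z \<cdot> f = Zer C (Dom C f) Z"
proof -
  have f: "f \<in> Hom C (Dom C f) Y" and Y: "Y \<in> Obj C" using assms by (auto simp: Hom_iff)
  note z = Zer_Hom[OF Y assms(2)]
  have "Add C (Zer C Y Z \<cdot> f) (Zer C Y Z \<cdot> f) = Zer C Y Z \<cdot> f"
    using Cmp_Add_left[OF f z z] Add_Zer[OF z] by simp
  then show ?thesis using Add_self_imp_Zer[OF Cmp_Hom[OF f z]] by blast
qed

lemma Cmp_Zer_right [simp]:
  assumes "f \<in> Arr C" "W \<in> Obj C" "Dom C f = X"
  shows "f \<cdot> Zer C W X = Zer C W (Cod C f)"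
proof -
  have f: "f \<in> Hom C X (Cod C f)" and Y: "X \<in> Obj C" using assms by (auto simp: Hom_iff)
  note z = Zer_Hom[OF assms(2) Y]
  have "Add C (f \<cdot> Zer C W X) (f \<cdot> Zer C W X) = f \<cdot> Zer C W X"
    using Cmp_Add_right[OF z z f] Add_Zer[OF z] by simp
  then show ?thesis using Add_self_imp_Zer[OF Cmp_Hom[OF z f]] by blast
qed

lemma Cmp_neg_left [simp]:
  assumes "f \<in> Arr C" "g \<in> Arr C" "Cod C f = Dom C g"
  shows "neg C g \<cdot> f = neg C (g \<cdot> f)"
proof -
  have f: "f \<in> Hom C (Dom C f) (Dom C g)" and g: "g \<in> Hom C (Dom C g) (Cod C g)"
    using assms by (auto simp: Hom_iff)
  have "Add C (g \<cdot> f) (neg C g \<cdot> f) = Zer C (Dom C f) (Cod C g)"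
    using Cmp_Add_left[OF f g neg_Hom[OF g]] Add_neg[OF g] assms by simp
  then show ?thesis
    using Add_eq_Zer[OF Cmp_Hom[OF f g] Cmp_Hom[OF f neg_Hom[OF g]]] by simp
qed

lemma Cmp_neg_right [simp]:
  assumes "f \<in> Arr C" "g \<in> Arr C" "Cod C f = Dom C g"
  shows "g \<cdot> neg C f = neg C (g \<cdot> f)"
proof -
  have f: "f \<in> Hom C (Dom C f) (Dom C g)" and g: "g \<in> Hom C (Dom C g) (Cod C g)"
    using assms by (auto simp: Hom_iff)
  have "Add C (g \<cdot> f) (g \<cdot> neg C f) = Zer C (Dom C f) (Cod C g)"
    using Cmp_Add_right[OF f neg_Hom[OF f] g] Add_neg[OF f] assms by simp
  then show ?thesis
    using Add_eq_Zer[OF Cmp_Hom[OF f g] Cmp_Hom[OF neg_Hom[OF f] g]] by simp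
qed

lemma eq_if_diff_Zer:
  assumes f: "f \<in> Hom C X Y" and g: "g \<in> Hom C X Y" and z: "Add C f (neg C g) = Zer C X Y"
  shows "f = g"
proof -
  have "neg C g = neg C f" by (rule Add_eq_Zer[OF f neg_Hom[OF g] z])
  then show ?thesis using f g neg_neg by (metis Hom_iff)
qed

text \<open>Every arrow into or out of \<open>X\<close> factors through the identity of
  \<open>X\<close>. Zero objects thus become an equation between arrows, which can be tested in a
  quotient.\<close>

lemma zero_obj_iff: "zero_obj C X \<longleftrightarrow> X \<in> Obj C \<and> Ide C X = Zer C X X"
proof
  assume "zero_obj C X"
  then have X: "X \<in> Obj C" and "\<exists>!f. f \<in> Hom C X X" unfolding zero_obj_def by blast+
  then show "X \<in> Obj C \<and> Ide C X = Zer C X X"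
    using Ide_Hom Zer_Hom by blast
next
  assume X: "X \<in> Obj C \<and> Ide C X = Zer C X X"
  have "f = Zer C X Y" if "f \<in> Hom C X Y" for f Y
    using that X Cmp_Ide(2)[of f X] by (auto simp: Hom_iff)
  moreover have "f = Zer C Y X" if "f \<in> Hom C Y X" for f Y
    using that X Cmp_Ide(1)[of f X] by (auto simp: Hom_iff)
  ultimately show "zero_obj C X"
    using X Zer_Hom unfolding zero_obj_def by metis
qed

lemma zero_obj_arrows:
  assumes "zero_obj C X"
  shows "f \<in> Hom C X Y \<Longrightarrow> f = Zer C X Y" "f \<in> Hom C Y X \<Longrightarrow> f = Zer C Y X"
  using assms Zer_Hom Hom_Obj unfolding zero_obj_def by metis+

lemma is_isoE:
  assumes "is_iso C f"
  obtains g where "g \<in> Arr C" "Dom C g = Cod C f" "Cod C g = Dom C f"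
    "g \<cdot> f = Ide C (Dom C f)" "f \<cdot> g = Ide C (Cod C f)"
proof -
  obtain g where g: "g \<in> Hom C (Cod C f) (Dom C f)" "g \<cdot> f = Ide C (Dom C f)"
    "f \<cdot> g = Ide C (Cod C f)"
    using assms unfolding is_iso_def by blast
  show thesis
    by (rule that[of g]) (use g in \<open>simp_all add: Hom_iff\<close>)
qed

lemma is_isoI:
  assumes "f \<in> Hom C X Y" "g \<in> Hom C Y X" "g \<cdot> f = Ide C X" "f \<cdot> g = Ide C Y"
  shows "is_iso C f"
proof -
  have "X = Dom C f" "Y = Cod C f" "f \<in> Arr C" using assms(1) by (auto simp: Hom_iff)
  then show ?thesis using assms(2-4) unfolding is_iso_def by blast
qed

lemma is_iso_Ide: "X \<in> Obj C \<Longrightarrow> is_iso C (Ide C X)"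
  by (rule is_isoI[OF Ide_Hom Ide_Hom]) auto

lemma is_iso_Cmp:
  assumes "is_iso C f" "is_iso C g" "Cod C f = Dom C g"
  shows "is_iso C (g \<cdot> f)"
proof -
  obtain f' where f': "f' \<in> Arr C" "Dom C f' = Cod C f" "Cod C f' = Dom C f"
    "f' \<cdot> f = Ide C (Dom C f)" "f \<cdot> f' = Ide C (Cod C f)" using assms(1) by (rule is_isoE)
  obtain g' where g': "g' \<in> Arr C" "Dom C g' = Cod C g" "Cod C g' = Dom C g"
    "g' \<cdot> g = Ide C (Dom C g)" "g \<cdot> g' = Ide C (Cod C g)" using assms(2) by (rule is_isoE)
  have fg: "f \<in> Arr C" "g \<in> Arr C" using assms by (auto simp: is_iso_def)
  have "g' \<cdot> (g \<cdot> f) = f"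
    using fg g' assms(3) by (intro Cmp_cancel_left) auto
  moreover have "f \<cdot> (f' \<cdot> g') = g'"
    using fg f' g' assms(3) by (intro Cmp_cancel_left) auto
  ultimately show ?thesis
    using fg f' g' assms(3)
    by (intro is_isoI[of _ "Dom C f" "Cod C g" "f' \<cdot> g'"]) (auto simp: Hom_iff)
qed

lemma is_iso_Cmp_cancel:
  assumes gf: "is_iso C (g \<cdot> f)" and f: "is_iso C f" and g: "g \<in> Arr C" "Dom C g = Cod C f"
  shows "is_iso C g"
proof -
  obtain f' where f': "f' \<in> Arr C" "Dom C f' = Cod C f" "Cod C f' = Dom C f"
    "f' \<cdot> f = Ide C (Dom C f)" "f \<cdot> f' = Ide C (Cod C f)" using f by (rule is_isoE)
  have fA: "f \<in> Arr C" using f by (simp add: is_iso_def)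
  have "is_iso C f'" by (rule is_isoI[of _ "Cod C f" "Dom C f" f]) (use f' fA in \<open>auto simp:
      Hom_iff\<close>)
  then have "is_iso C ((g \<cdot> f) \<cdot> f')" by (rule is_iso_Cmp[OF _ gf]) (use f' fA g in auto)
  moreover have "(g \<cdot> f) \<cdot> f' = g" using f' fA g by (intro Cmp_cancel_right) auto
  ultimately show ?thesis by simp
qed

lemma is_iso_right_cancel:
  assumes "is_iso C f" "g \<in> Arr C" "h \<in> Arr C" "Dom C g = Cod C f" "Dom C h = Cod C f"
      "g \<cdot> f = h \<cdot> f"
  shows "g = h"
proof -
  obtain f' where f': "f' \<in> Arr C" "Dom C f' = Cod C f" "Cod C f' = Dom C f"
    "f' \<cdot> f = Ide C (Dom C f)" "f \<cdot> f' = Ide C (Cod C f)" using assms(1) by (rule is_isoE)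
  have "f \<in> Arr C" using assms by (auto simp: is_iso_def)
  then have "(u \<cdot> f) \<cdot> f' = u" if "u \<in> Arr C" "Dom C u = Cod C f" for u
    using that f' by (intro Cmp_cancel_right) auto
  from this[of g] this[of h] show ?thesis using assms by metis
qed

lemma is_iso_left_cancel:
  assumes "is_iso C f" "g \<in> Arr C" "h \<in> Arr C" "Cod C g = Dom C f" "Cod C h = Dom C f"
      "f \<cdot> g = f \<cdot> h"
  shows "g = h"
proof -
  obtain f' where f': "f' \<in> Arr C" "Dom C f' = Cod C f" "Cod C f' = Dom C f"
    "f' \<cdot> f = Ide C (Dom C f)" "f \<cdot> f' = Ide C (Cod C f)" using assms(1) by (rule is_isoE)
  have "f \<in> Arr C" using assms by (auto simp: is_iso_def)
  then have "f' \<cdot> (f \<cdot> u) = u" if "u \<in> Arr C" "Cod C u = Dom C f" for u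
    using that f' by (intro Cmp_cancel_left) auto
  from this[of g] this[of h] show ?thesis using assms by metis
qed

lemma zero_obj_iso:
  assumes "is_iso C f" "zero_obj C (Dom C f) \<or> zero_obj C (Cod C f)"
  shows "zero_obj C (Dom C f)" "zero_obj C (Cod C f)"
proof -
  obtain g where g: "g \<in> Arr C" "Dom C g = Cod C f" "Cod C g = Dom C f"
    "g \<cdot> f = Ide C (Dom C f)" "f \<cdot> g = Ide C (Cod C f)" using assms(1) by (rule is_isoE)
  have f: "f \<in> Arr C" using assms by (auto simp: is_iso_def)
  have fH: "f \<in> Hom C (Dom C f) (Cod C f)" and gH: "g \<in> Hom C (Cod C f) (Dom C f)"
    using f g by (auto simp: Hom_iff)
  have "f = Zer C (Dom C f) (Cod C f)"
    using assms(2) zero_obj_arrows(1)[OF _ fH] zero_obj_arrows(2)[OF _ fH] by blast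
  then have "f \<cdot> g = Zer C (Cod C f) (Cod C f)" "g \<cdot> f = Zer C (Dom C f) (Dom C f)"
    using g f Cmp_Zer_left[of g "Cod C f" "Dom C f"] Cmp_Zer_right[of g "Dom C f" "Cod C f"] by auto
  then show "zero_obj C (Dom C f)" "zero_obj C (Cod C f)"
    using f g by (simp_all add: zero_obj_iff)
qed

end

text \<open>The axioms of a triangulated category that do not mention triangles. The Verdier
  quotients are shown to satisfy these, which is enough to speak of powers of the suspension and of
  graded endomorphism modules there.\<close>

locale shift_category = additive_category +
  assumes ShO_bij: "bij_betw (ShO C) (Obj C) (Obj C)"
    and ShA_bij: "bij_betw (ShA C) (Arr C) (Arr C)"
    and ShA_Hom: "f \<in> Hom C X Y \<Longrightarrow> ShA C f \<in> Hom C (ShO C X) (ShO C Y)"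
    and ShA_Ide: "X \<in> Obj C \<Longrightarrow> ShA C (Ide C X) = Ide C (ShO C X)"
    and ShA_Cmp: "f \<in> Hom C X Y \<Longrightarrow> g \<in> Hom C Y Z \<Longrightarrow> ShA C (g \<cdot> f) = ShA C g \<cdot> ShA C f"
    and ShA_Add: "f \<in> Hom C X Y \<Longrightarrow> f' \<in> Hom C X Y \<Longrightarrow>
      ShA C (Add C f f') = Add C (ShA C f) (ShA C f')"

sublocale triangulated_category \<subseteq> shift_category
  by unfold_locales (fact ShO_bij ShA_bij ShA_Hom ShA_Ide ShA_Cmp ShA_Add)+

text \<open>Negative powers of the suspension use the inverse bijection, so additivity and functoriality
  of all powers come from closure of additive endofunctors under composition.\<close>

definition additive_endo :: "('o, 'm) tcat \<Rightarrow> ('o \<Rightarrow> 'o) \<Rightarrow> ('m \<Rightarrow> 'm) \<Rightarrow> bool" where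
  "additive_endo C F0 F1 \<longleftrightarrow>
     (\<forall>X\<in>Obj C. F0 X \<in> Obj C) \<and>
     (\<forall>X Y f. f \<in> Hom C X Y \<longrightarrow> F1 f \<in> Hom C (F0 X) (F0 Y)) \<and>
     (\<forall>X\<in>Obj C. F1 (Ide C X) = Ide C (F0 X)) \<and>
     (\<forall>X Y Z f g. f \<in> Hom C X Y \<longrightarrow> g \<in> Hom C Y Z \<longrightarrow> F1 (g \<cdot>\<^bsub>C\<^esub> f) = F1 g \<cdot>\<^bsub>C\<^esub> F1 f) \<and>
     (\<forall>X Y f g. f \<in> Hom C X Y \<longrightarrow> g \<in> Hom C X Y \<longrightarrow> F1 (Add C f g) = Add C (F1 f) (F1 g))"

lemma additive_endo_funpow:
  assumes "additive_endo C F0 F1"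
  shows "additive_endo C (F0 ^^ n) (F1 ^^ n)"
proof (induction n)
  case 0
  then show ?case by (simp add: additive_endo_def)
next
  case (Suc n)
  have *: "additive_endo C (F0 \<circ> G0) (F1 \<circ> G1)" if "additive_endo C G0 G1" for G0 G1
  proof -
    note F = assms[unfolded additive_endo_def] and G = that[unfolded additive_endo_def]
    have GH: "G1 f \<in> Hom C (G0 X) (G0 Y)" if "f \<in> Hom C X Y" for f X Y using G that by blast
    show ?thesis
      unfolding additive_endo_def o_def
    proof (intro conjI allI impI ballI)
      fix X Y Z f g assume f: "f \<in> Hom C X Y" and g: "g \<in> Hom C Y Z"
      have "G1 (g \<cdot>\<^bsub>C\<^esub> f) = G1 g \<cdot>\<^bsub>C\<^esub> G1 f" using G f g by blast
      then show "F1 (G1 (g \<cdot>\<^bsub>C\<^esub> f)) = F1 (G1 g) \<cdot>\<^bsub>C\<^esub> F1 (G1 f)"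
        using F GH[OF f] GH[OF g] by simp
    next
      fix X Y f g assume f: "f \<in> Hom C X Y" and g: "g \<in> Hom C X Y"
      have "G1 (Add C f g) = Add C (G1 f) (G1 g)" using G f g by blast
      then show "F1 (G1 (Add C f g)) = Add C (F1 (G1 f)) (F1 (G1 g))"
        using F GH[OF f] GH[OF g] by simp
    qed (use F G GH in auto)
  qed
  show ?case using *[OF Suc] by (simp add: o_def)
qed

text \<open>Stated for a bijection of a set so that it serves objects and arrows alike. The exponent
  law for mixed signs follows by induction on \<open>m\<close> in both directions from 0.\<close>

lemma bij_betw_int_funpow:
  assumes f: "bij_betw f A A" and x: "x \<in> A"
    and p: "\<And>n y. p n y = (if 0 \<le> (n::int) then (f ^^ nat n) y else (inv_into A f ^^ nat (- n)) y)"
  shows "p n x \<in> A" "p (m + n) x = p m (p n x)" "f (p n x) = p n (f x)"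
proof -
  let ?g = "inv_into A f"
  have f_in: "f y \<in> A" if "y \<in> A" for y using f that bij_betwE by blast
  have g_in: "?g y \<in> A" if "y \<in> A" for y
    using bij_betw_inv_into[OF f] that bij_betwE by blast
  have fg: "f (?g y) = y" if "y \<in> A" for y using bij_betw_inv_into_right[OF f that] .
  have gf: "?g (f y) = y" if "y \<in> A" for y using bij_betw_inv_into_left[OF f that] .
  have pow_f: "(f ^^ k) y \<in> A" and pow_g: "(?g ^^ k) y \<in> A" if "y \<in> A" for k y
    using that by (induction k) (auto intro: f_in g_in)
  have cl: "p n y \<in> A" if "y \<in> A" for n y using pow_f pow_g that by (simp add: p)
  show "p n x \<in> A" using cl x .
  have step: "p (n + 1) y = f (p n y)" if "y \<in> A" for n y
  proof (cases "0 \<le> n")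
    case True
    then show ?thesis by (simp add: p nat_add_distrib)
  next
    case False
    \<comment> \<open>One inverse is split off to cancel against \<open>f\<close>; for
      \<open>n = -1\<close> the successor is 0, where the definition switches to its other
      branch.\<close>
    then obtain k where k: "nat (- n) = Suc k"
        by (metis gr0_conv_Suc neg_0_less_iff_less not_le zero_less_nat_eq)
    then have n: "n = - int (Suc k)" using False by linarith
    have "p n y = ?g ((?g ^^ k) y)" using False k by (simp add: p)
    moreover have "p (n + 1) y = (?g ^^ k) y"
    proof (cases "0 \<le> n + 1")
      case True
      then have "k = 0" "nat (n + 1) = 0" using n by linarith+
      then show ?thesis using True by (simp add: p)
    next
      case False
      have "nat (- (n + 1)) = k" using n by linarith
      then show ?thesis using False unfolding p by simp
    qed
    ultimately show ?thesis using fg pow_g that by simp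
  qed
  have step': "p (n - 1) y = ?g (p n y)" if "y \<in> A" for n y
    using step[OF that, of "n - 1"] gf cl that by simp
  have "\<forall>y\<in>A. p (m + n) y = p m (p n y)" for m n
  proof (induction m rule: int_induct[of _ 0])
    case base
    then show ?case by (simp add: p)
  next
    case (step1 i)
    show ?case
    proof
      fix y assume y: "y \<in> A"
      have "p (i + 1 + n) y = f (p (i + n) y)" using step[OF y, of "i + n"]
          by (simp add: algebra_simps)
      then show "p (i + 1 + n) y = p (i + 1) (p n y)" using step1 y step[OF cl[OF y]] by simp
    qed
  next
    case (step2 i)
    show ?case
    proof
      fix y assume y: "y \<in> A"
      have "p (i - 1 + n) y = ?g (p (i + n) y)" using step'[OF y, of "i + n"]
          by (simp add: algebra_simps)
      then show "p (i - 1 + n) y = p (i - 1) (p n y)" using step2 y step'[OF cl[OF y]] by simp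
    qed
  qed
  then show add: "p (m + n) x = p m (p n x)" for m n using x by blast
  have "p 1 y = f y" for y by (simp add: p)
  then show "f (p n x) = p n (f x)"
    using add[of n 1] add[of 1 n] by (simp add: add.commute)
qed

context shift_category
begin

lemma ShO_Obj [simp]: "X \<in> Obj C \<Longrightarrow> ShO C X \<in> Obj C"
  using ShO_bij bij_betwE by blast

lemma additive_endo_ShA: "additive_endo C (ShO C) (ShA C)"
  unfolding additive_endo_def using ShA_Hom ShA_Ide ShA_Cmp ShA_Add by auto

text \<open>\<open>ShA C\<close> is injective on arrows, so each law for the inverse may be checked
  after applying it, where it is the corresponding law of the suspension.\<close>

lemma additive_endo_inv: "additive_endo C (inv_into (Obj C) (ShO C)) (inv_into (Arr C) (ShA C))"
proof -
  let ?O = "inv_into (Obj C) (ShO C)" and ?A = "inv_into (Arr C) (ShA C)"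
  have O: "?O X \<in> Obj C" "ShO C (?O X) = X" if "X \<in> Obj C" for X
    using bij_betw_inv_into[OF ShO_bij] bij_betw_inv_into_right[OF ShO_bij] that bij_betwE by blast+
  have O': "?O (ShO C X) = X" if "X \<in> Obj C" for X
    using bij_betw_inv_into_left[OF ShO_bij that] .
  have A: "?A f \<in> Hom C (?O X) (?O Y)" "ShA C (?A f) = f" if f: "f \<in> Hom C X Y" for f X Y
  proof -
    have fA: "f \<in> Arr C" by (rule ArrI[OF f])
    have 1: "?A f \<in> Arr C" and 2: "ShA C (?A f) = f"
      using bij_betw_inv_into[OF ShA_bij] bij_betw_inv_into_right[OF ShA_bij] fA bij_betwE by blast+
    have "f \<in> Hom C (ShO C (Dom C (?A f))) (ShO C (Cod C (?A f)))"
      using ShA_Hom[of "?A f"] 1 2 by (simp add: Hom_iff)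
    then show "?A f \<in> Hom C (?O X) (?O Y)" "ShA C (?A f) = f"
      using f 1 2 O' by (auto simp: Hom_iff)
  qed
  have inj: "f = g" if "f \<in> Arr C" "g \<in> Arr C" "ShA C f = ShA C g" for f g
    using ShA_bij that unfolding bij_betw_def inj_on_def by blast
  show ?thesis
    unfolding additive_endo_def
  proof (intro conjI allI impI ballI)
    show "?A (Ide C X) = Ide C (?O X)" if X: "X \<in> Obj C" for X
      using A[OF Ide_Hom[OF X]] O[OF X] ShA_Ide[OF O(1)[OF X]] by - (rule inj, auto simp: Hom_iff)
    show "?A (g \<cdot> f) = ?A g \<cdot> ?A f" if f: "f \<in> Hom C X Y" and g: "g \<in> Hom C Y Z" for X Y Z f g
      using A[OF f] A[OF g] A[OF Cmp_Hom[OF f g]] ShA_Cmp[OF A(1)[OF f] A(1)[OF g]]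
      by - (rule inj, auto simp: Hom_iff)
    show "?A (Add C f g) = Add C (?A f) (?A g)" if f: "f \<in> Hom C X Y" and g: "g \<in> Hom C X Y"
        for X Y f g
      using A[OF f] A[OF g] A[OF Add_Hom[OF f g]] ShA_Add[OF A(1)[OF f] A(1)[OF g]]
      by - (rule inj, auto simp: Hom_iff)
  qed (use O A in auto)
qed

lemma additive_endo_pow: "additive_endo C (ShO_pow C n) (ShA_pow C n)"
proof (cases "0 \<le> n")
  case True
  then have "ShO_pow C n = ShO C ^^ nat n" "ShA_pow C n = ShA C ^^ nat n"
    by (auto simp: ShO_pow_def ShA_pow_def fun_eq_iff)
  then show ?thesis using additive_endo_funpow[OF additive_endo_ShA] by simp
next
  case False
  then have "ShO_pow C n = inv_into (Obj C) (ShO C) ^^ nat (- n)"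
    "ShA_pow C n = inv_into (Arr C) (ShA C) ^^ nat (- n)"
    by (auto simp: ShO_pow_def ShA_pow_def fun_eq_iff)
  then show ?thesis using additive_endo_funpow[OF additive_endo_inv] by simp
qed

lemma ShO_pow_Obj [simp]: "X \<in> Obj C \<Longrightarrow> ShO_pow C n X \<in> Obj C"
  using additive_endo_pow by (simp add: additive_endo_def)

lemma ShA_pow_Hom: "f \<in> Hom C X Y \<Longrightarrow> ShA_pow C n f \<in> Hom C (ShO_pow C n X) (ShO_pow C n Y)"
  using additive_endo_pow by (simp add: additive_endo_def)

lemma ShA_pow_typed [simp]:
  assumes "f \<in> Arr C"
  shows "ShA_pow C n f \<in> Arr C" "Dom C (ShA_pow C n f) = ShO_pow C n (Dom C f)"
    "Cod C (ShA_pow C n f) = ShO_pow C n (Cod C f)"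
  using ShA_pow_Hom[of f "Dom C f" "Cod C f" n] assms by (auto simp: Hom_iff)

lemma ShA_typed [simp]:
  assumes "f \<in> Arr C"
  shows "ShA C f \<in> Arr C" "Dom C (ShA C f) = ShO C (Dom C f)" "Cod C (ShA C f) = ShO C (Cod C f)"
  using ShA_Hom[of f "Dom C f" "Cod C f"] assms by (auto simp: Hom_iff)

lemma ShA_pow_Ide [simp]: "X \<in> Obj C \<Longrightarrow> ShA_pow C n (Ide C X) = Ide C (ShO_pow C n X)"
  using additive_endo_pow by (simp add: additive_endo_def)

lemma ShA_pow_Cmp: "f \<in> Arr C \<Longrightarrow> g \<in> Arr C \<Longrightarrow> Cod C f = Dom C g \<Longrightarrow>
    ShA_pow C n (g \<cdot> f) = ShA_pow C n g \<cdot> ShA_pow C n f"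
  using additive_endo_pow unfolding additive_endo_def Hom_iff by blast

lemma ShA_Cmp_Arr: "f \<in> Arr C \<Longrightarrow> g \<in> Arr C \<Longrightarrow> Cod C f = Dom C g \<Longrightarrow>
    ShA C (g \<cdot> f) = ShA C g \<cdot> ShA C f"
  using ShA_Cmp unfolding Hom_iff by blast

lemma ShA_pow_Add: "f \<in> Hom C X Y \<Longrightarrow> g \<in> Hom C X Y \<Longrightarrow>
    ShA_pow C n (Add C f g) = Add C (ShA_pow C n f) (ShA_pow C n g)"
  using additive_endo_pow unfolding additive_endo_def by blast

lemma additive_endo_Zer:
  assumes "additive_endo C F0 F1" "X \<in> Obj C" "Y \<in> Obj C"
  shows "F1 (Zer C X Y) = Zer C (F0 X) (F0 Y)"
proof -
  have "F1 (Zer C X Y) = Add C (F1 (Zer C X Y)) (F1 (Zer C X Y))"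
    using assms Add_Zer[OF Zer_Hom[OF assms(2,3)]] Zer_Hom[OF assms(2,3)]
    unfolding additive_endo_def by metis
  moreover have "F1 (Zer C X Y) \<in> Hom C (F0 X) (F0 Y)"
    using assms Zer_Hom[OF assms(2,3)] unfolding additive_endo_def by blast
  ultimately show ?thesis using Add_self_imp_Zer by metis
qed

lemma additive_endo_neg:
  assumes F: "additive_endo C F0 F1" and f: "f \<in> Arr C"
  shows "F1 (neg C f) = neg C (F1 f)"
proof -
  let ?X = "Dom C f" and ?Y = "Cod C f"
  have fH: "f \<in> Hom C ?X ?Y" using f by (simp add: Hom_iff)
  note nH = neg_Hom[OF fH]
  have "Add C (F1 f) (F1 (neg C f)) = F1 (Add C f (neg C f))"
    using F fH nH unfolding additive_endo_def by metis
  also have "\<dots> = Zer C (F0 ?X) (F0 ?Y)"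
    using additive_endo_Zer[OF F] f by (simp add: Add_neg[OF fH])
  finally show ?thesis
    using Add_eq_Zer F fH nH unfolding additive_endo_def by metis
qed

lemma ShA_pow_Zer [simp]: "X \<in> Obj C \<Longrightarrow> Y \<in> Obj C \<Longrightarrow>
    ShA_pow C n (Zer C X Y) = Zer C (ShO_pow C n X) (ShO_pow C n Y)"
  by (rule additive_endo_Zer[OF additive_endo_pow])

lemma ShA_Zer [simp]: "X \<in> Obj C \<Longrightarrow> Y \<in> Obj C \<Longrightarrow> ShA C (Zer C X Y) = Zer C (ShO C X) (ShO C Y)"
  by (rule additive_endo_Zer[OF additive_endo_ShA])

lemma ShA_pow_neg: "f \<in> Arr C \<Longrightarrow> ShA_pow C n (neg C f) = neg C (ShA_pow C n f)"
  by (rule additive_endo_neg[OF additive_endo_pow])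

lemma ShA_neg: "f \<in> Arr C \<Longrightarrow> ShA C (neg C f) = neg C (ShA C f)"
  by (rule additive_endo_neg[OF additive_endo_ShA])

lemma is_iso_ShA:
  assumes "is_iso C f"
  shows "is_iso C (ShA C f)"
proof -
  obtain g where g: "g \<in> Arr C" "Dom C g = Cod C f" "Cod C g = Dom C f"
    "g \<cdot> f = Ide C (Dom C f)" "f \<cdot> g = Ide C (Cod C f)" using assms by (rule is_isoE)
  have f: "f \<in> Arr C" using assms by (simp add: is_iso_def)
  show ?thesis
    by (rule is_isoI[of _ "ShO C (Dom C f)" "ShO C (Cod C f)" "ShA C g"])
      (use f g in \<open>auto simp: Hom_iff ShA_Ide simp flip: ShA_Cmp_Arr\<close>)
qed

lemma ShO_pow_add: "X \<in> Obj C \<Longrightarrow> ShO_pow C m (ShO_pow C n X) = ShO_pow C (m + n) X"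
  using bij_betw_int_funpow(2)[OF ShO_bij _ ShO_pow_def] by simp

lemma ShA_pow_add: "f \<in> Arr C \<Longrightarrow> ShA_pow C m (ShA_pow C n f) = ShA_pow C (m + n) f"
  using bij_betw_int_funpow(2)[OF ShA_bij _ ShA_pow_def] by simp

lemma ShO_pow_0 [simp]: "ShO_pow C 0 X = X"
  by (simp add: ShO_pow_def)

lemma ShA_pow_0 [simp]: "ShA_pow C 0 f = f"
  by (simp add: ShA_pow_def)

lemma ShO_pow_1: "ShO_pow C 1 X = ShO C X"
  by (simp add: ShO_pow_def)

lemma ShA_pow_1: "ShA_pow C 1 f = ShA C f"
  by (simp add: ShA_pow_def)

lemma ShO_pow_ShO: "X \<in> Obj C \<Longrightarrow> ShO_pow C n (ShO C X) = ShO_pow C (n + 1) X"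
  using ShO_pow_add[of X n 1] by (simp add: ShO_pow_1)

lemma ShO_ShO_pow: "X \<in> Obj C \<Longrightarrow> ShO C (ShO_pow C n X) = ShO_pow C (n + 1) X"
  using ShO_pow_add[of X 1 n] by (simp add: ShO_pow_1 add.commute)

lemma ShA_pow_eq_Zer:
  assumes "f \<in> Hom C X Y"
  shows "ShA_pow C n f = Zer C (ShO_pow C n X) (ShO_pow C n Y) \<longleftrightarrow> f = Zer C X Y"
proof
  note XY = Hom_Obj[OF assms]
  assume "ShA_pow C n f = Zer C (ShO_pow C n X) (ShO_pow C n Y)"
  then have "ShA_pow C (- n) (ShA_pow C n f) = Zer C X Y" using XY by (simp add: ShO_pow_add)
  then show "f = Zer C X Y" using ArrI[OF assms] by (simp add: ShA_pow_add)
qed (use Hom_Obj[OF assms] in simp)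

end

section \<open>Triangulated categories and thick subcategories\<close>

context triangulated_category
begin

section \<open>Exact triangles\<close>

lemma TriD:
  assumes "(f, g, h) \<in> Tri C"
  shows "f \<in> Arr C" "g \<in> Arr C" "h \<in> Arr C" "Dom C g = Cod C f" "Dom C h = Cod C g"
    "Cod C h = ShO C (Dom C f)"
  using Tri_typed[OF assms] unfolding Hom_iff by metis+

lemma Tri_rot:
  assumes "(f, g, h) \<in> Tri C"
  shows "(g, h, neg C (ShA C f)) \<in> Tri C"
  using assms Tri_rotate[of f g h] Tri_typed[OF assms] TriD[OF assms] by (auto simp: Hom_iff)

text \<open>\<open>k\<close> is minus the desuspension of \<open>h\<close>, so that the sign in the
  rotation axiom cancels.\<close>

lemma Tri_rot_back:
  assumes T: "(f, g, h) \<in> Tri C"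
  obtains k where "k \<in> Arr C" "Cod C k = Dom C f" "ShO C (Dom C k) = Cod C g" "h = neg C (ShA C k)"
    "(k, f, g) \<in> Tri C"
proof -
  note T' = TriD[OF T]
  let ?k = "neg C (ShA_pow C (- 1) h)"
  have k: "?k \<in> Arr C" "Cod C ?k = Dom C f"
    using T' ShO_pow_add[of "Dom C f" "- 1" 1] by (simp_all add: ShO_pow_1)
  have kD: "ShO C (Dom C ?k) = Cod C g"
    using T' ShO_pow_add[of "Cod C g" 1 "- 1"] by (simp add: ShO_pow_1)
  have h: "neg C (ShA C ?k) = h"
    using T' ShA_pow_add[of h 1 "- 1"] by (simp add: ShA_neg ShA_pow_1)
  have "(?k, f, g) \<in> Tri C"
    using Tri_rotate[of ?k f g] T' T k kD h by (simp add: Hom_iff)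
  then show ?thesis using that k kD h by metis
qed

lemma Tri_fibre:
  assumes "f \<in> Arr C"
  obtains k h where "(k, f, h) \<in> Tri C"
proof -
  obtain g h where "(f, g, h) \<in> Tri C" using Tri_exists assms by blast
  then show ?thesis using that by (rule Tri_rot_back)
qed

text \<open>A map from the trivial triangle on the identity of \<open>Dom C f\<close> factors
  \<open>g \<cdot> f\<close> through a zero object.\<close>

lemma Tri_Cmp_Zer:
  assumes T: "(f, g, h) \<in> Tri C"
  shows "g \<cdot> f = Zer C (Dom C f) (Cod C g)"
proof -
  note T' = TriD[OF T]
  obtain Z where Z: "zero_obj C Z" using zero_obj_exists by blast
  let ?X = "Dom C f"
  have X: "?X \<in> Obj C" "Z \<in> Obj C" using T' Z by (auto simp: zero_obj_iff)
  have T0: "(Ide C ?X, Zer C ?X Z, Zer C Z (ShO C ?X)) \<in> Tri C"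
    using Tri_Ide[OF X(1) Z] .
  have "\<exists>c\<in>Hom C (Cod C (Zer C ?X Z)) (Cod C g). c \<cdot> Zer C ?X Z = g \<cdot> f \<and>
      ShA C (Ide C ?X) \<cdot> Zer C Z (ShO C ?X) = h \<cdot> c"
    using X T' by (intro Tri_fill[OF T0 T]) (auto simp: Hom_iff)
  then obtain c where "c \<in> Hom C Z (Cod C g)" "c \<cdot> Zer C ?X Z = g \<cdot> f" using X by auto
  then show ?thesis using X T' by (auto simp: Hom_iff)
qed

lemma Tri_Cmp_Zer':
  assumes T: "(f, g, h) \<in> Tri C"
  shows "h \<cdot> g = Zer C (Cod C f) (ShO C (Dom C f))"
  using Tri_Cmp_Zer[OF Tri_rot[OF T]] TriD[OF T] by simp

lemma Tri_Zer_exists: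
  assumes "X \<in> Obj C" "zero_obj C Z"
  shows "(Zer C X Z, Zer C Z (ShO C X), neg C (Ide C (ShO C X))) \<in> Tri C"
  using Tri_rot[OF Tri_Ide[OF assms]] assms by (simp add: ShA_Ide)

text \<open>\<open>f\<close> is a weak kernel of \<open>g\<close>: a map from the triangle on
  \<open>W \<rightarrow> 0\<close> to the rotated triangle gives the lift one suspension up, and it
  is then desuspended.\<close>

lemma Tri_lift:
  assumes T: "(f, g, h) \<in> Tri C" and a: "a \<in> Hom C W (Cod C f)" and z: "g \<cdot> a = Zer C W (Cod C g)"
  shows "\<exists>k\<in>Hom C W (Dom C f). f \<cdot> k = a"
proof -
  note T' = TriD[OF T]
  obtain Z where Z: "zero_obj C Z" using zero_obj_exists by blast
  have W: "W \<in> Obj C" "Z \<in> Obj C" using Hom_Obj[OF a] Z by (auto simp: zero_obj_iff)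
  note a' = a[unfolded Hom_iff]
  note T0 = Tri_Zer_exists[OF W(1) Z]
  let ?b = "Zer C Z (Cod C g)"
  have "\<exists>c\<in>Hom C (Cod C (Zer C Z (ShO C W))) (Cod C h). c \<cdot> Zer C Z (ShO C W) = h \<cdot> ?b \<and>
      ShA C a \<cdot> neg C (Ide C (ShO C W)) = neg C (ShA C f) \<cdot> c"
    using W a' T' z by (intro Tri_fill[OF T0 Tri_rot[OF T]]) (auto simp: Hom_iff)
  then obtain c where c: "c \<in> Hom C (ShO C W) (Cod C h)"
    and eq: "ShA C a \<cdot> neg C (Ide C (ShO C W)) = neg C (ShA C f) \<cdot> c"
    using W by auto
  note c' = c[unfolded Hom_iff]
  have "neg C (ShA C a) = neg C (ShA C f \<cdot> c)"
    using eq W a' T' c' by simp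
  then have eq': "ShA C a = ShA C f \<cdot> c"
    by (rule neg_inject) (use a' T' c' in auto)
  let ?k = "ShA_pow C (- 1) c"
  have cc: "ShA C ?k = c" using c' ShA_pow_add[of c 1 "- 1"] by (simp add: ShA_pow_1)
  have k: "?k \<in> Hom C W (Dom C f)"
    using ShA_pow_Hom[OF c, of "- 1"] T' W ShO_pow_add[of W "-1" 1] ShO_pow_add[of "Dom C f" "-1" 1]
    by (simp add: ShO_pow_1)
  have "ShA C (f \<cdot> ?k) = ShA C a"
    using eq' cc k T' ShA_Cmp_Arr[of ?k f] by (simp add: Hom_iff)
  then have "f \<cdot> ?k = a"
    using ShA_bij k T' a' unfolding bij_betw_def inj_on_def Hom_iff by auto
  then show ?thesis using k by blast
qed

lemma Tri_from_zero:
  assumes "X \<in> Obj C" and Z: "zero_obj C Z"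
  shows "(Zer C Z X, Ide C X, Zer C X (ShO C Z)) \<in> Tri C"
proof -
  have ZO: "Z \<in> Obj C" using Z by (simp add: zero_obj_iff)
  have "Ide C (ShO C Z) = Zer C (ShO C Z) (ShO C Z)"
    using Z ZO by (simp add: zero_obj_iff flip: ShA_Ide)
  then have SZ: "zero_obj C (ShO C Z)" using ZO by (simp add: zero_obj_iff)
  show ?thesis
    using Tri_rotate[of "Zer C Z X" "Ide C X" "Zer C X (ShO C Z)"] Tri_Ide[OF assms(1) SZ] assms(1)
        ZO
    by (simp add: Hom_iff)
qed

text \<open>Dual to \<open>Tri_lift\<close>: \<open>g\<close> is a weak cokernel of
  \<open>f\<close>, by a map to the triangle on \<open>0 \<rightarrow> W\<close>.\<close>

lemma Tri_extend:
  assumes T: "(f, g, h) \<in> Tri C" and a: "a \<in> Hom C (Cod C f) W" and z: "a \<cdot> f = Zer C (Dom C f) W"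
  shows "\<exists>k\<in>Hom C (Cod C g) W. k \<cdot> g = a"
proof -
  note T' = TriD[OF T]
  obtain Z where Z: "zero_obj C Z" using zero_obj_exists by blast
  have W: "W \<in> Obj C" "Z \<in> Obj C" using Hom_Obj[OF a] Z by (auto simp: zero_obj_iff)
  note a' = a[unfolded Hom_iff]
  note T0 = Tri_from_zero[OF W(1) Z]
  have "\<exists>c\<in>Hom C (Cod C g) (Cod C (Ide C W)). c \<cdot> g = Ide C W \<cdot> a \<and>
      ShA C (Zer C (Dom C f) Z) \<cdot> h = Zer C W (ShO C Z) \<cdot> c"
    using W a' T' z by (intro Tri_fill[OF T T0]) (auto simp: Hom_iff)
  then show ?thesis using W a' by auto
qed

text \<open>A zero first arrow splits the triangle: the identity of \<open>Cod C f\<close> kills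
  \<open>f\<close> and so extends along \<open>g\<close> to a retraction. For a thick subcategory
  this means that an object belongs to it as soon as the cone of some zero arrow into the object
  does.\<close>

lemma Tri_Zer_biproduct:
  assumes T: "(f, g, h) \<in> Tri C" and f: "f = Zer C (Dom C f) (Cod C f)"
  shows "is_biproduct C (Cod C f) (ShO C (Dom C f)) (Cod C g)"
proof -
  note T' = TriD[OF T]
  let ?X = "Dom C f" and ?Y = "Cod C f" and ?Z = "Cod C g"
  have O: "?X \<in> Obj C" "?Y \<in> Obj C" "?Z \<in> Obj C" using T' by auto
  have zf: "u \<cdot> f = Zer C ?X (Cod C u)" if "u \<in> Arr C" "Dom C u = ?Y" for u
    using that O by (subst f) simp
  obtain r where r: "r \<in> Hom C ?Z ?Y" "r \<cdot> g = Ide C ?Y"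
    using Tri_extend[OF T, of "Ide C ?Y" ?Y] zf[of "Ide C ?Y"] O by (auto simp: Hom_iff)
  note r' = r(1)[unfolded Hom_iff]
  have gr: "g \<cdot> r \<in> Hom C ?Z ?Z" using r' T' by (simp add: Hom_iff)
  have id: "Ide C ?Z \<in> Hom C ?Z ?Z" using O by (simp add: Hom_iff)
  let ?e = "Add C (Ide C ?Z) (neg C (g \<cdot> r))"
  have e: "?e \<in> Hom C ?Z ?Z" by (rule Add_Hom[OF id neg_Hom[OF gr]])
  have gH: "g \<in> Hom C ?Y ?Z" using T' by (simp add: Hom_iff)
  have hH: "h \<in> Hom C ?Z (ShO C ?X)" using T' by (simp add: Hom_iff)
  have hg: "h \<cdot> g = Zer C ?Y (ShO C ?X)" by (rule Tri_Cmp_Zer'[OF T])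
  have "(g \<cdot> r) \<cdot> g = g" using r r' T' by simp
  \<comment> \<open>The complementary projection kills \<open>g\<close>, hence factors through
    \<open>h\<close>; the factor \<open>k\<close> is the second inclusion.\<close>
  then have "?e \<cdot> g = Zer C ?Y ?Z"
    using Cmp_Add_left[OF gH id neg_Hom[OF gr]] r' T' Add_neg[OF gH] O by simp
  then obtain k where k: "k \<in> Hom C (ShO C ?X) ?Z" "k \<cdot> h = ?e"
    using Tri_extend[OF Tri_rot[OF T], of ?e ?Z] e T' by auto
  note k' = k(1)[unfolded Hom_iff]
  have S: "neg C (ShA C f) = Zer C (ShO C ?X) (ShO C ?Y)"
    using T' O by (subst f) simp
  \<comment> \<open>The arrow following \<open>h\<close> is, up to sign, the suspension of the zero
    arrow \<open>f\<close>; a difference that vanishes on \<open>h\<close> factors through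
    it.\<close>
  have h_epi: "u = v" if u: "u \<in> Hom C (ShO C ?X) W" and v: "v \<in> Hom C (ShO C ?X) W"
      and eq: "u \<cdot> h = v \<cdot> h" for u v W
  proof -
    let ?d = "Add C u (neg C v)"
    note W = Hom_Obj(2)[OF u]
    have "?d \<cdot> h = Zer C ?Z W"
      using Cmp_Add_left[OF hH u neg_Hom[OF v]] eq u v T' Add_neg[OF Cmp_Hom[OF hH v]]
          by (simp add: Hom_iff)
    then obtain l where l: "l \<in> Hom C (Cod C (neg C (ShA C f))) W" "l \<cdot> neg C (ShA C f) = ?d"
      using Tri_extend[OF Tri_rot[OF Tri_rot[OF T]], of ?d W] Add_Hom[OF u neg_Hom[OF v]] T' by auto
    then have "?d = Zer C (ShO C ?X) W"
      unfolding S using O T' by (auto simp: Hom_iff)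
    then show ?thesis by (rule eq_if_diff_Zer[OF u v])
  qed
  have idg: "h \<cdot> ?e = h"
  proof -
    have "h \<cdot> (g \<cdot> r) = Zer C ?Z (ShO C ?X)"
      using hg T' r' O Cmp_assoc_Arr[of r g h] by simp
    then show ?thesis
      using Cmp_Add_right[OF id neg_Hom[OF gr] hH] T' r' O Add_Zer[OF hH] by simp
  qed
  have hk: "h \<cdot> k = Ide C (ShO C ?X)"
  proof (rule h_epi)
    show "(h \<cdot> k) \<cdot> h = Ide C (ShO C ?X) \<cdot> h" using k k' T' idg O by simp
  qed (use k' T' O in \<open>auto simp: Hom_iff\<close>)
  have rk: "r \<cdot> k = Zer C (ShO C ?X) ?Y"
  proof (rule h_epi)
    have "r \<cdot> (g \<cdot> r) = r" using r r' T' by (intro Cmp_cancel_left) auto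
    then have "r \<cdot> ?e = Zer C ?Z ?Y"
      using Cmp_Add_right[OF id neg_Hom[OF gr] r(1)] T' r' O Add_neg[OF r(1)] by simp
    then show "(r \<cdot> k) \<cdot> h = Zer C (ShO C ?X) ?Y \<cdot> h" using k k' T' r' O by simp
  qed (use k' T' r' O in \<open>auto simp: Hom_iff\<close>)
  have "Add C (g \<cdot> r) ?e = Ide C ?Z"
    using Add_commute[OF gr e] Add_assoc[OF id neg_Hom[OF gr] gr] Add_neg[OF gr] Add_Zer[OF id]
        by simp
  then show ?thesis
    unfolding is_biproduct_def using O gH hH r k hg hk rk
    by (intro conjI bexI[of _ g] bexI[of _ k] bexI[of _ r] bexI[of _ h]) (auto simp: k(2))
qed

text \<open>Cancelling the isomorphism makes both \<open>g\<close> and \<open>h\<close> zero. As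
  \<open>h\<close> is zero, the identity of the cone lifts through \<open>g\<close>, and as
  \<open>g\<close> is zero, this identity is zero.\<close>

lemma Tri_iso_zero_obj:
  assumes "f \<in> Arr C" "(f, g, h) \<in> Tri C" "is_iso C f"
  shows "zero_obj C (Cod C g)"
proof -
  note T' = TriD[OF assms(2)]
  have "g \<cdot> f = Zer C (Cod C f) (Cod C g) \<cdot> f"
    using Tri_Cmp_Zer[OF assms(2)] T' by simp
  then have g: "g = Zer C (Cod C f) (Cod C g)"
    by (rule is_iso_right_cancel[OF assms(3), rotated -1]) (use T' in auto)
  obtain f' where f': "f' \<in> Arr C" "Dom C f' = Cod C f" "Cod C f' = Dom C f"
    "f' \<cdot> f = Ide C (Dom C f)" "f \<cdot> f' = Ide C (Cod C f)" using assms(3) by (rule is_isoE)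
  have ff: "ShA C f' \<cdot> ShA C f = Ide C (ShO C (Dom C f))"
    using f' T' by (simp add: ShA_Ide flip: ShA_Cmp_Arr)
  have "ShA C f \<cdot> h = Zer C (Cod C g) (ShO C (Cod C f))"
    using Tri_Cmp_Zer'[OF Tri_rot[OF assms(2)]] T' neg_inject[of "ShA C f \<cdot> h"
        "Zer C (Cod C g) (ShO C (Cod C f))"]
    by simp
  then have "ShA C f' \<cdot> (ShA C f \<cdot> h) = Zer C (Cod C g) (ShO C (Dom C f))"
    using f' T' by simp
  moreover have "ShA C f' \<cdot> (ShA C f \<cdot> h) = h"
    using ff f' T' by (intro Cmp_cancel_left) auto
  ultimately have h: "h = Zer C (Cod C g) (ShO C (Dom C f))" by simp
  obtain k where k: "k \<in> Hom C (Cod C g) (Cod C f)" "g \<cdot> k = Ide C (Cod C g)"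
    using Tri_lift[OF Tri_rot[OF assms(2)], of "Ide C (Cod C g)" "Cod C g"] T' h
    by (metis Cmp_Ide(2) Cod_in_Obj Ide_Hom)
  have "g \<cdot> k = Zer C (Cod C g) (Cod C g)"
    using arg_cong[OF g, of "\<lambda>x. x \<cdot> k"] Cmp_Zer_left[of k "Cod C g" "Cod C f"] k T'
    by (auto simp: Hom_iff)
  then show ?thesis using k T' by (simp add: zero_obj_iff)
qed

end

section \<open>Thick subcategories and the arrows whose cone lies in them\<close>

locale thick_subcategory = triangulated_category +
  fixes S
  assumes thick: "thick C S"
begin

lemma thick_Obj: "X \<in> S \<Longrightarrow> X \<in> Obj C"
  using thick unfolding thick_def by blast

lemma thick_zero: "zero_obj C X \<Longrightarrow> X \<in> S"
  using thick unfolding thick_def by blast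

lemma thick_ShO: "X \<in> Obj C \<Longrightarrow> ShO C X \<in> S \<longleftrightarrow> X \<in> S"
  using thick unfolding thick_def by blast

lemma thick_cone: "(f, g, h) \<in> Tri C \<Longrightarrow> Dom C f \<in> S \<Longrightarrow> Cod C f \<in> S \<Longrightarrow> Cod C g \<in> S"
  using thick unfolding thick_def by blast

lemma thick_summand: "is_biproduct C X Y B \<Longrightarrow> B \<in> S \<Longrightarrow> X \<in> S"
  using thick unfolding thick_def by blast

lemma thick_Dom:
  assumes T: "(f, g, h) \<in> Tri C" and "Cod C f \<in> S" "Cod C g \<in> S"
  shows "Dom C f \<in> S"
  using thick_cone[OF Tri_rot[OF T]] TriD[OF T] assms thick_ShO[of "Dom C f"] by simp

lemma thick_Cod:
  assumes T: "(f, g, h) \<in> Tri C" and "Dom C f \<in> S" "Cod C g \<in> S"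
  shows "Cod C f \<in> S"
proof -
  obtain k where k: "k \<in> Arr C" "Cod C k = Dom C f" "ShO C (Dom C k) = Cod C g"
    "(k, f, g) \<in> Tri C" using Tri_rot_back[OF T] by metis
  then show ?thesis
    using thick_cone[OF k(4)] assms thick_ShO[of "Dom C k"] by simp
qed

lemma thick_ShO_pow:
  assumes "X \<in> Obj C"
  shows "ShO_pow C n X \<in> S \<longleftrightarrow> X \<in> S"
proof (induction n rule: int_induct[of _ 0])
  case (step1 i)
  then show ?case using assms thick_ShO[of "ShO_pow C i X"] by (simp add: ShO_ShO_pow)
next
  case (step2 i)
  then show ?case using assms thick_ShO[of "ShO_pow C (i - 1) X"] by (simp add: ShO_ShO_pow)
qed simp

text \<open>The octahedral axiom for the identity composed with \<open>f\<close> puts the two cones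
  and a zero object into one triangle, and two out of three finishes; no isomorphism between the
  cones has to be constructed.\<close>

lemma Tri_cone_unique:
  assumes T: "(f, g, h) \<in> Tri C" and T': "(f, g', h') \<in> Tri C" and "Cod C g \<in> S"
  shows "Cod C g' \<in> S"
proof -
  note D = TriD[OF T] TriD[OF T']
  have id: "(Ide C (Cod C f), Zer C (Cod C f) Z, Zer C Z (ShO C (Cod C f))) \<in> Tri C"
      if "zero_obj C Z" for Z
    using Tri_Ide[OF _ that] D by simp
  obtain Z where Z: "zero_obj C Z" using zero_obj_exists by blast
  then have ZO: "Z \<in> Obj C" by (simp add: zero_obj_iff)
  have "Ide C (Cod C f) \<cdot> f = f" using D by simp
  then obtain u v where "u \<in> Hom C (Cod C g) (Cod C g')"
      "v \<in> Hom C (Cod C g') (Cod C (Zer C (Cod C f) Z))"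
    "(u, v, ShA C g \<cdot> Zer C Z (ShO C (Cod C f))) \<in> Tri C"
    using Tri_octahedral[OF T id[OF Z], of g' h'] T' D by auto
  moreover have "Cod C (Zer C (Cod C f) Z) = Z" using D ZO by simp
  ultimately show ?thesis
    using thick_Cod[of u v] assms(3) thick_zero[OF Z] by (auto simp: Hom_iff)
qed

lemma weak_eq_iff: "(f, g, h) \<in> Tri C \<Longrightarrow> f \<in> weak_eq C S \<longleftrightarrow> Cod C g \<in> S"
  unfolding weak_eq_def using Tri_cone_unique by blast

lemma weak_eq_Arr: "f \<in> weak_eq C S \<Longrightarrow> f \<in> Arr C"
  unfolding weak_eq_def using TriD by blast

lemma weak_eq_iso: "is_iso C f \<Longrightarrow> f \<in> weak_eq C S"
  using Tri_exists[of f] thick_zero[OF Tri_iso_zero_obj] unfolding weak_eq_def is_iso_def by blast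

lemma weak_eq_Ide: "X \<in> Obj C \<Longrightarrow> Ide C X \<in> weak_eq C S"
  by (rule weak_eq_iso[OF is_iso_Ide])

text \<open>The cones of \<open>f\<close>, \<open>g \<cdot> f\<close> and \<open>g\<close> form an
  exact triangle, so two of them in \<open>S\<close> force the third into \<open>S\<close>.\<close>

lemma weak_eq_octahedral:
  assumes "f \<in> Arr C" "g \<in> Arr C" "Cod C f = Dom C g"
  shows "f \<in> weak_eq C S \<Longrightarrow> g \<in> weak_eq C S \<Longrightarrow> g \<cdot> f \<in> weak_eq C S"
    and "g \<in> weak_eq C S \<Longrightarrow> g \<cdot> f \<in> weak_eq C S \<Longrightarrow> f \<in> weak_eq C S"
proof -
  obtain f1 f2 where f: "(f, f1, f2) \<in> Tri C" using Tri_exists assms by blast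
  obtain g1 g2 where g: "(g, g1, g2) \<in> Tri C" using Tri_exists assms by blast
  obtain h1 h2 where h: "(g \<cdot> f, h1, h2) \<in> Tri C" using Tri_exists[of "g \<cdot> f"] assms by auto
  obtain u v where uv: "u \<in> Hom C (Cod C f1) (Cod C h1)" "v \<in> Hom C (Cod C h1) (Cod C g1)"
    "(u, v, ShA C f1 \<cdot> g2) \<in> Tri C"
    using Tri_octahedral[OF f g assms(3) h] by blast
  note uv' = uv(1,2)[unfolded Hom_iff]
  show "f \<in> weak_eq C S \<Longrightarrow> g \<in> weak_eq C S \<Longrightarrow> g \<cdot> f \<in> weak_eq C S"
    using thick_Cod[OF uv(3)] uv' weak_eq_iff[OF f] weak_eq_iff[OF g] weak_eq_iff[OF h] by simp
  show "g \<in> weak_eq C S \<Longrightarrow> g \<cdot> f \<in> weak_eq C S \<Longrightarrow> f \<in> weak_eq C S"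
    using thick_Dom[OF uv(3)] uv' weak_eq_iff[OF f] weak_eq_iff[OF g] weak_eq_iff[OF h] by simp
qed

end

section \<open>Verdier quotients\<close>

context thick_subcategory
begin

section \<open>Calculus of fractions\<close>

abbreviation W where "W \<equiv> weak_eq C S"

lemma W_Arr [simp]: "s \<in> W \<Longrightarrow> s \<in> Arr C"
  by (rule weak_eq_Arr)

lemma W_Cmp: "s \<in> W \<Longrightarrow> t \<in> W \<Longrightarrow> Cod C t = Dom C s \<Longrightarrow> s \<cdot> t \<in> W"
  by (rule weak_eq_octahedral(1)) auto

text \<open>The fibre of \<open>f\<close> is killed by \<open>f\<close>, and its cone is the target
  of \<open>f\<close>.\<close>

lemma W_fibre:
  assumes "f \<in> Arr C" "Cod C f \<in> S"
  obtains u where "u \<in> W" "Cod C u = Dom C f" "f \<cdot> u = Zer C (Dom C u) (Cod C f)"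
proof -
  obtain u h where T: "(u, f, h) \<in> Tri C" using Tri_fibre assms(1) by blast
  show ?thesis
    using that[of u] weak_eq_iff[OF T] assms(2) TriD[OF T] Tri_Cmp_Zer[OF T] by simp
qed

text \<open>Compose \<open>f\<close> with the arrow to the cone of \<open>t\<close>: the composite
  ends in \<open>S\<close>, so some \<open>u\<close> in \<open>W\<close> kills it, and
  \<open>f \<cdot> u\<close> then lifts through \<open>t\<close>.\<close>

lemma Ore:
  assumes "f \<in> Arr C" "t \<in> W" "Cod C f = Cod C t"
  obtains u v where "u \<in> W" "v \<in> Arr C" "Cod C u = Dom C f" "Cod C v = Dom C t" "Dom C v = Dom C u"
    "f \<cdot> u = t \<cdot> v"
proof -
  obtain g h where T: "(t, g, h) \<in> Tri C" "Cod C g \<in> S" using assms(2) unfolding weak_eq_def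
      by blast
  note T' = TriD[OF T(1)]
  have gf: "g \<cdot> f \<in> Arr C" "Cod C (g \<cdot> f) \<in> S" using T' T(2) assms by auto
  obtain u where u: "u \<in> W" "Cod C u = Dom C (g \<cdot> f)"
      "(g \<cdot> f) \<cdot> u = Zer C (Dom C u) (Cod C (g \<cdot> f))"
    using W_fibre[OF gf] by blast
  have "g \<cdot> (f \<cdot> u) = Zer C (Dom C u) (Cod C g)" using u T' assms by simp
  then obtain v where "v \<in> Hom C (Dom C u) (Dom C t)" "t \<cdot> v = f \<cdot> u"
    using Tri_lift[OF T(1), of "f \<cdot> u" "Dom C u"] u T' assms by (auto simp: Hom_iff)
  then show ?thesis using that[of u v] u T' assms by (simp add: Hom_iff)
qed

text \<open>The difference of \<open>f\<close> and \<open>g\<close> factors through the fibre of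
  \<open>t\<close>, whose source lies in \<open>S\<close>; \<open>W_fibre\<close> kills the
  factor.\<close>

lemma W_cancel:
  assumes t: "t \<in> W" and f: "f \<in> Hom C X (Dom C t)" and g: "g \<in> Hom C X (Dom C t)"
      and eq: "t \<cdot> f = t \<cdot> g"
  obtains u where "u \<in> W" "Cod C u = X" "f \<cdot> u = g \<cdot> u"
proof -
  obtain c h where T: "(t, c, h) \<in> Tri C" "Cod C c \<in> S" using t unfolding weak_eq_def by blast
  obtain k where k: "k \<in> Arr C" "Cod C k = Dom C t" "ShO C (Dom C k) = Cod C c" "(k, t, c) \<in> Tri C"
    using Tri_rot_back[OF T(1)] by metis
  have kS: "Dom C k \<in> S" using k T(2) thick_ShO[of "Dom C k"] by simp
  let ?d = "Add C f (neg C g)"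
  have d: "?d \<in> Hom C X (Dom C t)" using Add_Hom[OF f neg_Hom[OF g]] .
  have tH: "t \<in> Hom C (Dom C t) (Cod C t)" using t by (simp add: Hom_iff)
  have "t \<cdot> ?d = Zer C X (Cod C t)"
    using Cmp_Add_right[OF f neg_Hom[OF g] tH] eq Add_neg[OF Cmp_Hom[OF g tH]] f g t
        by (simp add: Hom_iff)
  then obtain e where e: "e \<in> Hom C X (Dom C k)" "k \<cdot> e = ?d"
    using Tri_lift[OF k(4), of ?d X] d k TriD[OF T(1)] by auto
  obtain u where u: "u \<in> W" "Cod C u = X" "e \<cdot> u = Zer C (Dom C u) (Dom C k)"
    using W_fibre[of e] e kS by (auto simp: Hom_iff)
  have "?d \<cdot> u = k \<cdot> (e \<cdot> u)" using e k u by (auto simp: Hom_iff simp flip: e(2))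
  then have du: "?d \<cdot> u = Zer C (Dom C u) (Dom C t)" using u k by simp
  have uH: "u \<in> Hom C (Dom C u) X" using u by (simp add: Hom_iff)
  have "Add C (f \<cdot> u) (neg C (g \<cdot> u)) = Zer C (Dom C u) (Dom C t)"
    using du Cmp_Add_left[OF uH f neg_Hom[OF g]] g u by (simp add: Hom_iff)
  then have "f \<cdot> u = g \<cdot> u" by (rule eq_if_diff_Zer[OF Cmp_Hom[OF uH f] Cmp_Hom[OF uH g]])
  then show ?thesis using that u by blast
qed

lemma W_common:
  assumes "s \<in> W" "t \<in> W" "Cod C s = Cod C t"
  obtains u v where "u \<in> W" "v \<in> W" "Cod C u = Dom C s" "Cod C v = Dom C t" "Dom C v = Dom C u"
    "s \<cdot> u = t \<cdot> v" "s \<cdot> u \<in> W"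
proof -
  obtain u v where uv: "u \<in> W" "v \<in> Arr C" "Cod C u = Dom C s" "Cod C v = Dom C t"
      "Dom C v = Dom C u"
    "s \<cdot> u = t \<cdot> v" using Ore[of s t] assms by auto
  have "s \<cdot> u \<in> W" using W_Cmp[OF assms(1) uv(1) uv(3)] .
  moreover have "v \<in> W" using weak_eq_octahedral(2)[of v t] uv assms calculation by simp
  ultimately show ?thesis using that uv by blast
qed

section \<open>Roofs and their classes\<close>

definition roof :: "'a \<Rightarrow> 'a \<Rightarrow> 'b \<Rightarrow> 'b \<Rightarrow> bool" where
  "roof X Y s f \<longleftrightarrow> s \<in> W \<and> f \<in> Arr C \<and> Cod C s = X \<and> Cod C f = Y \<and> Dom C f = Dom C s"

abbreviation cls where "cls \<equiv> roof_class C S"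

abbreviation rel where "rel \<equiv> roof_rel C S"

lemma roofs_iff: "(s, f) \<in> roofs C S \<longleftrightarrow> roof (Cod C s) (Cod C f) s f"
  by (auto simp: roofs_def roof_def)

lemma relI:
  assumes "roof X Y s f" "roof X Y t g" "u \<in> Arr C" "v \<in> Arr C" "Cod C u = Dom C s"
      "Cod C v = Dom C t"
    "Dom C v = Dom C u" "s \<cdot> u = t \<cdot> v" "s \<cdot> u \<in> W" "f \<cdot> u = g \<cdot> v"
  shows "((s, f), (t, g)) \<in> rel"
proof -
  have "(s, f) \<in> roofs C S" "(t, g) \<in> roofs C S" "u \<in> Hom C (Dom C u) (Dom C s)"
      "v \<in> Hom C (Dom C u) (Dom C t)"
    using assms(1-7) by (auto simp: roofs_iff roof_def Hom_iff)
  then show ?thesis unfolding roof_rel_def using assms(8-10) by blast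
qed

lemma relE:
  assumes "((s, f), (t, g)) \<in> rel"
  obtains u v where "roof (Cod C s) (Cod C f) s f" "roof (Cod C s) (Cod C f) t g"
    "u \<in> Arr C" "v \<in> Arr C" "Cod C u = Dom C s" "Cod C v = Dom C t"
    "Dom C v = Dom C u" "s \<cdot> u = t \<cdot> v" "s \<cdot> u \<in> W" "f \<cdot> u = g \<cdot> v"
proof -
  obtain A u v where uv: "u \<in> Hom C A (Dom C s)" "v \<in> Hom C A (Dom C t)" "s \<cdot> u = t \<cdot> v"
    "s \<cdot> u \<in> W" "f \<cdot> u = g \<cdot> v" "(s, f) \<in> roofs C S" "(t, g) \<in> roofs C S"
    using assms unfolding roof_rel_def by blast
  note r = uv(6,7)[unfolded roofs_iff roof_def]
  have "Cod C (s \<cdot> u) = Cod C s" "Cod C (t \<cdot> v) = Cod C t" "Cod C (f \<cdot> u) = Cod C f"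
      "Cod C (g \<cdot> v) = Cod C g"
    using uv(1,2) r by (simp_all add: Hom_iff)
  then have "Cod C t = Cod C s" "Cod C g = Cod C f" using uv(3,5) by simp_all
  then show ?thesis using that[of u v] uv r by (auto simp: roof_def Hom_iff)
qed

text \<open>Only transitivity has content: two refinements of the middle roof have to be
  merged.\<close>

lemma rel_equiv: "equiv (roofs C S) rel"
proof (rule equivI)
  show "rel \<subseteq> roofs C S \<times> roofs C S" unfolding roof_rel_def by blast
  show "refl_on (roofs C S) rel"
  proof (rule refl_onI)
    fix x assume x: "x \<in> roofs C S"
    obtain s f where sf: "x = (s, f)" by fastforce
    then have r: "roof (Cod C s) (Cod C f) s f" using x roofs_iff by blast
    show "(x, x) \<in> rel"
      unfolding sf by (rule relI[OF r r, of "Ide C (Dom C s)" "Ide C (Dom C s)"]) (use r in \<open>auto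
          simp: roof_def\<close>)
  qed
  show "sym rel"
    unfolding roof_rel_def by (rule symI) (auto, metis)
  show "trans rel"
  proof (rule transI)
    fix x y z assume xy: "(x, y) \<in> rel" and yz: "(y, z) \<in> rel"
    obtain s f t g r h where xyz: "x = (s, f)" "y = (t, g)" "z = (r, h)" by fastforce
    obtain u v where 1: "roof (Cod C s) (Cod C f) s f" "roof (Cod C s) (Cod C f) t g"
      "u \<in> Arr C" "v \<in> Arr C" "Cod C u = Dom C s" "Cod C v = Dom C t"
      "Dom C v = Dom C u" "s \<cdot> u = t \<cdot> v" "s \<cdot> u \<in> W" "f \<cdot> u = g \<cdot> v"
      using relE[OF xy[unfolded xyz]] by blast
    obtain u' v' where 2: "roof (Cod C t) (Cod C g) t g" "roof (Cod C t) (Cod C g) r h"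
      "u' \<in> Arr C" "v' \<in> Arr C" "Cod C u' = Dom C t" "Cod C v' = Dom C r"
      "Dom C v' = Dom C u'" "t \<cdot> u' = r \<cdot> v'" "t \<cdot> u' \<in> W" "g \<cdot> u' = h \<cdot> v'"
      using relE[OF yz[unfolded xyz]] by blast
    have c: "Cod C t = Cod C s" "Cod C g = Cod C f" "Dom C f = Dom C s" "Dom C g = Dom C t"
      "Dom C h = Dom C r" "Cod C r = Cod C s" "Cod C h = Cod C f"
      "s \<in> Arr C" "t \<in> Arr C" "r \<in> Arr C" "f \<in> Arr C" "g \<in> Arr C" "h \<in> Arr C"
      using 1(1,2) 2(1,2) by (auto simp: roof_def)
    obtain a b where ab: "a \<in> W" "b \<in> W" "Cod C a = Dom C u" "Cod C b = Dom C u'"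
        "Dom C b = Dom C a"
      "(s \<cdot> u) \<cdot> a = (t \<cdot> u') \<cdot> b" "(s \<cdot> u) \<cdot> a \<in> W"
      using W_common[OF 1(9) 2(9)] 1 2 c by auto
    have "s \<cdot> (u \<cdot> a) = t \<cdot> (v \<cdot> a)"
      by (rule Cmp_eq_extend[OF 1(8)]) (use ab(1-5) 1(3-7) c in auto)
    moreover have "s \<cdot> (u \<cdot> a) = t \<cdot> (u' \<cdot> b)" using ab(1-6) 1(3-7) 2(3-7) c by simp
    ultimately have "t \<cdot> (v \<cdot> a) = t \<cdot> (u' \<cdot> b)" by metis
    \<comment> \<open>So far the two ways into \<open>Dom C t\<close> agree only after
      \<open>t\<close>; one further refinement makes them equal.\<close>
    then obtain w where w: "w \<in> W" "Cod C w = Dom C a" "(v \<cdot> a) \<cdot> w = (u' \<cdot> b) \<cdot> w"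
      using W_cancel[of t "v \<cdot> a" "Dom C a" "u' \<cdot> b"] 1 2 ab c by (auto simp: Hom_iff roof_def)
    have w': "v \<cdot> (a \<cdot> w) = u' \<cdot> (b \<cdot> w)" using w 1(3-7) 2(3-7) ab(1-5) c by simp
    have aw: "a \<cdot> w \<in> W" "b \<cdot> w \<in> W" using W_Cmp ab w by auto
    have rr: "roof (Cod C s) (Cod C f) r h" using 2(2) c by simp
    show "(x, z) \<in> rel"
      unfolding xyz
    proof (rule relI[OF 1(1) rr, of "u \<cdot> (a \<cdot> w)" "v' \<cdot> (b \<cdot> w)"])
      have "s \<cdot> (u \<cdot> (a \<cdot> w)) = t \<cdot> (v \<cdot> (a \<cdot> w))"
        using 1 aw c ab w by (intro Cmp_eq_extend) auto
      also have "\<dots> = r \<cdot> (v' \<cdot> (b \<cdot> w))"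
        unfolding w' using 2 aw c ab w by (intro Cmp_eq_extend) auto
      finally show "s \<cdot> (u \<cdot> (a \<cdot> w)) = r \<cdot> (v' \<cdot> (b \<cdot> w))" .
      have "f \<cdot> (u \<cdot> (a \<cdot> w)) = g \<cdot> (v \<cdot> (a \<cdot> w))"
        using 1 aw c ab w by (intro Cmp_eq_extend) auto
      also have "\<dots> = h \<cdot> (v' \<cdot> (b \<cdot> w))"
        unfolding w' using 2 aw c ab w by (intro Cmp_eq_extend) auto
      finally show "f \<cdot> (u \<cdot> (a \<cdot> w)) = h \<cdot> (v' \<cdot> (b \<cdot> w))" .
      have "(s \<cdot> u) \<cdot> (a \<cdot> w) \<in> W" using W_Cmp[OF 1(9) aw(1)] 1(3-7) c ab(1-5) w(1,2) by simp
      then show "s \<cdot> (u \<cdot> (a \<cdot> w)) \<in> W" using 1(3-7) c ab(1-5) w(1,2) by simp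
    qed (use 1 2 ab w c in auto)
  qed
qed

lemma cls_eq_iff: "roof X Y s f \<Longrightarrow> roof X Y t g \<Longrightarrow> cls s f = cls t g \<longleftrightarrow> ((s, f), (t, g)) \<in> rel"
  unfolding roof_class_def using equiv_class_eq_iff[OF rel_equiv, of "(s, f)" "(t, g)"] roofs_iff
  by (auto simp: roof_def)

lemma mem_cls: "(t, g) \<in> cls s f \<longleftrightarrow> ((s, f), (t, g)) \<in> rel"
  by (simp add: roof_class_def)

lemma cls_self: "roof X Y s f \<Longrightarrow> (s, f) \<in> cls s f"
  unfolding mem_cls using cls_eq_iff[of X Y s f s f] by blast

lemma mem_cls_roof:
  assumes "roof X Y s f" "(t, g) \<in> cls s f"
  shows "roof X Y t g" "cls t g = cls s f"
proof -
  show 1: "roof X Y t g" using relE[OF assms(2)[unfolded mem_cls]] assms(1) unfolding roof_def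
      by metis
  show "cls t g = cls s f" using cls_eq_iff[OF assms(1) 1] assms(2) by (simp add: mem_cls)
qed

lemma cls_refine:
  assumes "roof X Y s f" "w \<in> Arr C" "Cod C w = Dom C s" "s \<cdot> w \<in> W"
  shows "roof X Y (s \<cdot> w) (f \<cdot> w)" "cls (s \<cdot> w) (f \<cdot> w) = cls s f"
proof -
  show 1: "roof X Y (s \<cdot> w) (f \<cdot> w)" using assms by (auto simp: roof_def)
  show "cls (s \<cdot> w) (f \<cdot> w) = cls s f"
    unfolding cls_eq_iff[OF 1 assms(1)]
    by (rule relI[OF 1 assms(1), of "Ide C (Dom C w)" w]) (use assms in \<open>auto simp: roof_def\<close>)
qed

lemma cls_refine_W:
  assumes "roof X Y s f" "w \<in> W" "Cod C w = Dom C s"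
  shows "roof X Y (s \<cdot> w) (f \<cdot> w)" "cls (s \<cdot> w) (f \<cdot> w) = cls s f"
  using cls_refine[of X Y s f w] W_Cmp[of s w] assms by (auto simp: roof_def)

text \<open>The witnesses \<open>u\<close> and \<open>v\<close> agree after \<open>s\<close>, hence
  after a refinement. By two out of three \<open>u\<close> lies in \<open>W\<close>, so the
  resulting arrow is again admissible.\<close>

lemma cls_eqD:
  assumes "roof X Y s f" "roof X Y s g" "cls s f = cls s g"
  obtains w where "w \<in> W" "Cod C w = Dom C s" "f \<cdot> w = g \<cdot> w"
proof -
  obtain u v where 1: "u \<in> Arr C" "v \<in> Arr C" "Cod C u = Dom C s" "Cod C v = Dom C s"
    "Dom C v = Dom C u" "s \<cdot> u = s \<cdot> v" "s \<cdot> u \<in> W" "f \<cdot> u = g \<cdot> v"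
    using relE[of s f s g] assms cls_eq_iff[OF assms(1,2)] by metis
  have s: "s \<in> W" "f \<in> Arr C" "g \<in> Arr C" "Dom C f = Dom C s" "Dom C g = Dom C s"
    using assms by (auto simp: roof_def)
  obtain w where w: "w \<in> W" "Cod C w = Dom C u" "u \<cdot> w = v \<cdot> w"
    using W_cancel[of s u "Dom C u" v] 1 s by (auto simp: Hom_iff)
  have "u \<in> W" using weak_eq_octahedral(2)[of u s] 1(1-5,7) s by simp
  then have "u \<cdot> w \<in> W" using w(1,2) by (rule W_Cmp)
  moreover have "f \<cdot> (u \<cdot> w) = g \<cdot> (v \<cdot> w)"
    by (rule Cmp_eq_extend[OF 1(8)]) (use w(1,2) 1(1-5) s in auto)
  then have "f \<cdot> (u \<cdot> w) = g \<cdot> (u \<cdot> w)" unfolding w(3) .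
  ultimately show ?thesis using that[of "u \<cdot> w"] 1(1-5) w(1,2) by fastforce
qed

abbreviation Q where "Q \<equiv> verdier C S"

abbreviation q where "q \<equiv> quotient_arr C S"

lemma verdier_simps [simp]:
  "Obj Q = Obj C" "Ide Q X = q (Ide C X)" "Zer Q X Y = q (Zer C X Y)" "ShO Q = ShO C"
  "Arr Q = roofs C S // rel" "ShA Q = (\<lambda>a. map_prod (ShA C) (ShA C) ` a)"
  by (simp_all add: verdier_def verdier_pre_def Let_def)

lemma quotient_arr_cls: "q f = cls (Ide C (Dom C f)) f"
  by (simp add: quotient_arr_def)

lemma roof_Ide: "f \<in> Arr C \<Longrightarrow> roof (Dom C f) (Cod C f) (Ide C (Dom C f)) f"
  by (simp add: roof_def weak_eq_Ide)

text \<open>Domain and codomain in the quotient are read off a chosen representative, so all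
  representatives of a class must share their endpoints.\<close>

lemma roof_Hom:
  assumes r: "roof X Y s f"
  shows "cls s f \<in> Hom Q X Y"
proof -
  let ?r = "SOME r. r \<in> cls s f"
  have "?r \<in> cls s f" using cls_self[OF r] by (rule someI)
  then have "Cod C (fst ?r) = X" "Cod C (snd ?r) = Y"
    using mem_cls_roof(1)[OF r, of "fst ?r" "snd ?r"] by (auto simp: roof_def)
  moreover have "cls s f \<in> roofs C S // rel"
    unfolding roof_class_def by (rule quotientI) (use r in \<open>auto simp: roofs_iff roof_def\<close>)
  ultimately show ?thesis
    by (simp add: Hom_iff verdier_def verdier_pre_def Let_def)
qed

lemma Hom_roof:
  assumes "a \<in> Hom Q X Y"
  obtains s f where "roof X Y s f" "a = cls s f"
proof -
  have "a \<in> roofs C S // rel" using assms by (simp add: Hom_iff)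
  then obtain s f where sf: "(s, f) \<in> roofs C S" "a = cls s f"
    unfolding roof_class_def by (auto elim!: quotientE)
  then have r: "roof (Cod C s) (Cod C f) s f" by (simp add: roofs_iff)
  have "X = Cod C s" "Y = Cod C f" using roof_Hom[OF r] assms sf by (auto simp: Hom_iff)
  then show ?thesis using that r sf by blast
qed

lemma quotient_Hom: "f \<in> Hom C X Y \<Longrightarrow> q f \<in> Hom Q X Y"
  using roof_Hom[OF roof_Ide, of f] by (simp add: quotient_arr_cls Hom_iff)

lemma quotient_Dom_Cod:
  assumes "f \<in> Arr C"
  shows "q f \<in> Arr Q" "Dom Q (q f) = Dom C f" "Cod Q (q f) = Cod C f"
  using quotient_Hom[of f "Dom C f" "Cod C f"] assms unfolding Hom_iff by blast+

lemma cls_Zer: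
  assumes "s \<in> W" "Y \<in> Obj C"
  shows "cls s (Zer C (Dom C s) Y) = Zer Q (Cod C s) Y"
  using cls_refine[OF roof_Ide[of "Zer C (Cod C s) Y"], of s] assms by (simp add: quotient_arr_cls)

lemma common2:
  assumes "a \<in> Hom Q X Y" "b \<in> Hom Q X Y'"
  obtains s f g where "roof X Y s f" "roof X Y' s g" "a = cls s f" "b = cls s g"
proof -
  obtain s f where 1: "roof X Y s f" "a = cls s f" using assms(1) by (rule Hom_roof)
  obtain t g where 2: "roof X Y' t g" "b = cls t g" using assms(2) by (rule Hom_roof)
  obtain u v where uv: "u \<in> W" "v \<in> W" "Cod C u = Dom C s" "Cod C v = Dom C t" "Dom C v = Dom C u"
    "s \<cdot> u = t \<cdot> v" "s \<cdot> u \<in> W"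
    using W_common[of s t] 1 2 by (auto simp: roof_def)
  show ?thesis
    using that[of "s \<cdot> u" "f \<cdot> u" "g \<cdot> v"] cls_refine_W[OF 1(1) uv(1,3)] cls_refine_W[OF 2(1)
        uv(2,4)] 1 2 uv
    by metis
qed

lemma common3:
  assumes "a \<in> Hom Q X Y" "b \<in> Hom Q X Y'" "c \<in> Hom Q X Y''"
  obtains s f g h where "roof X Y s f" "roof X Y' s g" "roof X Y'' s h" "a = cls s f" "b = cls s g"
      "c = cls s h"
proof -
  obtain s f g where 1: "roof X Y s f" "roof X Y' s g" "a = cls s f" "b = cls s g"
    using common2[OF assms(1,2)] .
  obtain t h where 2: "roof X Y'' t h" "c = cls t h" using assms(3) by (rule Hom_roof)
  obtain u v where uv: "u \<in> W" "v \<in> W" "Cod C u = Dom C s" "Cod C v = Dom C t" "Dom C v = Dom C u"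
    "s \<cdot> u = t \<cdot> v" "s \<cdot> u \<in> W"
    using W_common[of s t] 1 2 by (auto simp: roof_def)
  show ?thesis
    using that[of "s \<cdot> u" "f \<cdot> u" "g \<cdot> u" "h \<cdot> v"] cls_refine_W[OF 1(1) uv(1,3)]
      cls_refine_W[OF 1(2) uv(1,3)] cls_refine_W[OF 2(1) uv(2,4)] 1 2 uv
    by metis
qed

text \<open>Both composites are refined to one roof: first the left legs are matched, then the
  arrows into the middle object. Finally the arrows \<open>?m\<close> and \<open>?m'\<close> into
  the sources of \<open>t\<close> and \<open>t'\<close> are matched with the witnesses
  \<open>c\<close> and \<open>d\<close> for the second pair of roofs, which is what makes the right
  legs agree.\<close>

lemma Cmp_well_defined:
  assumes r: "roof X Y s f" "roof Y Z t g" "roof X Y s' f'" "roof Y Z t' g'"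
    and eq: "cls s f = cls s' f'" "cls t g = cls t' g'"
    and u: "u \<in> W" "v \<in> Arr C" "Cod C u = Dom C f" "Cod C v = Dom C t" "Dom C v = Dom C u"
        "f \<cdot> u = t \<cdot> v"
    and u': "u' \<in> W" "v' \<in> Arr C" "Cod C u' = Dom C f'" "Cod C v' = Dom C t'" "Dom C v' = Dom C u'"
        "f' \<cdot> u' = t' \<cdot> v'"
  shows "cls (s \<cdot> u) (g \<cdot> v) = cls (s' \<cdot> u') (g' \<cdot> v')"
proof -
  note R = r[unfolded roof_def]
  have su: "s \<cdot> u \<in> W" "s' \<cdot> u' \<in> W" using W_Cmp R u u' by auto
  obtain a b where ab: "a \<in> W" "b \<in> W" "Cod C a = Dom C u" "Cod C b = Dom C u'" "Dom C b = Dom C a"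
    "(s \<cdot> u) \<cdot> a = (s' \<cdot> u') \<cdot> b" "(s \<cdot> u) \<cdot> a \<in> W"
    using W_common[OF su] R u u' by auto
  have ab6: "s \<cdot> (u \<cdot> a) = s' \<cdot> (u' \<cdot> b)" using ab R u u' by simp
  have ua: "u \<cdot> a \<in> W" "u' \<cdot> b \<in> W" using W_Cmp u u' ab by auto
  have 1: "roof X Y (s \<cdot> (u \<cdot> a)) (f \<cdot> (u \<cdot> a))" "cls (s \<cdot> (u \<cdot> a)) (f \<cdot> (u \<cdot> a)) = cls s f"
    using cls_refine_W[OF r(1) ua(1)] ab u R by auto
  have 2: "roof X Y (s \<cdot> (u \<cdot> a)) (f' \<cdot> (u' \<cdot> b))" "cls (s \<cdot> (u \<cdot> a)) (f' \<cdot> (u' \<cdot> b)) = cls s' f'"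
    unfolding ab6 using cls_refine_W[OF r(3) ua(2)] ab u' R by auto
  obtain w where w: "w \<in> W" "Cod C w = Dom C a" "(f \<cdot> (u \<cdot> a)) \<cdot> w = (f' \<cdot> (u' \<cdot> b)) \<cdot> w"
    using cls_eqD[OF 1(1) 2(1)] 1 2 eq R u ab by auto
  have tv: "f \<cdot> (u \<cdot> (a \<cdot> w)) = t \<cdot> (v \<cdot> (a \<cdot> w))"
    by (rule Cmp_eq_extend[OF u(6)]) (use R u(1-5) ab(1-5) w(1,2) in auto)
  have tv': "f' \<cdot> (u' \<cdot> (b \<cdot> w)) = t' \<cdot> (v' \<cdot> (b \<cdot> w))"
    by (rule Cmp_eq_extend[OF u'(6)]) (use R u'(1-5) ab(1-5) w(1,2) in auto)
  have ff: "f \<cdot> (u \<cdot> (a \<cdot> w)) = f' \<cdot> (u' \<cdot> (b \<cdot> w))" using w R u u' ab by simp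
  obtain c d where cd: "roof Y Z t g" "c \<in> Arr C" "d \<in> Arr C" "Cod C c = Dom C t"
      "Cod C d = Dom C t'"
    "Dom C d = Dom C c" "t \<cdot> c = t' \<cdot> d" "t \<cdot> c \<in> W" "g \<cdot> c = g' \<cdot> d"
    using relE[of t g t' g'] cls_eq_iff[OF r(2,4)] eq r(2) by metis
  let ?m = "v \<cdot> (a \<cdot> w)" and ?m' = "v' \<cdot> (b \<cdot> w)"
  have m: "?m \<in> Hom C (Dom C w) (Dom C t)" "?m' \<in> Hom C (Dom C w) (Dom C t')"
    using u u' ab w by (auto simp: Hom_iff)
  have tm: "t \<cdot> ?m = t' \<cdot> ?m'" using tv tv' ff by metis
  \<comment> \<open>An Ore square joins what was built from the first pair of roofs to the witness
    \<open>t \<cdot> c\<close> for the second pair.\<close>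
  obtain x y where xy: "x \<in> W" "y \<in> Arr C" "Cod C x = Dom C w" "Cod C y = Dom C c"
      "Dom C y = Dom C x"
    "(t \<cdot> ?m) \<cdot> x = (t \<cdot> c) \<cdot> y"
    using Ore[of "t \<cdot> ?m" "t \<cdot> c"] m R cd by (auto simp: Hom_iff)
  have mx: "?m \<cdot> x \<in> Hom C (Dom C x) (Dom C t)" "?m' \<cdot> x \<in> Hom C (Dom C x) (Dom C t')"
    and cy: "c \<cdot> y \<in> Hom C (Dom C x) (Dom C t)" "d \<cdot> y \<in> Hom C (Dom C x) (Dom C t')"
    using m xy cd by (auto simp: Hom_iff)
  have tmx: "t \<cdot> (?m \<cdot> x) = t \<cdot> (c \<cdot> y)"
    using xy m R cd Cmp_assoc_Arr[of x ?m t] Cmp_assoc_Arr[of y c t] by (simp only: Hom_iff W_Arr)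
  \<comment> \<open>\<open>t\<close> and \<open>t'\<close> are cancelled separately, at the price of
    one refinement each; \<open>p\<close> and \<open>p'\<close> merge the two.\<close>
  obtain x1 where x1: "x1 \<in> W" "Cod C x1 = Dom C x" "(?m \<cdot> x) \<cdot> x1 = (c \<cdot> y) \<cdot> x1"
    using W_cancel[OF _ mx(1) cy(1) tmx] R by blast
  have "t' \<cdot> (?m' \<cdot> x) = t \<cdot> (?m \<cdot> x)"
    using Cmp_eq_extend[OF tm, of x] m R xy by (simp add: Hom_iff)
  also have "\<dots> = t' \<cdot> (d \<cdot> y)"
    unfolding tmx by (rule Cmp_eq_extend[OF cd(7)]) (use cd(2-6) R xy(1-5) in auto)
  finally have tmx': "t' \<cdot> (?m' \<cdot> x) = t' \<cdot> (d \<cdot> y)" .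
  obtain x2 where x2: "x2 \<in> W" "Cod C x2 = Dom C x" "(?m' \<cdot> x) \<cdot> x2 = (d \<cdot> y) \<cdot> x2"
    using W_cancel[OF _ mx(2) cy(2) tmx'] R by blast
  obtain p p' where p: "p \<in> W" "p' \<in> W" "Cod C p = Dom C x1" "Cod C p' = Dom C x2"
      "Dom C p' = Dom C p"
    "x1 \<cdot> p = x2 \<cdot> p'" "x1 \<cdot> p \<in> W"
    using W_common[OF x1(1) x2(1)] x1 x2 by auto
  let ?z = "x \<cdot> (x1 \<cdot> p)"
  have z: "?z \<in> W" "Cod C ?z = Dom C w" using W_Cmp p(1-5,7) x1(1,2) xy(1-5) by auto
  have e1: "?m \<cdot> ?z = c \<cdot> (y \<cdot> (x1 \<cdot> p))"
  proof -
    have "((?m \<cdot> x) \<cdot> x1) \<cdot> p = ((c \<cdot> y) \<cdot> x1) \<cdot> p" using x1 by simp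
    then show ?thesis using u(1-5) ab(1-5) w(1,2) xy(1-5) x1(1,2) p(1-5) cd(2-6) by simp
  qed
  have e2: "?m' \<cdot> ?z = d \<cdot> (y \<cdot> (x1 \<cdot> p))"
  proof -
    have "((?m' \<cdot> x) \<cdot> x2) \<cdot> p' = ((d \<cdot> y) \<cdot> x2) \<cdot> p'" using x2 by simp
    then show ?thesis using u'(1-5) ab(1-5) w(1,2) xy(1-5) x2(1,2) p(1-6) cd(2-6) by simp
  qed
  have gg: "g \<cdot> (?m \<cdot> ?z) = g' \<cdot> (?m' \<cdot> ?z)"
    unfolding e1 e2 by (rule Cmp_eq_extend[OF cd(9)]) (use cd(2-6) R xy(1-5) x1(1,2) p(1-5) in auto)
  have aw: "a \<cdot> (w \<cdot> ?z) \<in> W" "b \<cdot> (w \<cdot> ?z) \<in> W" using W_Cmp ab w z by auto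
  have r1: "roof X Z (s \<cdot> u) (g \<cdot> v)" "roof X Z (s' \<cdot> u') (g' \<cdot> v')"
    using R u u' su by (auto simp: roof_def)
  have "cls (s \<cdot> u) (g \<cdot> v) = cls ((s \<cdot> u) \<cdot> (a \<cdot> (w \<cdot> ?z))) ((g \<cdot> v) \<cdot> (a \<cdot> (w \<cdot> ?z)))"
    using cls_refine_W(2)[OF r1(1) aw(1)] ab w z R u by simp
  also have "(s \<cdot> u) \<cdot> (a \<cdot> (w \<cdot> ?z)) = (s' \<cdot> u') \<cdot> (b \<cdot> (w \<cdot> ?z))"
    using ab(6) ab w z R u su u' by (intro Cmp_eq_extend) auto
  also have "(g \<cdot> v) \<cdot> (a \<cdot> (w \<cdot> ?z)) = (g' \<cdot> v') \<cdot> (b \<cdot> (w \<cdot> ?z))"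
    using gg ab w z R u u' by simp
  also have "cls ((s' \<cdot> u') \<cdot> (b \<cdot> (w \<cdot> ?z))) ((g' \<cdot> v') \<cdot> (b \<cdot> (w \<cdot> ?z)))
      = cls (s' \<cdot> u') (g' \<cdot> v')"
    using cls_refine_W(2)[OF r1(2) aw(2)] ab w z R u' by simp
  finally show ?thesis .
qed

text \<open>The composite is defined as a union over all representatives and all squares. By
  \<open>Cmp_well_defined\<close> they give a single class, so any one square computes it.\<close>

lemma Cmp_cls:
  assumes r: "roof X Y s f" "roof Y Z t g"
    and u: "u \<in> W" "v \<in> Arr C" "Cod C u = Dom C f" "Cod C v = Dom C t" "Dom C v = Dom C u"
        "f \<cdot> u = t \<cdot> v"
  shows "cls t g \<cdot>\<^bsub>Q\<^esub> cls s f = cls (s \<cdot> u) (g \<cdot> v)"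
proof -
  let ?M = "{cls (s' \<cdot> u') (g' \<cdot> v') | s' f' t' g' u' v'.
     (s', f') \<in> cls s f \<and> (t', g') \<in> cls t g \<and> Cod C f' = Cod C t' \<and>
     u' \<in> weak_eq C S \<and> u' \<in> Hom C (Dom C v') (Dom C f') \<and> v' \<in> Hom C (Dom C u') (Dom C t') \<and>
     f' \<cdot> u' = t' \<cdot> v'}"
  have "?M = {cls (s \<cdot> u) (g \<cdot> v)}"
  proof (rule equalityI)
    show "?M \<subseteq> {cls (s \<cdot> u) (g \<cdot> v)}"
    proof
      fix x assume "x \<in> ?M"
      then obtain s' f' t' g' u' v' where x: "x = cls (s' \<cdot> u') (g' \<cdot> v')" "(s', f') \<in> cls s f"
          "(t', g') \<in> cls t g"
        "u' \<in> W" "u' \<in> Hom C (Dom C v') (Dom C f')" "v' \<in> Hom C (Dom C u') (Dom C t')"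
            "f' \<cdot> u' = t' \<cdot> v'"
        by blast
      note 1 = mem_cls_roof[OF r(1) x(2)] mem_cls_roof[OF r(2) x(3)]
      have "cls (s' \<cdot> u') (g' \<cdot> v') = cls (s \<cdot> u) (g \<cdot> v)"
        using x u by (intro Cmp_well_defined[OF 1(1,3) r 1(2,4)]) (auto simp: Hom_iff)
      then show "x \<in> {cls (s \<cdot> u) (g \<cdot> v)}" using x by simp
    qed
    have "cls (s \<cdot> u) (g \<cdot> v) \<in> ?M"
    proof -
      have "(s, f) \<in> cls s f" "(t, g) \<in> cls t g" by (rule cls_self, rule r)+
      moreover have "Cod C f = Cod C t" using r by (simp add: roof_def)
      moreover have "u \<in> Hom C (Dom C v) (Dom C f)" "v \<in> Hom C (Dom C u) (Dom C t)"
        using u(1-5) by (simp_all add: Hom_iff)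
      ultimately show ?thesis using u(1,6) by blast
    qed
    then show "{cls (s \<cdot> u) (g \<cdot> v)} \<subseteq> ?M" by blast
  qed
  then show ?thesis
    by (simp add: verdier_def verdier_pre_def Let_def)
qed

text \<open>As for composition, the union in the definition consists of one class. The two summands
  are compared over different refinements \<open>w\<close> and \<open>w'\<close>, which then have to
  be merged.\<close>

lemma Add_cls:
  assumes r: "roof X Y s f" "roof X Y s g"
  shows "Add Q (cls s f) (cls s g) = cls s (Add C f g)"
proof -
  note R = r[unfolded roof_def]
  let ?M = "{cls s' (Add C f' g') | s' f' g'.
     (s', f') \<in> cls s f \<and> (s', g') \<in> cls s g \<and> Cod C f' = Cod C g'}"
  have rA: "roof X Y s (Add C f g)" if "roof X Y s f" "roof X Y s g" for s f g
    using that by (simp add: roof_def)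
  have AddW: "Add C f g \<cdot> w = Add C (f \<cdot> w) (g \<cdot> w)"
    if "roof X Y s f" "roof X Y s g" "w \<in> Arr C" "Cod C w = Dom C s" for s f g w
    using that by (intro Cmp_Add_left[of w "Dom C w" "Dom C s" f Y g]) (auto simp: roof_def Hom_iff)
  have eq: "cls s' (Add C f' g') = cls s (Add C f g)" if "(s', f') \<in> cls s f" "(s', g') \<in> cls s g"
      for s' f' g'
  proof -
    note 1 = mem_cls_roof[OF r(1) that(1)] mem_cls_roof[OF r(2) that(2)]
    note R' = 1(1,3)[unfolded roof_def]
    obtain u v where uv: "u \<in> W" "v \<in> W" "Cod C u = Dom C s" "Cod C v = Dom C s'"
        "Dom C v = Dom C u"
      "s \<cdot> u = s' \<cdot> v" "s \<cdot> u \<in> W"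
      using W_common[of s s'] R R' by auto
    note f = cls_refine_W[OF r(1) uv(1,3)] cls_refine_W[OF 1(1) uv(2,4), folded uv(6)]
    note g = cls_refine_W[OF r(2) uv(1,3)] cls_refine_W[OF 1(3) uv(2,4), folded uv(6)]
    have su: "Dom C (s \<cdot> u) = Dom C u" using R uv(1,3) by simp
    have "cls (s \<cdot> u) (f \<cdot> u) = cls (s \<cdot> u) (f' \<cdot> v)" using f(2,4) 1(2) by metis
    then obtain w where w: "w \<in> W" "Cod C w = Dom C u" "(f \<cdot> u) \<cdot> w = (f' \<cdot> v) \<cdot> w"
      using cls_eqD[OF f(1,3)] su by metis
    have "cls (s \<cdot> u) (g \<cdot> u) = cls (s \<cdot> u) (g' \<cdot> v)" using g(2,4) 1(4) by metis
    then obtain w' where w': "w' \<in> W" "Cod C w' = Dom C u" "(g \<cdot> u) \<cdot> w' = (g' \<cdot> v) \<cdot> w'"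
      using cls_eqD[OF g(1,3)] su by metis
    obtain a b where ab: "a \<in> W" "b \<in> W" "Cod C a = Dom C w" "Cod C b = Dom C w'"
        "Dom C b = Dom C a"
      "w \<cdot> a = w' \<cdot> b" "w \<cdot> a \<in> W"
      using W_common[OF w(1) w'(1)] w(2) w'(2) by auto
    let ?z = "w \<cdot> a"
    have z: "?z \<in> W" "Cod C ?z = Dom C u" "Dom C ?z = Dom C a" using ab(1-5,7) w(1,2) by auto
    have fz: "f \<cdot> (u \<cdot> ?z) = f' \<cdot> (v \<cdot> ?z)"
    proof -
      have "((f \<cdot> u) \<cdot> w) \<cdot> a = ((f' \<cdot> v) \<cdot> w) \<cdot> a" using w by simp
      then show ?thesis using R R' uv(1-5) w(1,2) ab(1-5) by simp
    qed
    have gz: "g \<cdot> (u \<cdot> ?z) = g' \<cdot> (v \<cdot> ?z)"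
    proof -
      have "((g \<cdot> u) \<cdot> w') \<cdot> b = ((g' \<cdot> v) \<cdot> w') \<cdot> b" using w' by simp
      then show ?thesis using R R' uv(1-5) w'(1,2) ab(1-6) by simp
    qed
    have uz: "u \<cdot> ?z \<in> W" "v \<cdot> ?z \<in> W" using W_Cmp uv(1-5) z by auto
    have sz: "s \<cdot> (u \<cdot> ?z) = s' \<cdot> (v \<cdot> ?z)"
      by (rule Cmp_eq_extend[OF uv(6)]) (use uv(1-5) R R' z in auto)
    have "cls s (Add C f g) = cls (s \<cdot> (u \<cdot> ?z)) (Add C f g \<cdot> (u \<cdot> ?z))"
      using cls_refine_W(2)[OF rA[OF r] uz(1)] uv(1-5) z by simp
    also have "\<dots> = cls (s' \<cdot> (v \<cdot> ?z)) (Add C f' g' \<cdot> (v \<cdot> ?z))"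
    proof -
      have "Add C f g \<cdot> (u \<cdot> ?z) = Add C (f \<cdot> (u \<cdot> ?z)) (g \<cdot> (u \<cdot> ?z))"
        by (rule AddW[OF r]) (use uz uv(1-5) z in auto)
      moreover have "Add C f' g' \<cdot> (v \<cdot> ?z) = Add C (f' \<cdot> (v \<cdot> ?z)) (g' \<cdot> (v \<cdot> ?z))"
        by (rule AddW[OF 1(1,3)]) (use uz uv(1-5) z in auto)
      ultimately show ?thesis unfolding fz gz sz by metis
    qed
    also have "\<dots> = cls s' (Add C f' g')"
      using cls_refine_W(2)[OF rA[OF 1(1,3)] uz(2)] uv(1-5) z by simp
    finally show ?thesis by simp
  qed
  have "?M = {cls s (Add C f g)}"
  proof (rule equalityI)
    show "?M \<subseteq> {cls s (Add C f g)}" using eq by blast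
    show "{cls s (Add C f g)} \<subseteq> ?M" using cls_self[OF r(1)] cls_self[OF r(2)] R by blast
  qed
  then show ?thesis
    by (simp add: verdier_def verdier_pre_def Let_def)
qed

lemma quotient_Cmp:
  assumes "f \<in> Arr C" "g \<in> Arr C" "Cod C f = Dom C g"
  shows "q (g \<cdot> f) = q g \<cdot>\<^bsub>Q\<^esub> q f"
proof -
  have "cls (Ide C (Dom C g)) g \<cdot>\<^bsub>Q\<^esub> cls (Ide C (Dom C f)) f =
      cls (Ide C (Dom C f) \<cdot> Ide C (Dom C f)) (g \<cdot> f)"
    using assms weak_eq_Ide[of "Dom C f"] roof_Ide[of f]
    by (intro Cmp_cls[of "Dom C f" "Dom C g" _ _ "Cod C g", OF _ roof_Ide]) auto
  then show ?thesis using assms by (simp add: quotient_arr_cls)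
qed

lemma quotient_Add:
  assumes "f \<in> Hom C X Y" "g \<in> Hom C X Y"
  shows "q (Add C f g) = Add Q (q f) (q g)"
  using Add_cls[OF roof_Ide[of f], of g] roof_Ide[of g] assms
      by (simp add: quotient_arr_cls Hom_iff)

section \<open>Additive structure of the quotient\<close>

lemma hom_group_quotient:
  assumes "X \<in> Obj C" "Y \<in> Obj C"
  shows "abelian_group (hom_group Q X Y)"
proof -
  have car: "carrier (hom_group Q X Y) = Hom Q X Y" "add (hom_group Q X Y) = Add Q"
    "zero (hom_group Q X Y) = q (Zer C X Y)"
    by (simp_all add: hom_group_def)
  have z: "roof X Y s (Zer C (Dom C s) Y)" "q (Zer C X Y) = cls s (Zer C (Dom C s) Y)"
      if "roof X Y s f" for s f
    using that cls_Zer[of s Y] assms by (auto simp: roof_def)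
  have rA: "roof X Y s (Add C f g)" if "roof X Y s f" "roof X Y s g" for s f g
    using that by (simp add: roof_def)
  have rH: "f \<in> Hom C (Dom C s) Y" if "roof X Y s f" for s f
    using that by (simp add: roof_def Hom_iff)
  show ?thesis
  proof (rule abelian_groupI, unfold car)
    show "q (Zer C X Y) \<in> Hom Q X Y" using assms by (intro quotient_Hom Zer_Hom)
    fix a assume a: "a \<in> Hom Q X Y"
    then obtain s f where f: "roof X Y s f" "a = cls s f" by (rule Hom_roof)
    show "Add Q (q (Zer C X Y)) a = a"
      unfolding z(2)[OF f(1)] f(2) Add_cls[OF z(1)[OF f(1)] f(1)]
          by (simp add: Add_Zer[OF rH[OF f(1)]])
    have n: "roof X Y s (neg C f)" using f(1) by (simp add: roof_def)
    have "Add Q (cls s (neg C f)) a = q (Zer C X Y)"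
      unfolding f(2) Add_cls[OF n f(1)] z(2)[OF f(1)] by (simp add: Add_neg[OF rH[OF f(1)]])
    then show "\<exists>b\<in>Hom Q X Y. Add Q b a = q (Zer C X Y)" using roof_Hom[OF n] by blast
    fix b assume b: "b \<in> Hom Q X Y"
    obtain s f g where 1: "roof X Y s f" "roof X Y s g" "a = cls s f" "b = cls s g"
        using common2[OF a b] .
    show "Add Q a b \<in> Hom Q X Y" unfolding 1 Add_cls[OF 1(1,2)] by (rule roof_Hom[OF rA[OF 1(1,2)]])
    show "Add Q a b = Add Q b a"
      unfolding 1(3,4) Add_cls[OF 1(1,2)] Add_cls[OF 1(2,1)] using Add_commute[OF rH rH] 1 by metis
    fix c assume c: "c \<in> Hom Q X Y"
    obtain s f g h where 2: "roof X Y s f" "roof X Y s g" "roof X Y s h" "a = cls s f" "b = cls s g"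
        "c = cls s h"
      using common3[OF a b c] .
    show "Add Q (Add Q a b) c = Add Q a (Add Q b c)"
      unfolding 2(4-6) Add_cls[OF 2(1,2)] Add_cls[OF 2(2,3)] Add_cls[OF rA[OF 2(1,2)] 2(3)]
        Add_cls[OF 2(1) rA[OF 2(2,3)]] Add_assoc[OF rH[OF 2(1)] rH[OF 2(2)] rH[OF 2(3)]] ..
  qed
qed

lemma Cmp_quotient_Hom:
  assumes "a \<in> Hom Q X Y" "b \<in> Hom Q Y Z"
  shows "b \<cdot>\<^bsub>Q\<^esub> a \<in> Hom Q X Z"
proof -
  obtain s f where 1: "roof X Y s f" "a = cls s f" using assms(1) by (rule Hom_roof)
  obtain t g where 2: "roof Y Z t g" "b = cls t g" using assms(2) by (rule Hom_roof)
  note R = 1(1)[unfolded roof_def] 2(1)[unfolded roof_def]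
  obtain u v where uv: "u \<in> W" "v \<in> Arr C" "Cod C u = Dom C f" "Cod C v = Dom C t"
      "Dom C v = Dom C u"
    "f \<cdot> u = t \<cdot> v" using Ore[of f t] R by auto
  have "roof X Z (s \<cdot> u) (g \<cdot> v)" using R uv W_Cmp[of s u] by (simp add: roof_def)
  then show ?thesis unfolding 1 2 Cmp_cls[OF 1(1) 2(1) uv] by (rule roof_Hom)
qed

lemma Cmp_quotient_Ide:
  assumes "a \<in> Hom Q X Y"
  shows "q (Ide C Y) \<cdot>\<^bsub>Q\<^esub> a = a" "a \<cdot>\<^bsub>Q\<^esub> q (Ide C X) = a"
proof -
  obtain s f where 1: "roof X Y s f" "a = cls s f" using assms(1) by (rule Hom_roof)
  note R = 1(1)[unfolded roof_def]
  have XY: "X \<in> Obj C" "Y \<in> Obj C" using R by auto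
  have id: "roof X X (Ide C X) (Ide C X)" "roof Y Y (Ide C Y) (Ide C Y)"
    using XY roof_Ide[of "Ide C X"] roof_Ide[of "Ide C Y"] by auto
  have sD: "Dom C s \<in> Obj C" using R by auto
  have "cls (Ide C Y) (Ide C Y) \<cdot>\<^bsub>Q\<^esub> cls s f = cls (s \<cdot> Ide C (Dom C s)) (Ide C Y \<cdot> f)"
    using R XY sD by (intro Cmp_cls[OF 1(1) id(2)] weak_eq_Ide) auto
  then show "q (Ide C Y) \<cdot>\<^bsub>Q\<^esub> a = a" using R XY 1 by (simp add: quotient_arr_cls)
  have "cls s f \<cdot>\<^bsub>Q\<^esub> cls (Ide C X) (Ide C X) = cls (Ide C X \<cdot> s) (f \<cdot> Ide C (Dom C s))"
    using R XY sD by (intro Cmp_cls[OF id(1) 1(1)]) auto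
  then show "a \<cdot>\<^bsub>Q\<^esub> q (Ide C X) = a" using R XY 1 by (simp add: quotient_arr_cls)
qed

text \<open>The square for \<open>c\<close> after \<open>b\<close> is chosen first and the square
  for \<open>a\<close> is built over its apex; the same two squares then also compute the other
  bracketing.\<close>

lemma Cmp_quotient_assoc:
  assumes "a \<in> Hom Q X Y" "b \<in> Hom Q Y Z" "c \<in> Hom Q Z V"
  shows "(c \<cdot>\<^bsub>Q\<^esub> b) \<cdot>\<^bsub>Q\<^esub> a = c \<cdot>\<^bsub>Q\<^esub> (b \<cdot>\<^bsub>Q\<^esub> a)"
proof -
  obtain s f where 1: "roof X Y s f" "a = cls s f" using assms(1) by (rule Hom_roof)
  obtain t g where 2: "roof Y Z t g" "b = cls t g" using assms(2) by (rule Hom_roof)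
  obtain r h where 3: "roof Z V r h" "c = cls r h" using assms(3) by (rule Hom_roof)
  note R = 1(1)[unfolded roof_def] 2(1)[unfolded roof_def] 3(1)[unfolded roof_def]
  obtain w x where wx: "w \<in> W" "x \<in> Arr C" "Cod C w = Dom C g" "Cod C x = Dom C r"
      "Dom C x = Dom C w"
    "g \<cdot> w = r \<cdot> x" using Ore[of g r] R by auto
  have tw: "t \<cdot> w \<in> W" using W_Cmp R wx by auto
  obtain u v where uv: "u \<in> W" "v \<in> Arr C" "Cod C u = Dom C f" "Cod C v = Dom C (t \<cdot> w)"
      "Dom C v = Dom C u"
    "f \<cdot> u = (t \<cdot> w) \<cdot> v" using Ore[OF _ tw, of f] R wx by auto
  have r1: "roof Y V (t \<cdot> w) (h \<cdot> x)" using R wx tw by (simp add: roof_def)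
  have su: "s \<cdot> u \<in> W" using W_Cmp R uv by auto
  have r2: "roof X Z (s \<cdot> u) (g \<cdot> (w \<cdot> v))" using R wx uv su by (simp add: roof_def)
  have "(c \<cdot>\<^bsub>Q\<^esub> b) \<cdot>\<^bsub>Q\<^esub> a = cls (s \<cdot> u) ((h \<cdot> x) \<cdot> v)"
    unfolding 1(2) 2(2) 3(2) Cmp_cls[OF 2(1) 3(1) wx] by (rule Cmp_cls[OF 1(1) r1 uv])
  moreover have "b \<cdot>\<^bsub>Q\<^esub> a = cls (s \<cdot> u) (g \<cdot> (w \<cdot> v))"
    unfolding 1(2) 2(2) using R wx uv by (intro Cmp_cls[OF 1(1) 2(1) uv(1)]) auto
  moreover have e: "g \<cdot> (w \<cdot> v) = r \<cdot> (x \<cdot> v)"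
    by (rule Cmp_eq_extend[OF wx(6)]) (use R wx(1-5) uv(1-5) in auto)
  have "cls r h \<cdot>\<^bsub>Q\<^esub> cls (s \<cdot> u) (g \<cdot> (w \<cdot> v)) = cls ((s \<cdot> u) \<cdot> Ide C (Dom C u)) (h \<cdot> (x \<cdot> v))"
    by (rule Cmp_cls[OF r2 3(1)]) (use R wx(1-5) uv(1-5) e weak_eq_Ide in auto)
  ultimately show ?thesis unfolding 3(2) using R wx(1-5) uv(1-5) by simp
qed

lemma Cmp_quotient_Add_left:
  assumes "a \<in> Hom Q X Y" "b \<in> Hom Q Y Z" "b' \<in> Hom Q Y Z"
  shows "Add Q b b' \<cdot>\<^bsub>Q\<^esub> a = Add Q (b \<cdot>\<^bsub>Q\<^esub> a) (b' \<cdot>\<^bsub>Q\<^esub> a)"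
proof -
  obtain s f where 1: "roof X Y s f" "a = cls s f" using assms(1) by (rule Hom_roof)
  obtain t g g' where 2: "roof Y Z t g" "roof Y Z t g'" "b = cls t g" "b' = cls t g'"
      using common2[OF assms(2,3)] .
  note R = 1(1)[unfolded roof_def] 2(1,2)[unfolded roof_def]
  obtain u v where uv: "u \<in> W" "v \<in> Arr C" "Cod C u = Dom C f" "Cod C v = Dom C t"
      "Dom C v = Dom C u"
    "f \<cdot> u = t \<cdot> v" using Ore[of f t] R by auto
  have su: "s \<cdot> u \<in> W" using W_Cmp R uv by auto
  have r: "roof X Z (s \<cdot> u) (g \<cdot> v)" "roof X Z (s \<cdot> u) (g' \<cdot> v)" "roof Y Z t (Add C g g')"
    using R uv su by (auto simp: roof_def)
  have "Add C g g' \<cdot> v = Add C (g \<cdot> v) (g' \<cdot> v)"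
    by (rule Cmp_Add_left[of v "Dom C v" "Dom C t" g Z g']) (use R uv in \<open>auto simp: Hom_iff\<close>)
  then show ?thesis
    unfolding 1(2) 2(3,4) Add_cls[OF 2(1,2)] Cmp_cls[OF 1(1) 2(1) uv] Cmp_cls[OF 1(1) 2(2) uv]
      Cmp_cls[OF 1(1) r(3) uv] Add_cls[OF r(1,2)] by simp
qed

text \<open>Each composite comes with its own Ore square; both are refined until they share the
  arrow \<open>?w\<close> into the common source of the roofs.\<close>

lemma Cmp_quotient_Add_right:
  assumes "a \<in> Hom Q X Y" "a' \<in> Hom Q X Y" "b \<in> Hom Q Y Z"
  shows "b \<cdot>\<^bsub>Q\<^esub> Add Q a a' = Add Q (b \<cdot>\<^bsub>Q\<^esub> a) (b \<cdot>\<^bsub>Q\<^esub> a')"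
proof -
  obtain s f f' where 1: "roof X Y s f" "roof X Y s f'" "a = cls s f" "a' = cls s f'"
      using common2[OF assms(1,2)] .
  obtain t g where 2: "roof Y Z t g" "b = cls t g" using assms(3) by (rule Hom_roof)
  note R = 1(1,2)[unfolded roof_def] 2(1)[unfolded roof_def]
  obtain u v where uv: "u \<in> W" "v \<in> Arr C" "Cod C u = Dom C f" "Cod C v = Dom C t"
      "Dom C v = Dom C u"
    "f \<cdot> u = t \<cdot> v" using Ore[of f t] R by auto
  obtain u' v' where uv': "u' \<in> W" "v' \<in> Arr C" "Cod C u' = Dom C f'" "Cod C v' = Dom C t"
      "Dom C v' = Dom C u'"
    "f' \<cdot> u' = t \<cdot> v'" using Ore[of f' t] R by auto
  obtain c d where cd: "c \<in> W" "d \<in> W" "Cod C c = Dom C u" "Cod C d = Dom C u'" "Dom C d = Dom C c"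
    "u \<cdot> c = u' \<cdot> d" "u \<cdot> c \<in> W"
    using W_common[OF uv(1) uv'(1)] uv uv' R by auto
  let ?w = "u \<cdot> c"
  have w: "?w \<in> W" "Cod C ?w = Dom C f" "Cod C ?w = Dom C f'" "Dom C ?w = Dom C c"
      using cd(1-5,7) uv(1-5) R by auto
  have e: "f \<cdot> ?w = t \<cdot> (v \<cdot> c)"
    by (rule Cmp_eq_extend[OF uv(6)]) (use uv(1-5) cd(1-5) R in auto)
  have e': "f' \<cdot> ?w = t \<cdot> (v' \<cdot> d)" unfolding cd(6)
      by (rule Cmp_eq_extend[OF uv'(6)]) (use uv'(1-5) cd(1-5) R in auto)
  have vH: "v \<cdot> c \<in> Hom C (Dom C c) (Dom C t)" "v' \<cdot> d \<in> Hom C (Dom C c) (Dom C t)"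
    using uv(1-5) uv'(1-5) cd(1-5) by (auto simp: Hom_iff)
  have fH: "f \<in> Hom C (Dom C s) Y" "f' \<in> Hom C (Dom C s) Y" "t \<in> Hom C (Dom C t) Y"
      "g \<in> Hom C (Dom C t) Z"
    "?w \<in> Hom C (Dom C c) (Dom C s)"
    using R w by (auto simp: Hom_iff)
  have eA: "Add C f f' \<cdot> ?w = t \<cdot> Add C (v \<cdot> c) (v' \<cdot> d)"
    using Cmp_Add_left[OF fH(5) fH(1,2)] Cmp_Add_right[OF vH fH(3)] e e' by simp
  have sw: "s \<cdot> ?w \<in> W" using W_Cmp R w by auto
  have r: "roof X Y s (Add C f f')" using R by (simp add: roof_def)
  have r': "roof X Z (s \<cdot> ?w) (g \<cdot> (v \<cdot> c))" "roof X Z (s \<cdot> ?w) (g \<cdot> (v' \<cdot> d))"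
    using R sw vH w by (auto simp: roof_def Hom_iff)
  have A: "Add C (v \<cdot> c) (v' \<cdot> d) \<in> Hom C (Dom C c) (Dom C t)" using Add_Hom[OF vH] .
  have "b \<cdot>\<^bsub>Q\<^esub> Add Q a a' = cls (s \<cdot> ?w) (g \<cdot> Add C (v \<cdot> c) (v' \<cdot> d))"
    unfolding 1(3,4) 2(2) Add_cls[OF 1(1,2)]
    using w A R eA by (intro Cmp_cls[OF r 2(1) w(1)]) (auto simp: Hom_iff)
  also have "\<dots> = Add Q (cls (s \<cdot> ?w) (g \<cdot> (v \<cdot> c))) (cls (s \<cdot> ?w) (g \<cdot> (v' \<cdot> d)))"
    unfolding Add_cls[OF r'] Cmp_Add_right[OF vH fH(4)] ..
  also have "cls (s \<cdot> ?w) (g \<cdot> (v \<cdot> c)) = b \<cdot>\<^bsub>Q\<^esub> a"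
    unfolding 1(3) 2(2) using w vH R e by (intro Cmp_cls[OF 1(1) 2(1) w(1), symmetric]) (auto simp:
        Hom_iff)
  also have "cls (s \<cdot> ?w) (g \<cdot> (v' \<cdot> d)) = b \<cdot>\<^bsub>Q\<^esub> a'"
    unfolding 1(4) 2(2) using w vH R e' by (intro Cmp_cls[OF 1(2) 2(1) w(1), symmetric]) (auto simp:
        Hom_iff)
  finally show ?thesis .
qed

lemma quotient_biproduct:
  assumes "is_biproduct C X Y B"
  shows "is_biproduct Q X Y B"
proof -
  obtain i j p r where O: "X \<in> Obj C" "Y \<in> Obj C" "B \<in> Obj C" and H: "i \<in> Hom C X B" "j \<in> Hom C Y B"
    "p \<in> Hom C B X" "r \<in> Hom C B Y"
    and E: "p \<cdot> i = Ide C X" "r \<cdot> j = Ide C Y" "r \<cdot> i = Zer C X Y" "p \<cdot> j = Zer C Y X"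
    "Add C (i \<cdot> p) (j \<cdot> r) = Ide C B"
    using assms unfolding is_biproduct_def by blast
  note H' = H[unfolded Hom_iff]
  have "q p \<cdot>\<^bsub>Q\<^esub> q i = q (Ide C X)" "q r \<cdot>\<^bsub>Q\<^esub> q j = q (Ide C Y)"
    "q r \<cdot>\<^bsub>Q\<^esub> q i = q (Zer C X Y)" "q p \<cdot>\<^bsub>Q\<^esub> q j = q (Zer C Y X)"
    "Add Q (q i \<cdot>\<^bsub>Q\<^esub> q p) (q j \<cdot>\<^bsub>Q\<^esub> q r) = q (Ide C B)"
    using H' E quotient_Add[OF Cmp_Hom[OF H(3,1)] Cmp_Hom[OF H(4,2)]]
        by (simp_all flip: quotient_Cmp)
  then show ?thesis
    unfolding is_biproduct_def verdier_simps using O quotient_Hom H by blast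
qed

lemma additive_category_quotient: "additive_category Q"
proof (rule additive_category.intro)
  show "Dom Q f \<in> Obj Q" "Cod Q f \<in> Obj Q" if "f \<in> Arr Q" for f
  proof -
    from that have "f \<in> Hom Q (Dom Q f) (Cod Q f)" by (simp only: Hom_iff)
    then obtain s g where "roof (Dom Q f) (Cod Q f) s g" by (rule Hom_roof)
    then show "Dom Q f \<in> Obj Q" "Cod Q f \<in> Obj Q"
      unfolding roof_def verdier_simps using Cod_Obj W_Arr by metis+
  qed
  obtain Z where Z: "zero_obj C Z" using zero_obj_exists by blast
  \<comment> \<open>The identity of \<open>Z\<close> equals a zero arrow, so \<open>f\<close> is a
    composite with an arrow that doubles to itself. Hence \<open>f\<close> doubles to itself too and
    is the neutral element of its group.\<close>
  have "f = q (Zer C X Y)" if f: "f \<in> Hom Q X Y" and z: "X = Z \<or> Y = Z" for f X Y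
  proof -
    obtain s g where sg: "roof X Y s g" "f = cls s g" using f by (rule Hom_roof)
    have eq: "q (Ide C Z) = q (Zer C Z Z)" using Z by (simp add: zero_obj_iff)
    have XY: "X \<in> Obj C" "Y \<in> Obj C" using sg by (auto simp: roof_def)
    have z1: "q (Zer C X Y) = a" if "a \<in> Hom Q X Y" "Add Q a a = a" for a
    proof -
      interpret A: abelian_group "hom_group Q X Y" by (rule hom_group_quotient[OF XY])
      have "a \<in> carrier (hom_group Q X Y)" "a \<oplus>\<^bsub>hom_group Q X Y\<^esub> a = a" using that
          by (auto simp: hom_group_def)
      then have "a = \<zero>\<^bsub>hom_group Q X Y\<^esub>" using A.add.l_cancel_one by simp
      then show ?thesis by (simp add: hom_group_def)
    qed
    have ZO: "Z \<in> Obj C" using Z by (simp add: zero_obj_iff)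
    have ZH: "q (Zer C Z Z) \<in> Hom Q Z Z" using ZO quotient_Hom Zer_Hom by blast
    have zz: "Add Q (q (Zer C Z Z)) (q (Zer C Z Z)) = q (Zer C Z Z)"
      using quotient_Add[OF Zer_Hom[OF ZO ZO] Zer_Hom[OF ZO ZO]] Add_Zer[OF Zer_Hom[OF ZO ZO]]
          by simp
    show ?thesis
    proof (cases "X = Z")
      case True
      have "Add Q f f = Add Q (f \<cdot>\<^bsub>Q\<^esub> q (Zer C Z Z)) (f \<cdot>\<^bsub>Q\<^esub> q (Zer C Z Z))"
        using Cmp_quotient_Ide(2)[OF f] eq True by simp
      also have "\<dots> = f"
        using Cmp_quotient_Add_right[OF ZH ZH, of f Y] f zz Cmp_quotient_Ide(2)[OF f] eq True
            by simp
      finally show ?thesis using z1[OF f] by simp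
    next
      case False
      then have Y: "Y = Z" using z by blast
      have "Add Q f f = Add Q (q (Zer C Z Z) \<cdot>\<^bsub>Q\<^esub> f) (q (Zer C Z Z) \<cdot>\<^bsub>Q\<^esub> f)"
        using Cmp_quotient_Ide(1)[OF f] eq Y by simp
      also have "\<dots> = f"
        using Cmp_quotient_Add_left[of f X Z, OF _ ZH ZH] f zz Cmp_quotient_Ide(1)[OF f] eq Y
            by simp
      finally show ?thesis using z1[OF f] by simp
    qed
  qed
  moreover have "q (Zer C X Y) \<in> Hom Q X Y" if "X \<in> Obj C" "Y \<in> Obj C" for X Y
    using that quotient_Hom Zer_Hom by blast
  ultimately have "zero_obj Q Z"
    using Z unfolding zero_obj_def verdier_simps by metis
  then show "\<exists>Z. zero_obj Q Z" ..
  show "\<exists>B. is_biproduct Q X Y B" if "X \<in> Obj Q" "Y \<in> Obj Q" for X Y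
    using that biproduct_exists quotient_biproduct by fastforce
  show "Ide Q X \<in> Hom Q X X" if "X \<in> Obj Q" for X
    using that quotient_Hom[OF Ide_Hom] by simp
  show "g \<cdot>\<^bsub>Q\<^esub> f \<in> Hom Q X Z" if "f \<in> Hom Q X Y" "g \<in> Hom Q Y Z" for f g X Y Z
    using Cmp_quotient_Hom that by blast
  show "Ide Q Y \<cdot>\<^bsub>Q\<^esub> f = f" "f \<cdot>\<^bsub>Q\<^esub> Ide Q X = f" if "f \<in> Hom Q X Y" for f X Y
    using Cmp_quotient_Ide[OF that] by simp_all
  show "(h \<cdot>\<^bsub>Q\<^esub> g) \<cdot>\<^bsub>Q\<^esub> f = h \<cdot>\<^bsub>Q\<^esub> (g \<cdot>\<^bsub>Q\<^esub> f)"
    if "f \<in> Hom Q W X" "g \<in> Hom Q X Y" "h \<in> Hom Q Y Z" for f g h W X Y Z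
    using Cmp_quotient_assoc[OF that] .
  show "abelian_group (hom_group Q X Y)" if "X \<in> Obj Q" "Y \<in> Obj Q" for X Y
    using hom_group_quotient that by simp
  show "Add Q g g' \<cdot>\<^bsub>Q\<^esub> f = Add Q (g \<cdot>\<^bsub>Q\<^esub> f) (g' \<cdot>\<^bsub>Q\<^esub> f)"
    if "f \<in> Hom Q X Y" "g \<in> Hom Q Y Z" "g' \<in> Hom Q Y Z" for f g g' X Y Z
    by (rule Cmp_quotient_Add_left[OF that])
  show "g \<cdot>\<^bsub>Q\<^esub> Add Q f f' = Add Q (g \<cdot>\<^bsub>Q\<^esub> f) (g \<cdot>\<^bsub>Q\<^esub> f')"
    if "f \<in> Hom Q X Y" "f' \<in> Hom Q X Y" "g \<in> Hom Q Y Z" for f f' g X Y Z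
    by (rule Cmp_quotient_Add_right[OF that])
qed

section \<open>Suspension on the quotient\<close>

lemma W_neg:
  assumes "s \<in> W"
  shows "neg C s \<in> W"
proof -
  let ?Y = "Cod C s"
  have Y: "?Y \<in> Obj C" using assms by simp
  then have n: "neg C (Ide C ?Y) \<in> Hom C ?Y ?Y" by (intro neg_Hom Ide_Hom)
  have "is_iso C (neg C (Ide C ?Y))" by (rule is_isoI[OF n n]) (use Y in auto)
  then show ?thesis using W_Cmp[OF weak_eq_iso, of "neg C (Ide C ?Y)" s] assms Y by simp
qed

text \<open>Rotating three times turns the triangle on \<open>s\<close> into one on minus the
  suspension of \<open>s\<close>, whose cone is the suspended cone.\<close>

lemma W_ShA:
  assumes "s \<in> Arr C"
  shows "ShA C s \<in> W \<longleftrightarrow> s \<in> W"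
proof -
  obtain g h where T: "(s, g, h) \<in> Tri C" using Tri_exists assms by blast
  note T3 = Tri_rot[OF Tri_rot[OF Tri_rot[OF T]]]
  have "neg C (ShA C s) \<in> W \<longleftrightarrow> s \<in> W"
    using weak_eq_iff[OF T3] weak_eq_iff[OF T] TriD[OF T] thick_ShO[of "Cod C g"] by simp
  moreover have "neg C (ShA C s) \<in> W \<longleftrightarrow> ShA C s \<in> W"
    using W_neg[of "neg C (ShA C s)"] W_neg[of "ShA C s"] assms by auto
  ultimately show ?thesis by simp
qed

lemma W_ShA_pow:
  assumes s: "s \<in> Arr C"
  shows "ShA_pow C n s \<in> W \<longleftrightarrow> s \<in> W"
proof (induction n rule: int_induct[of _ 0])
  case (step1 i)
  have "ShA_pow C (i + 1) s = ShA C (ShA_pow C i s)"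
    using ShA_pow_add[OF s, of 1 i] by (simp add: ShA_pow_1 add.commute)
  then show ?case using step1 W_ShA[of "ShA_pow C i s"] s by simp
next
  case (step2 i)
  have "ShA_pow C i s = ShA C (ShA_pow C (i - 1) s)"
    using ShA_pow_add[OF s, of 1 "i - 1"] by (simp add: ShA_pow_1)
  then show ?case using step2 W_ShA[of "ShA_pow C (i - 1) s"] s by simp
qed simp

text \<open>The cone of a zero arrow has the target of the arrow as a direct summand.\<close>

lemma W_Zer:
  assumes "Zer C X Y \<in> W" "X \<in> Obj C" "Y \<in> Obj C"
  shows "Y \<in> S"
proof -
  obtain g h where T: "(Zer C X Y, g, h) \<in> Tri C" using Tri_exists[of "Zer C X Y"] assms by auto
  show ?thesis
    using thick_summand[OF Tri_Zer_biproduct[OF T]] weak_eq_iff[OF T] assms by simp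
qed

lemma ShA_inject: "f \<in> Arr C \<Longrightarrow> g \<in> Arr C \<Longrightarrow> ShA C f = ShA C g \<Longrightarrow> f = g"
  using ShA_bij unfolding bij_betw_def inj_on_def by blast

lemma ShO_inject: "X \<in> Obj C \<Longrightarrow> Y \<in> Obj C \<Longrightarrow> ShO C X = ShO C Y \<Longrightarrow> X = Y"
  using ShO_bij unfolding bij_betw_def inj_on_def by blast

lemma ShA_surj:
  assumes "f \<in> Arr C"
  obtains g where "g \<in> Arr C" "f = ShA C g"
  using ShA_bij assms unfolding bij_betw_def by blast

lemma roof_ShA:
  assumes "s \<in> Arr C" "f \<in> Arr C" "X \<in> Obj C" "Y \<in> Obj C"
  shows "roof (ShO C X) (ShO C Y) (ShA C s) (ShA C f) \<longleftrightarrow> roof X Y s f"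
  using assms W_ShA[of s] ShO_inject[of "Cod C s" X] ShO_inject[of "Cod C f" Y] ShO_inject[of
      "Dom C f" "Dom C s"]
  by (auto simp: roof_def)

lemma roof_ShAI: "roof X Y s f \<Longrightarrow> roof (ShO C X) (ShO C Y) (ShA C s) (ShA C f)"
  using roof_ShA[of s f X Y] by (auto simp: roof_def)

text \<open>Suspension is bijective on arrows, so witnesses of an equivalence can also be
  desuspended.\<close>

lemma rel_ShA:
  assumes r: "roof X Y s f" "roof X Y t g"
  shows "((ShA C s, ShA C f), (ShA C t, ShA C g)) \<in> rel \<longleftrightarrow> ((s, f), (t, g)) \<in> rel"
proof
  note R = r[unfolded roof_def]
  have r': "roof (ShO C X) (ShO C Y) (ShA C s) (ShA C f)"
      "roof (ShO C X) (ShO C Y) (ShA C t) (ShA C g)"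
    using r roof_ShAI by blast+
  {
    assume "((s, f), (t, g)) \<in> rel"
    then obtain u v where uv: "u \<in> Arr C" "v \<in> Arr C" "Cod C u = Dom C s" "Cod C v = Dom C t"
      "Dom C v = Dom C u" "s \<cdot> u = t \<cdot> v" "s \<cdot> u \<in> W" "f \<cdot> u = g \<cdot> v"
      by (rule relE)
    have "ShA C (s \<cdot> u) = ShA C s \<cdot> ShA C u" "ShA C (t \<cdot> v) = ShA C t \<cdot> ShA C v"
      "ShA C (f \<cdot> u) = ShA C f \<cdot> ShA C u" "ShA C (g \<cdot> v) = ShA C g \<cdot> ShA C v"
      using uv(1-5) R by (auto intro!: ShA_Cmp_Arr)
    moreover have "ShA C (s \<cdot> u) \<in> W" using uv(7) W_ShA by simp
    ultimately show "((ShA C s, ShA C f), (ShA C t, ShA C g)) \<in> rel"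
      using uv R by (intro relI[OF r', of "ShA C u" "ShA C v"]) auto
  next
    assume "((ShA C s, ShA C f), (ShA C t, ShA C g)) \<in> rel"
    then obtain u v where uv: "u \<in> Arr C" "v \<in> Arr C" "Cod C u = Dom C (ShA C s)"
        "Cod C v = Dom C (ShA C t)"
      "Dom C v = Dom C u" "ShA C s \<cdot> u = ShA C t \<cdot> v" "ShA C s \<cdot> u \<in> W" "ShA C f \<cdot> u = ShA C g \<cdot> v"
      by (rule relE)
    obtain u' where u': "u' \<in> Arr C" "u = ShA C u'" using ShA_surj uv(1) by blast
    obtain v' where v': "v' \<in> Arr C" "v = ShA C v'" using ShA_surj uv(2) by blast
    have D: "Cod C u' = Dom C s" "Cod C v' = Dom C t" "Dom C v' = Dom C u'"
    proof -
      have "ShO C (Cod C u') = ShO C (Dom C s)" "ShO C (Cod C v') = ShO C (Dom C t)"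
        "ShO C (Dom C v') = ShO C (Dom C u')"
        using uv(3-5) u' v' R by simp_all
      then show "Cod C u' = Dom C s" "Cod C v' = Dom C t" "Dom C v' = Dom C u'"
        using u' v' R by (meson ShO_inject Dom_Obj Cod_Obj W_Arr)+
    qed
    have S: "ShA C (s \<cdot> u') = ShA C s \<cdot> u" "ShA C (t \<cdot> v') = ShA C t \<cdot> v"
      "ShA C (f \<cdot> u') = ShA C f \<cdot> u" "ShA C (g \<cdot> v') = ShA C g \<cdot> v"
      unfolding u'(2) v'(2) using u' v' D R by (auto intro!: ShA_Cmp_Arr)
    have A: "s \<cdot> u' \<in> Arr C" "t \<cdot> v' \<in> Arr C" "f \<cdot> u' \<in> Arr C" "g \<cdot> v' \<in> Arr C"
      using u' v' D R by auto
    have "s \<cdot> u' = t \<cdot> v'" "f \<cdot> u' = g \<cdot> v'"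
      using ShA_inject[OF A(1,2)] ShA_inject[OF A(3,4)] S uv(6,8) by metis+
    moreover have "s \<cdot> u' \<in> W" using S(1) uv(7) W_ShA[OF A(1)] by simp
    ultimately show "((s, f), (t, g)) \<in> rel"
      using u' v' D by (intro relI[OF r, of u' v']) auto
  }
qed

text \<open>The suspension of a class is the set of its suspended representatives. That this is a
  whole class and not only part of one needs both directions of \<open>rel_ShA\<close> and
  surjectivity on arrows.\<close>

lemma ShA_cls:
  assumes r: "roof X Y s f"
  shows "ShA Q (cls s f) = cls (ShA C s) (ShA C f)"
proof -
  note R = r[unfolded roof_def]
  have XY: "X \<in> Obj C" "Y \<in> Obj C" using R by auto
  have r': "roof (ShO C X) (ShO C Y) (ShA C s) (ShA C f)" using r by (rule roof_ShAI)
  have "x \<in> cls (ShA C s) (ShA C f)" if "x \<in> map_prod (ShA C) (ShA C) ` cls s f" for x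
  proof -
    obtain t g where tg: "(t, g) \<in> cls s f" "x = (ShA C t, ShA C g)" using \<open>x \<in> _\<close> by auto
    show ?thesis
      using rel_ShA[OF r mem_cls_roof(1)[OF r tg(1)]] tg by (simp add: mem_cls)
  qed
  moreover have "x \<in> map_prod (ShA C) (ShA C) ` cls s f" if "x \<in> cls (ShA C s) (ShA C f)" for x
  proof -
    obtain t' g' where x: "x = (t', g')" by fastforce
    have rx: "roof (ShO C X) (ShO C Y) t' g'" using mem_cls_roof(1)[OF r'] that x by blast
    have "t' \<in> Arr C" "g' \<in> Arr C" using rx by (auto simp: roof_def)
    then obtain t g where tg: "t \<in> Arr C" "t' = ShA C t" "g \<in> Arr C" "g' = ShA C g"
      using ShA_surj by metis
    then have "roof X Y t g" using rx XY roof_ShA by simp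
    then have "(t, g) \<in> cls s f" using rel_ShA[OF r] that x tg by (simp add: mem_cls)
    then show ?thesis using x tg by force
  qed
  ultimately show ?thesis by auto
qed

lemma ShA_quotient:
  assumes "f \<in> Arr C"
  shows "ShA Q (q f) = q (ShA C f)"
  using ShA_cls[OF roof_Ide[OF assms]] assms by (simp add: quotient_arr_cls ShA_Ide)

lemma shift_category_quotient: "shift_category Q"
proof -
  interpret Q: additive_category Q by (rule additive_category_quotient)
  show ?thesis
  proof
    show "bij_betw (ShO Q) (Obj Q) (Obj Q)" using ShO_bij by simp
    have H: "ShA Q a \<in> Hom Q (ShO C X) (ShO C Y)" if "a \<in> Hom Q X Y" for a X Y
    proof -
      obtain s f where 1: "roof X Y s f" "a = cls s f" using \<open>a \<in> _\<close> by (rule Hom_roof)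
      then have "roof (ShO C X) (ShO C Y) (ShA C s) (ShA C f)" using roof_ShAI by blast
      then show ?thesis unfolding 1(2) ShA_cls[OF 1(1)] by (rule roof_Hom)
    qed
    then show "ShA Q f \<in> Hom Q (ShO Q X) (ShO Q Y)" if "f \<in> Hom Q X Y" for f X Y
      using that by simp
    have inj: "a = b" if a: "a \<in> Arr Q" and b: "b \<in> Arr Q" and eq: "ShA Q a = ShA Q b" for a b
    proof -
      have aH: "a \<in> Hom Q (Dom Q a) (Cod Q a)" and bH: "b \<in> Hom Q (Dom Q b) (Cod Q b)"
        using a b by (simp_all only: Hom_iff)
      have "ShO C (Dom Q a) = ShO C (Dom Q b)" "ShO C (Cod Q a) = ShO C (Cod Q b)"
        using H[OF aH] H[OF bH] eq by (simp_all only: Hom_iff)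
      then have "Dom Q a = Dom Q b" "Cod Q a = Cod Q b"
        using Q.Dom_Obj[OF a] Q.Dom_Obj[OF b] Q.Cod_Obj[OF a] Q.Cod_Obj[OF b] ShO_inject by simp_all
      then have bH': "b \<in> Hom Q (Dom Q a) (Cod Q a)" using bH by simp
      obtain s f where 1: "roof (Dom Q a) (Cod Q a) s f" "a = cls s f" using aH by (rule Hom_roof)
      obtain t g where 2: "roof (Dom Q a) (Cod Q a) t g" "b = cls t g" using bH' by (rule Hom_roof)
      have r: "roof (ShO C (Dom Q a)) (ShO C (Cod Q a)) (ShA C s) (ShA C f)"
        "roof (ShO C (Dom Q a)) (ShO C (Cod Q a)) (ShA C t) (ShA C g)"
        using 1(1) 2(1) roof_ShAI by blast+
      have "cls (ShA C s) (ShA C f) = cls (ShA C t) (ShA C g)"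
        using eq ShA_cls[OF 1(1)] ShA_cls[OF 2(1)] 1(2) 2(2) by metis
      then show ?thesis
        unfolding 1(2) 2(2) cls_eq_iff[OF r] cls_eq_iff[OF 1(1) 2(1)] rel_ShA[OF 1(1) 2(1)] .
    qed
    have surj: "\<exists>b\<in>Arr Q. a = ShA Q b" if "a \<in> Arr Q" for a
    proof -
      have "a \<in> Hom Q (Dom Q a) (Cod Q a)" using that by (simp only: Hom_iff)
      then obtain s' f' where 1: "roof (Dom Q a) (Cod Q a) s' f'" "a = cls s' f'" by (rule Hom_roof)
      have "s' \<in> Arr C" "f' \<in> Arr C" using 1 by (auto simp: roof_def)
      then obtain s f where sf: "s \<in> Arr C" "s' = ShA C s" "f \<in> Arr C" "f' = ShA C f"
        using ShA_surj by metis
      have "roof (ShO C (Cod C s)) (ShO C (Cod C f)) (ShA C s) (ShA C f)"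
        using 1 sf by (auto simp: roof_def)
      then have r: "roof (Cod C s) (Cod C f) s f" using sf roof_ShA by simp
      show ?thesis
        using roof_Hom[OF r] ShA_cls[OF r] 1(2) sf by (metis ArrI)
    qed
    show "bij_betw (ShA Q) (Arr Q) (Arr Q)"
    proof (rule bij_betw_imageI[OF inj_onI Set.set_eqI[OF iffI]])
      show "x = y" if "x \<in> Arr Q" "y \<in> Arr Q" "ShA Q x = ShA Q y" for x y
        using inj[OF that] .
      show "x \<in> Arr Q" if "x \<in> ShA Q ` Arr Q" for x
        using that H unfolding Hom_iff by (metis imageE)
      show "x \<in> ShA Q ` Arr Q" if "x \<in> Arr Q" for x
        using surj[OF that] by blast
    qed
    show "ShA Q (Ide Q X) = Ide Q (ShO Q X)" if "X \<in> Obj Q" for X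
      using ShA_quotient[of "Ide C X"] that by (simp add: ShA_Ide)
    show "ShA Q (b \<cdot>\<^bsub>Q\<^esub> a) = ShA Q b \<cdot>\<^bsub>Q\<^esub> ShA Q a" if ab: "a \<in> Hom Q X Y" "b \<in> Hom Q Y Z"
        for a b X Y Z
    proof -
      obtain s f where 1: "roof X Y s f" "a = cls s f" using ab(1) by (rule Hom_roof)
      obtain t g where 2: "roof Y Z t g" "b = cls t g" using ab(2) by (rule Hom_roof)
      note R = 1(1)[unfolded roof_def] 2(1)[unfolded roof_def]
      obtain u v where uv: "u \<in> W" "v \<in> Arr C" "Cod C u = Dom C f" "Cod C v = Dom C t"
          "Dom C v = Dom C u"
        "f \<cdot> u = t \<cdot> v" using Ore[of f t] R by auto
      have r: "roof X Z (s \<cdot> u) (g \<cdot> v)" using R uv(1-5) W_Cmp[of s u] by (simp add: roof_def)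
      have r': "roof (ShO C X) (ShO C Y) (ShA C s) (ShA C f)"
          "roof (ShO C Y) (ShO C Z) (ShA C t) (ShA C g)"
        using 1(1) 2(1) roof_ShAI by blast+
      have e: "ShA C f \<cdot> ShA C u = ShA C t \<cdot> ShA C v"
        using uv R ShA_Cmp_Arr[of u f] ShA_Cmp_Arr[of v t] by simp
      have e': "ShA C (s \<cdot> u) = ShA C s \<cdot> ShA C u" "ShA C (g \<cdot> v) = ShA C g \<cdot> ShA C v"
        using uv(1-5) R by (auto intro!: ShA_Cmp_Arr)
      have c: "cls (ShA C t) (ShA C g) \<cdot>\<^bsub>Q\<^esub> cls (ShA C s) (ShA C f)
          = cls (ShA C s \<cdot> ShA C u) (ShA C g \<cdot> ShA C v)"
        by (rule Cmp_cls[OF r' _ _ _ _ _ e]) (use uv(1-5) R W_ShA in auto)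
      show ?thesis
        unfolding 1(2) 2(2) Cmp_cls[OF 1(1) 2(1) uv] ShA_cls[OF r] e' ShA_cls[OF 1(1)] ShA_cls[OF
            2(1)] c ..
    qed
    show "ShA Q (Add Q a b) = Add Q (ShA Q a) (ShA Q b)" if ab: "a \<in> Hom Q X Y" "b \<in> Hom Q X Y"
        for a b X Y
    proof -
      obtain s f g where 1: "roof X Y s f" "roof X Y s g" "a = cls s f" "b = cls s g"
          using common2[OF ab] .
      have r: "roof X Y s (Add C f g)" using 1 by (simp add: roof_def)
      have r': "roof (ShO C X) (ShO C Y) (ShA C s) (ShA C f)"
          "roof (ShO C X) (ShO C Y) (ShA C s) (ShA C g)"
        using 1 roof_ShAI by blast+
      have e: "ShA C (Add C f g) = Add C (ShA C f) (ShA C g)"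
        by (rule ShA_Add[of f "Dom C s" Y]) (use 1 in \<open>auto simp: roof_def Hom_iff\<close>)
      show ?thesis
        unfolding 1(3,4) Add_cls[OF 1(1,2)] ShA_cls[OF r] ShA_cls[OF 1(1)] ShA_cls[OF 1(2)]
            Add_cls[OF r'] e ..
    qed
  qed
qed

sublocale quotient: shift_category Q
  by (rule shift_category_quotient)

section \<open>Zero arrows, zero objects, isomorphisms and triangles of the quotient\<close>

lemma quotient_eq_Zer:
  assumes f: "f \<in> Hom C X Y"
  shows "q f = Zer Q X Y \<longleftrightarrow> (\<exists>u\<in>W. Cod C u = X \<and> f \<cdot> u = Zer C (Dom C u) Y)"
proof
  note XY = Hom_Obj[OF f]
  have r: "roof X Y (Ide C X) f" using f roof_Ide[of f] by (simp add: Hom_iff)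
  have r0: "roof X Y (Ide C X) (Zer C X Y)" using roof_Ide[of "Zer C X Y"] XY by simp
  have e: "q f = cls (Ide C X) f" "Zer Q X Y = cls (Ide C X) (Zer C X Y)"
    using f XY by (simp_all add: quotient_arr_cls Hom_iff)
  {
    assume "q f = Zer Q X Y"
    then obtain w where "w \<in> W" "Cod C w = X" "f \<cdot> w = Zer C X Y \<cdot> w"
      using cls_eqD[OF r r0] e XY by auto
    then show "\<exists>u\<in>W. Cod C u = X \<and> f \<cdot> u = Zer C (Dom C u) Y" using XY by auto
  next
    assume "\<exists>u\<in>W. Cod C u = X \<and> f \<cdot> u = Zer C (Dom C u) Y"
    then obtain u where u: "u \<in> W" "Cod C u = X" "f \<cdot> u = Zer C (Dom C u) Y" by blast
    have "cls (Ide C X) f = cls (Ide C X \<cdot> u) (f \<cdot> u)"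
      using cls_refine_W(2)[OF r u(1)] u(2) XY by simp
    also have "\<dots> = cls u (Zer C (Dom C u) Y)" using u by simp
    also have "\<dots> = Zer Q X Y" using cls_Zer[OF u(1), of Y] u(2) XY by simp
    finally show "q f = Zer Q X Y" using e by simp
  }
qed

text \<open>If the identity of \<open>X\<close> becomes zero, some zero arrow into \<open>X\<close>
  has its cone in \<open>S\<close>, and \<open>X\<close> is a summand of that cone; this is where
  closure under summands enters. Conversely an arrow from a zero object to \<open>X\<close> has cone
  \<open>X\<close>.\<close>

lemma zero_obj_quotient: "zero_obj Q X \<longleftrightarrow> X \<in> S"
proof
  assume "zero_obj Q X"
  then have X: "X \<in> Obj C" and "q (Ide C X) = Zer Q X X" by (simp_all add: quotient.zero_obj_iff)
  then obtain u where u: "u \<in> W" "Cod C u = X" "Ide C X \<cdot> u = Zer C (Dom C u) X"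
    using quotient_eq_Zer[OF Ide_Hom[OF X]] by blast
  then have u0: "u = Zer C (Dom C u) (Cod C u)" by simp
  obtain g h where T: "(u, g, h) \<in> Tri C" using Tri_exists[of u] u by auto
  show "X \<in> S"
    using thick_summand[OF Tri_Zer_biproduct[OF T u0]] weak_eq_iff[OF T] u by simp
next
  assume X: "X \<in> S"
  then have XO: "X \<in> Obj C" by (rule thick_Obj)
  obtain Z where Z: "zero_obj C Z" using zero_obj_exists by blast
  then have ZO: "Z \<in> Obj C" by (simp add: zero_obj_iff)
  have "Zer C Z X \<in> W" using weak_eq_iff[OF Tri_from_zero[OF XO Z]] X XO by simp
  then have "q (Ide C X) = Zer Q X X"
    using XO ZO by (subst quotient_eq_Zer[OF Ide_Hom[OF XO]]) (auto intro!: bexI[of _ "Zer C Z X"])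
  then show "zero_obj Q X" using XO by (simp add: quotient.zero_obj_iff)
qed

text \<open>The inverse is the roof with left leg \<open>s\<close> and an identity as right
  leg.\<close>

lemma quotient_iso:
  assumes "s \<in> W"
  shows "is_iso Q (q s)"
proof -
  let ?X = "Dom C s" and ?Y = "Cod C s"
  have O: "?X \<in> Obj C" "?Y \<in> Obj C" using assms by auto
  have sH: "q s \<in> Hom Q ?X ?Y" using quotient_Hom assms by (simp add: Hom_iff)
  have r: "roof ?Y ?X s (Ide C ?X)" using assms O by (simp add: roof_def)
  have r1: "roof ?X ?Y (Ide C ?X) s" using roof_Ide[of s] assms by simp
  have "cls s (Ide C ?X) \<cdot>\<^bsub>Q\<^esub> cls (Ide C ?X) s = cls (Ide C ?X \<cdot> Ide C ?X) (Ide C ?X \<cdot> Ide C ?X)"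
    by (rule Cmp_cls[OF r1 r]) (use assms O weak_eq_Ide in auto)
  then have 1: "cls s (Ide C ?X) \<cdot>\<^bsub>Q\<^esub> q s = Ide Q ?X" using O by (simp add: quotient_arr_cls)
  have "cls (Ide C ?X) s \<cdot>\<^bsub>Q\<^esub> cls s (Ide C ?X) = cls (s \<cdot> Ide C ?X) (s \<cdot> Ide C ?X)"
    by (rule Cmp_cls[OF r r1]) (use assms O weak_eq_Ide in auto)
  then have "q s \<cdot>\<^bsub>Q\<^esub> cls s (Ide C ?X) = cls s s" using assms by (simp add: quotient_arr_cls)
  also have "\<dots> = cls (Ide C ?Y) (Ide C ?Y)"
    using cls_refine_W(2)[OF roof_Ide[of "Ide C ?Y"], of s] assms O by simp
  finally have 2: "q s \<cdot>\<^bsub>Q\<^esub> cls s (Ide C ?X) = Ide Q ?Y" using O by (simp add: quotient_arr_cls)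
  show ?thesis by (rule quotient.is_isoI[OF sH roof_Hom[OF r] 1 2])
qed

lemma ShO_pow_quotient: "ShO_pow Q = ShO_pow C"
  by (simp add: ShO_pow_def fun_eq_iff)

text \<open>Downwards, the claim is checked after one suspension, which is injective on the arrows
  of the quotient.\<close>

lemma ShA_pow_quotient:
  assumes "f \<in> Arr C"
  shows "ShA_pow Q n (q f) = q (ShA_pow C n f)"
proof -
  have qA: "q f \<in> Arr Q" if "f \<in> Arr C" for f using quotient_Hom[of f] that ArrI by (metis Hom_iff)
  show ?thesis
  proof (induction n rule: int_induct[of _ 0])
    case base
    show ?case by (simp only: quotient.ShA_pow_0 ShA_pow_0)
  next
    case (step1 i)
    have "ShA_pow Q (i + 1) (q f) = ShA Q (ShA_pow Q i (q f))"
      using quotient.ShA_pow_add[OF qA[OF assms], of 1 i]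
          by (simp only: quotient.ShA_pow_1 add.commute)
    also have "\<dots> = q (ShA C (ShA_pow C i f))" unfolding step1 using assms
        by (intro ShA_quotient) simp
    also have "ShA C (ShA_pow C i f) = ShA_pow C (i + 1) f"
      using ShA_pow_add[OF assms, of 1 i] by (simp only: ShA_pow_1 add.commute)
    finally show ?case .
  next
    case (step2 i)
    have "ShA Q (ShA_pow Q (i - 1) (q f)) = ShA_pow Q i (q f)"
    proof -
      have "1 + (i - 1) = i" by simp
      then show ?thesis
        using quotient.ShA_pow_add[OF qA[OF assms], of 1 "i - 1"] by (simp only: quotient.ShA_pow_1)
    qed
    also have "\<dots> = q (ShA C (ShA_pow C (i - 1) f))"
      unfolding step2 using ShA_pow_add[OF assms, of 1 "i - 1"] by (simp add: ShA_pow_1)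
    also have "\<dots> = ShA Q (q (ShA_pow C (i - 1) f))" using assms
        by (intro ShA_quotient[symmetric]) simp
    finally show ?case
      using quotient.ShA_bij quotient.ShA_pow_typed(1)[OF qA[OF assms]] qA[of "ShA_pow C (i - 1) f"]
          assms
      unfolding bij_betw_def inj_on_def by (meson ShA_pow_typed(1))
  qed
qed

text \<open>\<open>tri_iso\<close> does not look at the exact triangles, so it means the same before
  and after these are closed under isomorphism.\<close>

lemma Tri_quotient_iff:
  "(f', g', h') \<in> Tri Q \<longleftrightarrow> (\<exists>f g h. (f, g, h) \<in> Tri C \<and> tri_iso Q (q f, q g, q h) (f', g', h'))"
proof -
  have I: "tri_iso (verdier_pre C S) = tri_iso Q"
    by (simp add: tri_iso_def is_iso_def Hom_def verdier_def Let_def)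
  have TQ: "Tri Q = {t'. \<exists>t\<in>Tri (verdier_pre C S). tri_iso (verdier_pre C S) t t'}"
    by (simp add: verdier_def Let_def)
  have TP: "Tri (verdier_pre C S) = {(q f, q g, q h) | f g h. (f, g, h) \<in> Tri C}"
    by (simp add: verdier_pre_def)
  show ?thesis unfolding TQ I TP by blast
qed

lemma Tri_quotient:
  assumes T: "(f, g, h) \<in> Tri C"
  shows "(q f, q g, q h) \<in> Tri Q"
proof -
  note T' = TriD[OF T]
  have H: "q f \<in> Hom Q (Dom C f) (Cod C f)" "q g \<in> Hom Q (Cod C f) (Cod C g)"
    "q h \<in> Hom Q (Cod C g) (ShO C (Dom C f))"
    by (rule quotient_Hom, use T' in \<open>simp add: Hom_iff\<close>)+
  note H' = H[unfolded Hom_iff]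
  have i: "is_iso Q (Ide Q X)" "Ide Q X \<in> Hom Q X X" if "X \<in> Obj C" for X
    using quotient.is_iso_Ide quotient.Ide_Hom that verdier_simps(1) by blast+
  have "tri_iso Q (q f, q g, q h) (q f, q g, q h)"
    unfolding tri_iso_def prod.case
  proof (intro conjI exI)
    show "Ide Q (Cod C f) \<cdot>\<^bsub>Q\<^esub> q f = q f \<cdot>\<^bsub>Q\<^esub> Ide Q (Dom C f)"
      using quotient.Cmp_Ide_left[OF H(1)] quotient.Cmp_Ide_right[OF H(1)] by metis
    show "Ide Q (Cod C g) \<cdot>\<^bsub>Q\<^esub> q g = q g \<cdot>\<^bsub>Q\<^esub> Ide Q (Cod C f)"
      using quotient.Cmp_Ide_left[OF H(2)] quotient.Cmp_Ide_right[OF H(2)] by metis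
    have "ShA Q (Ide Q (Dom C f)) = Ide Q (ShO C (Dom C f))"
      using quotient.ShA_Ide[of "Dom C f"] T' verdier_simps(1,4) Dom_Obj by metis
    then show "ShA Q (Ide Q (Dom C f)) \<cdot>\<^bsub>Q\<^esub> q h = q h \<cdot>\<^bsub>Q\<^esub> Ide Q (Cod C g)"
      using quotient.Cmp_Ide_left[OF H(3)] quotient.Cmp_Ide_right[OF H(3)] by metis
  qed (use i H H' T' in \<open>simp_all del: verdier_simps(2,3,5,6) add: Hom_iff\<close>)
  then show ?thesis unfolding Tri_quotient_iff using T by blast
qed

end

section \<open>Graded actions and localisation of endomorphism modules\<close>

text \<open>Collects the properties of an action from which \<open>localisation_vanishes_iff\<close>
  follows, so that it applies to the original category and to its quotients alike.\<close>

locale graded_action = graded_commutative_ring R G + shift_category C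
  for R :: "('r, 'k) ring_scheme" (structure) and G :: "int \<Rightarrow> 'r set"
    and C :: "('o, 'm) tcat" +
  fixes \<phi> :: "'r \<Rightarrow> int \<Rightarrow> 'o \<Rightarrow> 'm"
  assumes act_Hom: "r \<in> carrier R \<Longrightarrow> X \<in> Obj C \<Longrightarrow> \<phi> r n X \<in> Hom C X (ShO_pow C n X)"
    and act_degree: "r \<in> G d \<Longrightarrow> n \<noteq> d \<Longrightarrow> X \<in> Obj C \<Longrightarrow> \<phi> r n X = Zer C X (ShO_pow C n X)"
    and act_mult: "r \<in> G d \<Longrightarrow> s \<in> G e \<Longrightarrow> X \<in> Obj C \<Longrightarrow>
      \<phi> (r \<otimes> s) (d + e) X = ShA_pow C e (\<phi> r d X) \<cdot>\<^bsub>C\<^esub> \<phi> s e X"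
begin

text \<open>For \<open>r\<close> homogeneous of degree \<open>d\<close> all other components of the
  action vanish, so this one equation says that \<open>r\<close> annihilates
  \<open>X\<close>.\<close>

definition kills :: "int \<Rightarrow> 'r \<Rightarrow> 'o \<Rightarrow> bool" where
  "kills d r X \<longleftrightarrow> \<phi> r d X = Zer C X (ShO_pow C d X)"

lemma act_typed [simp]:
  assumes "r \<in> carrier R" "X \<in> Obj C"
  shows "\<phi> r n X \<in> Arr C" "Dom C (\<phi> r n X) = X" "Cod C (\<phi> r n X) = ShO_pow C n X"
  using act_Hom[OF assms] by (auto simp: Hom_iff)

lemma kills_mult:
  assumes "r \<in> G d" "s \<in> G e" "X \<in> Obj C" "kills d r X"
  shows "kills (d + e) (r \<otimes> s) X"
proof -
  have "s \<in> carrier R" using assms G_carrier by blast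
  then show ?thesis
    using assms act_mult[OF assms(1-3)]
    by (simp add: kills_def ShO_pow_add add.commute)
qed

lemma kills_all_degrees: "r \<in> G d \<Longrightarrow> X \<in> Obj C \<Longrightarrow> kills d r X \<Longrightarrow> kills n r X"
  unfolding kills_def using act_degree by metis

lemma End_star_simps:
  "carrier (End_star C \<phi> X) = {f. (\<forall>n. f n \<in> Hom C X (ShO_pow C n X))
      \<and> finite {n. f n \<noteq> Zer C X (ShO_pow C n X)}}"
  "one (End_star C \<phi> X) = graded_one C X"
  "zero (End_star C \<phi> X) = (\<lambda>n. Zer C X (ShO_pow C n X))"
  "add (End_star C \<phi> X) = (\<lambda>f g n. Add C (f n) (g n))"
  "r \<odot>\<^bsub>End_star C \<phi> X\<^esub> f = graded_cmp C X (\<lambda>n. \<phi> r n X) f"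
  by (simp_all add: End_star_def)

lemma End_star_zero_closed: "X \<in> Obj C \<Longrightarrow> (\<lambda>n. Zer C X (ShO_pow C n X)) \<in> carrier (End_star C \<phi> X)"
  by (simp add: End_star_simps Zer_Hom)

lemma End_star_one_closed: "X \<in> Obj C \<Longrightarrow> graded_one C X \<in> carrier (End_star C \<phi> X)"
  by (auto simp: End_star_simps graded_one_def Zer_Hom Ide_Hom intro: finite_subset[of _ "{0}"])

lemma smult_killed:
  assumes X: "X \<in> Obj C" and f: "f \<in> carrier (End_star C \<phi> X)" and k: "\<And>n. kills n r X"
  shows "r \<odot>\<^bsub>End_star C \<phi> X\<^esub> f = \<zero>\<^bsub>End_star C \<phi> X\<^esub>"
proof
  fix k
  interpret H: abelian_group "hom_group C X (ShO_pow C k X)" using hom_abelian_group X by simp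
  have fH: "f j \<in> Hom C X (ShO_pow C j X)" for j using f by (simp add: End_star_simps)
  have "ShA_pow C j (\<phi> r (k - j) X) \<cdot>\<^bsub>C\<^esub> f j = Zer C X (ShO_pow C k X)" for j
    using k[of "k - j"] fH[of j] X by (simp add: kills_def Hom_iff ShO_pow_add)
  then show "(r \<odot>\<^bsub>End_star C \<phi> X\<^esub> f) k = \<zero>\<^bsub>End_star C \<phi> X\<^esub> k"
    using H.finsum_zero by (simp add: End_star_simps graded_cmp_def)
qed

lemma smult_zero: "X \<in> Obj C \<Longrightarrow> r \<odot>\<^bsub>End_star C \<phi> X\<^esub> \<zero>\<^bsub>End_star C \<phi> X\<^esub> = \<zero>\<^bsub>End_star C \<phi> X\<^esub>"
proof
  fix k assume X: "X \<in> Obj C"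
  interpret H: abelian_group "hom_group C X (ShO_pow C k X)" using hom_abelian_group X by simp
  show "(r \<odot>\<^bsub>End_star C \<phi> X\<^esub> \<zero>\<^bsub>End_star C \<phi> X\<^esub>) k = \<zero>\<^bsub>End_star C \<phi> X\<^esub> k"
    using H.finsum_empty by (simp add: End_star_simps graded_cmp_def)
qed

lemma smult_one:
  assumes X: "X \<in> Obj C" and r: "r \<in> carrier R"
  shows "(r \<odot>\<^bsub>End_star C \<phi> X\<^esub> \<one>\<^bsub>End_star C \<phi> X\<^esub>) k = \<phi> r k X"
proof -
  interpret H: abelian_group "hom_group C X (ShO_pow C k X)" using hom_abelian_group X by simp
  show ?thesis
  \<comment> \<open>The sum in \<open>graded_cmp\<close> runs over the support of the identity,
    which is empty and not \<open>{0}\<close> if \<open>X\<close> is zero.\<close>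
  proof (cases "Ide C X = Zer C X X")
    case True
    then have "{j. graded_one C X j \<noteq> Zer C X (ShO_pow C j X)} = {}"
      by (auto simp: graded_one_def)
    moreover have "\<phi> r k X = Zer C X (ShO_pow C k X)"
      using Cmp_Ide(2)[of "\<phi> r k X" X] Cmp_Zer_right[of "\<phi> r k X" X X] X r True by simp
    ultimately show ?thesis
      using H.finsum_empty by (simp add: End_star_simps graded_cmp_def)
  next
    case False
    then have "{j. graded_one C X j \<noteq> Zer C X (ShO_pow C j X)} = {0}"
      by (auto simp: graded_one_def)
    moreover have "\<phi> r k X \<in> carrier (hom_group C X (ShO_pow C k X))"
      using X r act_Hom by simp
    ultimately show ?thesis
      using X r H.finsum_insert[of "{}" 0 "\<lambda>j. ShA_pow C j (\<phi> r (k - j) X) \<cdot>\<^bsub>C\<^esub> graded_one C X j"]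
      by (simp add: End_star_simps graded_cmp_def graded_one_def Add_Zer)
  qed
qed

lemma denominators_mult:
  assumes "P \<in> Spec R G" "s \<in> G d" "t \<in> G e" "s \<notin> P" "t \<notin> P"
  shows "s \<otimes> t \<in> G (d + e)" "s \<otimes> t \<notin> P"
  using Spec_prime[OF assms(1) G_carrier[OF assms(2)] G_carrier[OF assms(3)]] assms(2-5)
      homogeneous_mult
  by blast+

text \<open>The identity decides: if its fraction is zero, some element outside \<open>P\<close>
  annihilates it. Conversely an element that kills \<open>X\<close> kills every endomorphism, so
  that all fractions coincide.\<close>

lemma localisation_vanishes_iff:
  assumes P: "P \<in> Spec R G" and X: "X \<in> Obj C"
  shows "localisation_vanishes R G (End_star C \<phi> X) P \<longleftrightarrow> (\<exists>d. \<exists>s\<in>G d. s \<notin> P \<and> kills d s X)"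
proof
  let ?M = "End_star C \<phi> X" and ?D = "loc_denominators G P"
  let ?rel = "loc_rel R G ?M P"
  have one: "\<one> \<in> ?D" using homogeneous_one Spec_one[OF P] by (auto simp: loc_denominators_def)
  note z = End_star_zero_closed[OF X] and e = End_star_one_closed[OF X]
  {
    assume v: "localisation_vanishes R G ?M P"
    have "?rel `` {(\<one>\<^bsub>?M\<^esub>, \<one>)} \<in> localisation R G ?M P"
      unfolding localisation_def using one e by (intro quotientI) (simp add: End_star_simps)
    then have "?rel `` {(\<one>\<^bsub>?M\<^esub>, \<one>)} = ?rel `` {(\<zero>\<^bsub>?M\<^esub>, \<one>)}"
      using v by (simp add: localisation_vanishes_def localisation_zero_def)
    moreover have "((\<one>\<^bsub>?M\<^esub>, \<one>), (\<one>\<^bsub>?M\<^esub>, \<one>)) \<in> ?rel"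
      unfolding loc_rel_def using one e by (auto simp: End_star_simps intro!: bexI[of _ \<one>])
    ultimately have "((\<zero>\<^bsub>?M\<^esub>, \<one>), (\<one>\<^bsub>?M\<^esub>, \<one>)) \<in> ?rel" by blast
    then obtain u u' where u: "u \<in> carrier R" "u' \<in> carrier R" "u \<otimes> \<one> = u' \<otimes> \<one>" "u \<otimes> \<one> \<in> ?D"
      "u \<odot>\<^bsub>?M\<^esub> \<zero>\<^bsub>?M\<^esub> = u' \<odot>\<^bsub>?M\<^esub> \<one>\<^bsub>?M\<^esub>"
      unfolding loc_rel_def by blast
    then have uu: "u' = u" "u \<in> ?D" by simp_all
    then obtain d where d: "u \<in> G d" "u \<notin> P" by (auto simp: loc_denominators_def)
    have "u \<odot>\<^bsub>?M\<^esub> \<one>\<^bsub>?M\<^esub> = \<zero>\<^bsub>?M\<^esub>" using u(5) uu(1) smult_zero[OF X] by simp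
    then have "\<phi> u d X = \<zero>\<^bsub>?M\<^esub> d" using smult_one[OF X u(1), of d] by simp
    then show "\<exists>d. \<exists>s\<in>G d. s \<notin> P \<and> kills d s X"
      using d by (auto simp: kills_def End_star_simps)
  next
    assume "\<exists>d. \<exists>s\<in>G d. s \<notin> P \<and> kills d s X"
    then obtain d t where t: "t \<in> G d" "t \<notin> P" "kills d t X" by blast
    have rel: "((m, s), (m', s')) \<in> ?rel"
      if m: "m \<in> carrier ?M" "m' \<in> carrier ?M" and s: "s \<in> ?D" "s' \<in> ?D" for m m' s s'
    proof -
      obtain a b where ab: "s \<in> G a" "s \<notin> P" "s' \<in> G b" "s' \<notin> P"
        using s by (auto simp: loc_denominators_def)
      have c: "s \<in> carrier R" "s' \<in> carrier R" "t \<in> carrier R" using ab t G_carrier by blast+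
      \<comment> \<open>\<open>s''\<close> is \<open>s\<close> up to sign. With it
        \<open>t \<otimes> s'\<close> and \<open>t \<otimes> s''\<close> expand the two fractions to
        a common denominator, and \<open>t\<close> kills both numerators.\<close>
      obtain s'' where s'': "s'' \<in> G a" "s' \<otimes> s = s'' \<otimes> s'"
        using homogeneous_swap[OF ab(3,1)] ab G_minus[OF ab(1)] c by (metis l_minus)
      have c'': "s'' \<in> carrier R" using s'' G_carrier by blast
      have "(t \<otimes> s') \<otimes> s = (t \<otimes> s'') \<otimes> s'" using c c'' s'' by (simp add: m_assoc)
      moreover have "(t \<otimes> s') \<otimes> s \<in> ?D"
        using denominators_mult[OF P denominators_mult(1)[OF P t(1) ab(3) t(2) ab(4)] ab(1)
            denominators_mult(2)[OF P t(1) ab(3) t(2) ab(4)] ab(2)]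
        unfolding loc_denominators_def by blast
      moreover have "(t \<otimes> s') \<odot>\<^bsub>?M\<^esub> m = \<zero>\<^bsub>?M\<^esub>"
        using kills_all_degrees[OF homogeneous_mult[OF t(1) ab(3)] X kills_mult[OF t(1) ab(3) X
            t(3)]]
        by (rule smult_killed[OF X m(1)])
      moreover have "(t \<otimes> s'') \<odot>\<^bsub>?M\<^esub> m' = \<zero>\<^bsub>?M\<^esub>"
        using kills_all_degrees[OF homogeneous_mult[OF t(1) s''(1)] X kills_mult[OF t(1) s''(1) X
            t(3)]]
        by (rule smult_killed[OF X m(2)])
      moreover have "t \<otimes> s' \<in> carrier R" "t \<otimes> s'' \<in> carrier R" using c c'' by auto
      ultimately have "\<exists>u\<in>carrier R. \<exists>u'\<in>carrier R. u \<otimes> s = u' \<otimes> s' \<and> u \<otimes> s \<in> ?D \<and>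
          u \<odot>\<^bsub>?M\<^esub> m = u' \<odot>\<^bsub>?M\<^esub> m'"
        by metis
      then show ?thesis unfolding loc_rel_def using m s by blast
    qed
    \<comment> \<open>The relation is total, so its only class is the whole set of
      fractions.\<close>
    have cl: "?rel `` {x} = carrier ?M \<times> ?D" if "x \<in> carrier ?M \<times> ?D" for x
    proof
      show "?rel `` {x} \<subseteq> carrier ?M \<times> ?D" unfolding loc_rel_def by blast
      show "carrier ?M \<times> ?D \<subseteq> ?rel `` {x}" using that rel by (cases x) blast
    qed
    have z1: "(\<zero>\<^bsub>?M\<^esub>, \<one>) \<in> carrier ?M \<times> ?D" using one z by (simp add: End_star_simps)
    have "(carrier ?M \<times> ?D) // ?rel = {carrier ?M \<times> ?D}"
      unfolding quotient_def using cl z1 by blast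
    then show "localisation_vanishes R G ?M P"
      unfolding localisation_vanishes_def localisation_def localisation_zero_def using cl[OF z1]
          by simp
  }
qed

end

section \<open>Linear triangulated categories\<close>

context linear_triangulated_category
begin

section \<open>The action through the graded centre\<close>

lemma act_centre: "r \<in> carrier R \<Longrightarrow> \<phi> r n \<in> centre_degree C n"
  using ring_hom_closed[OF action_hom, of r] by (simp add: graded_centre_def)

lemma action_Hom: "r \<in> carrier R \<Longrightarrow> X \<in> Obj C \<Longrightarrow> \<phi> r n X \<in> Hom C X (ShO_pow C n X)"
  using act_centre[of r n] by (auto simp: centre_degree_def PiE_def Pi_def)

lemma act_natural: "r \<in> carrier R \<Longrightarrow> f \<in> Arr C \<Longrightarrow>
    ShA_pow C n f \<cdot>\<^bsub>C\<^esub> \<phi> r n (Dom C f) = \<phi> r n (Cod C f) \<cdot>\<^bsub>C\<^esub> f"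
  using act_centre[of r n] by (auto simp: centre_degree_def)

lemma act_ShO: "r \<in> carrier R \<Longrightarrow> X \<in> Obj C \<Longrightarrow>
    \<phi> r n (ShO C X) = (if even n then ShA C (\<phi> r n X) else neg C (ShA C (\<phi> r n X)))"
  using act_centre[of r n] by (auto simp: centre_degree_def)

lemma act_finite: "r \<in> carrier R \<Longrightarrow> finite {n. \<exists>X\<in>Obj C. \<phi> r n X \<noteq> Zer C X (ShO_pow C n X)}"
  using ring_hom_closed[OF action_hom, of r] by (simp add: graded_centre_def)

lemma act_add: "r \<in> carrier R \<Longrightarrow> s \<in> carrier R \<Longrightarrow> X \<in> Obj C \<Longrightarrow>
    \<phi> (r \<oplus> s) n X = Add C (\<phi> r n X) (\<phi> s n X)"
  using ring_hom_add[OF action_hom, of r s] by (simp add: graded_centre_def)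

lemma act_one: "X \<in> Obj C \<Longrightarrow> \<phi> \<one> 0 X = Ide C X"
  using ring_hom_one[OF action_hom] by (simp add: graded_centre_def graded_one_def)

lemma act_mult_all: "r \<in> carrier R \<Longrightarrow> s \<in> carrier R \<Longrightarrow> X \<in> Obj C \<Longrightarrow>
    \<phi> (r \<otimes> s) n X = graded_cmp C X (\<lambda>i. \<phi> r i X) (\<lambda>j. \<phi> s j X) n"
  using ring_hom_mult[OF action_hom, of r s] by (simp add: graded_centre_def)

sublocale graded_action
proof
  show "\<phi> r n X \<in> Hom C X (ShO_pow C n X)" if "r \<in> carrier R" "X \<in> Obj C" for r n X
    using action_Hom that by blast
  show "\<phi> r n X = Zer C X (ShO_pow C n X)" if "r \<in> G d" "n \<noteq> d" "X \<in> Obj C" for r d n X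
    using action_degree that by blast
  show "\<phi> (r \<otimes> s) (d + e) X = ShA_pow C e (\<phi> r d X) \<cdot>\<^bsub>C\<^esub> \<phi> s e X"
    if r: "r \<in> G d" and s: "s \<in> G e" and X: "X \<in> Obj C" for r d s e X
  proof -
    have c: "r \<in> carrier R" "s \<in> carrier R" using r s G_carrier by blast+
    interpret H: abelian_group "hom_group C X (ShO_pow C (d + e) X)" using hom_abelian_group X
        by simp
    note rH = action_Hom[OF c(1) X, of d] and sH = action_Hom[OF c(2) X, of e]
    have t: "ShA_pow C e (\<phi> r d X) \<cdot>\<^bsub>C\<^esub> \<phi> s e X \<in> Hom C X (ShO_pow C (d + e) X)"
      using rH sH X by (simp add: Hom_iff ShO_pow_add add.commute)
    show ?thesis
    \<comment> \<open>The product in the centre sums over the support of the second factor, which is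
      empty and not \<open>{e}\<close> if \<open>s\<close> kills \<open>X\<close>.\<close>
    proof (cases "\<phi> s e X = Zer C X (ShO_pow C e X)")
      case True
      then have "\<phi> s j X = Zer C X (ShO_pow C j X)" for j using action_degree[OF s _ X] by metis
      then have "\<phi> (r \<otimes> s) (d + e) X = Zer C X (ShO_pow C (d + e) X)"
        unfolding act_mult_all[OF c X] graded_cmp_def using H.finsum_empty by simp
      moreover have "ShA_pow C e (\<phi> r d X) \<cdot>\<^bsub>C\<^esub> \<phi> s e X = Zer C X (ShO_pow C (d + e) X)"
        unfolding True using rH X by (simp add: Hom_iff ShO_pow_add add.commute)
      ultimately show ?thesis by simp
    next
      case False
      then have "{j. \<phi> s j X \<noteq> Zer C X (ShO_pow C j X)} = {e}" using action_degree[OF s _ X]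
          by blast
      then show ?thesis
        unfolding act_mult_all[OF c X] graded_cmp_def
        using t H.finsum_insert[of "{}" e "\<lambda>j. ShA_pow C j (\<phi> r (d + e - j) X) \<cdot>\<^bsub>C\<^esub> \<phi> s j X"]
        by (simp add: Add_Zer)
    qed
  qed
qed

lemma act_Cmp: "r \<in> carrier R \<Longrightarrow> f \<in> Hom C X Y \<Longrightarrow> \<phi> r d Y \<cdot>\<^bsub>C\<^esub> f = ShA_pow C d f \<cdot>\<^bsub>C\<^esub> \<phi> r d X"
  using act_natural[of r f d] by (auto simp: Hom_iff)

text \<open>The sign depends on the parities of \<open>d\<close> and \<open>n\<close>, but it is
  left open because later uses ask only about vanishing or membership up to sign. Downwards, one
  suspension is cancelled by injectivity.\<close>

lemma act_ShO_pow:
  assumes r: "r \<in> carrier R" and X: "X \<in> Obj C"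
  shows "\<phi> r d (ShO_pow C n X) = ShA_pow C n (\<phi> r d X) \<or>
    \<phi> r d (ShO_pow C n X) = neg C (ShA_pow C n (\<phi> r d X))"
proof (induction n rule: int_induct[of _ 0])
  case base
  then show ?case by simp
next
  case (step1 i)
  have "\<phi> r d (ShO_pow C (i + 1) X) = \<phi> r d (ShO C (ShO_pow C i X))"
    using X by (simp add: ShO_ShO_pow)
  moreover have "ShA_pow C (i + 1) (\<phi> r d X) = ShA C (ShA_pow C i (\<phi> r d X))"
    using r X ShA_pow_add[of "\<phi> r d X" 1 i] by (simp add: ShA_pow_1 add.commute)
  ultimately show ?case
    using act_ShO[OF r, of "ShO_pow C i X" d] step1(2) r X by (auto simp: ShA_neg)
next
  case (step2 i)
  let ?a = "\<phi> r d (ShO_pow C (i - 1) X)" and ?b = "ShA_pow C (i - 1) (\<phi> r d X)"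
  have "\<phi> r d (ShO_pow C i X) = \<phi> r d (ShO C (ShO_pow C (i - 1) X))"
    using X by (simp add: ShO_ShO_pow)
  moreover have "ShA_pow C i (\<phi> r d X) = ShA C ?b"
    using r X ShA_pow_add[of "\<phi> r d X" 1 "i - 1"] by (simp add: ShA_pow_1)
  moreover have "\<phi> r d (ShO C (ShO_pow C (i - 1) X)) = ShA C ?a \<or>
      \<phi> r d (ShO C (ShO_pow C (i - 1) X)) = neg C (ShA C ?a)"
    using act_ShO[OF r, of "ShO_pow C (i - 1) X" d] X by simp
  moreover have "ShA C ?a \<in> Arr C" "ShA C ?b \<in> Arr C" using r X by auto
  ultimately have "ShA C ?a = ShA C ?b \<or> ShA C ?a = neg C (ShA C ?b)"
    using step2(2) neg_neg by metis
  then have "ShA C ?a = ShA C ?b \<or> ShA C ?a = ShA C (neg C ?b)"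
    using r X by (simp add: ShA_neg)
  moreover have "?a \<in> Arr C" "?b \<in> Arr C" "neg C ?b \<in> Arr C" using r X by auto
  ultimately show ?case
    using ShA_bij unfolding bij_betw_def inj_on_def by blast
qed

lemma kills_ShO_pow:
  assumes r: "r \<in> carrier R" and X: "X \<in> Obj C"
  shows "kills d r (ShO_pow C n X) \<longleftrightarrow> kills d r X"
proof -
  have "kills d r X \<longleftrightarrow> ShA_pow C n (\<phi> r d X) = Zer C (ShO_pow C n X) (ShO_pow C d (ShO_pow C n X))"
    using ShA_pow_eq_Zer[OF action_Hom[OF r X], of n d] X
        by (simp add: kills_def ShO_pow_add add.commute)
  moreover have "neg C (ShA_pow C n (\<phi> r d X)) = Zer C A B \<longleftrightarrow> ShA_pow C n (\<phi> r d X) = Zer C A B"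
    if "A \<in> Obj C" "B \<in> Obj C" for A B
    using that neg_inject[of "ShA_pow C n (\<phi> r d X)" "Zer C A B"] r X by auto
  then have "\<phi> r d (ShO_pow C n X) = Zer C (ShO_pow C n X) (ShO_pow C d (ShO_pow C n X)) \<longleftrightarrow>
      ShA_pow C n (\<phi> r d X) = Zer C (ShO_pow C n X) (ShO_pow C d (ShO_pow C n X))"
    using act_ShO_pow[OF r X, of d n] X by (metis ShO_pow_Obj)
  ultimately show ?thesis unfolding kills_def by simp
qed

lemma kills_ShO: "r \<in> carrier R \<Longrightarrow> X \<in> Obj C \<Longrightarrow> kills d r (ShO C X) \<longleftrightarrow> kills d r X"
  using kills_ShO_pow[of r X d 1] by (simp add: ShO_pow_1)

lemma kills_zero_obj: "zero_obj C X \<Longrightarrow> r \<in> carrier R \<Longrightarrow> kills d r X"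
  unfolding kills_def using zero_obj_arrows(1) action_Hom by (metis zero_obj_iff)

text \<open>By naturality \<open>r\<close> can act on the middle object instead of on the
  target.\<close>

lemma kills_factor:
  assumes r: "r \<in> carrier R" and f: "f \<in> Hom C X Y" and g: "g \<in> Hom C Y Z" and k: "kills d r Y"
  shows "\<phi> r d Z \<cdot>\<^bsub>C\<^esub> (g \<cdot>\<^bsub>C\<^esub> f) = Zer C X (ShO_pow C d Z)"
proof -
  have "\<phi> r d Z \<cdot>\<^bsub>C\<^esub> (g \<cdot>\<^bsub>C\<^esub> f) = ShA_pow C d g \<cdot>\<^bsub>C\<^esub> (\<phi> r d Y \<cdot>\<^bsub>C\<^esub> f)"
    using act_Cmp[OF r g, of d] f g r Hom_Obj[OF f] Hom_Obj[OF g]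
      Cmp_assoc_Arr[of f g "\<phi> r d Z"] Cmp_assoc_Arr[of f "\<phi> r d Y" "ShA_pow C d g"]
    by (simp add: Hom_iff)
  then show ?thesis
    using k f g Hom_Obj[OF f] Hom_Obj[OF g] by (simp add: kills_def Hom_iff)
qed

text \<open>As \<open>s\<close> annihilates \<open>g\<close>, its action on the cone factors through
  \<open>h\<close>; by naturality \<open>t\<close> can then be made to act on \<open>h\<close>,
  which it annihilates. The hypotheses concern the arrows \<open>g\<close> and \<open>h\<close>, not
  the objects, so that the lemma also applies when only these vanish locally.\<close>

lemma kills_cone:
  assumes T: "(f, g, h) \<in> Tri C" and s: "s \<in> G e" and t: "t \<in> G e'"
    and sg: "\<phi> s e (Cod C g) \<cdot>\<^bsub>C\<^esub> g = Zer C (Cod C f) (ShO_pow C e (Cod C g))"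
    and th: "\<phi> t e' (ShO C (Dom C f)) \<cdot>\<^bsub>C\<^esub> h = Zer C (Cod C g) (ShO_pow C e' (ShO C (Dom C f)))"
  shows "kills (e' + e) (t \<otimes> s) (Cod C g)"
proof -
  note T' = TriD[OF T]
  let ?Z = "Cod C g" and ?X = "Dom C f"
  have O: "?Z \<in> Obj C" "?X \<in> Obj C" using T' by auto
  have c: "s \<in> carrier R" "t \<in> carrier R" using s t G_carrier by blast+
  let ?a = "\<phi> s e ?Z"
  have a: "?a \<in> Hom C ?Z (ShO_pow C e ?Z)" using action_Hom c O by blast
  obtain k where k: "k \<in> Hom C (ShO C ?X) (ShO_pow C e ?Z)" "k \<cdot>\<^bsub>C\<^esub> h = ?a"
    using Tri_extend[OF Tri_rot[OF T], of ?a "ShO_pow C e ?Z"] a sg T' by auto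
  have "\<phi> t e' (ShO_pow C e ?Z) \<cdot>\<^bsub>C\<^esub> ?a = ShA_pow C e' k \<cdot>\<^bsub>C\<^esub> (\<phi> t e' (ShO C ?X) \<cdot>\<^bsub>C\<^esub> h)"
    using act_Cmp[OF c(2) k(1), of e'] k T' c O
      Cmp_assoc_Arr[of h k "\<phi> t e' (ShO_pow C e ?Z)"] Cmp_assoc_Arr[of h "\<phi> t e' (ShO C ?X)"
          "ShA_pow C e' k"]
    by (simp add: Hom_iff)
  also have "\<dots> = Zer C ?Z (ShO_pow C e' (ShO_pow C e ?Z))"
    unfolding th using k T' O by (simp add: Hom_iff)
  finally have z: "\<phi> t e' (ShO_pow C e ?Z) \<cdot>\<^bsub>C\<^esub> ?a = Zer C ?Z (ShO_pow C (e' + e) ?Z)"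
    using O by (simp add: ShO_pow_add)
  \<comment> \<open>The product in the centre uses the shifted action instead of the action on the
    shifted object; they agree up to sign.\<close>
  have "ShA_pow C e (\<phi> t e' ?Z) \<cdot>\<^bsub>C\<^esub> ?a = Zer C ?Z (ShO_pow C (e' + e) ?Z)"
    using act_ShO_pow[OF c(2) O(1), of e' e]
  proof
    assume "\<phi> t e' (ShO_pow C e ?Z) = ShA_pow C e (\<phi> t e' ?Z)"
    then show ?thesis using z by simp
  next
    assume eq: "\<phi> t e' (ShO_pow C e ?Z) = neg C (ShA_pow C e (\<phi> t e' ?Z))"
    let ?b = "ShA_pow C e (\<phi> t e' ?Z) \<cdot>\<^bsub>C\<^esub> ?a"
    have b: "?b \<in> Arr C" using c O by simp
    have "neg C ?b = Zer C ?Z (ShO_pow C (e' + e) ?Z)" using z c O unfolding eq by simp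
    then show ?thesis using neg_inject[of ?b "Zer C ?Z (ShO_pow C (e' + e) ?Z)"] b O by simp
  qed
  then show ?thesis unfolding kills_def act_mult[OF t s O(1)] .
qed

text \<open>With the complement of a prime for \<open>U\<close> these are the objects vanishing at
  that prime; the sets \<open>products P Q\<close> will describe the torsion objects. One proof of
  thickness covers both.\<close>

definition kernel :: "'r set \<Rightarrow> 'o set" where
  "kernel U = {X \<in> Obj C. \<exists>d. \<exists>r\<in>G d. r \<in> U \<and> kills d r X}"

lemma thick_kernel:
  assumes one: "\<one> \<in> U" and mult: "\<And>d e r s. r \<in> G d \<Longrightarrow> s \<in> G e \<Longrightarrow> r \<in> U \<Longrightarrow> s \<in> U \<Longrightarrow> r \<otimes> s \<in> U"
  shows "thick C (kernel U)"
  unfolding thick_def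
proof (intro conjI allI impI ballI)
  show "kernel U \<subseteq> Obj C" by (auto simp: kernel_def)
  show "Z \<in> kernel U" if "zero_obj C Z" for Z
    using that kills_zero_obj[OF that, of \<one> 0] one homogeneous_one
        by (auto simp: kernel_def zero_obj_iff)
  show "X \<in> kernel U \<longleftrightarrow> ShO C X \<in> kernel U" if "X \<in> Obj C" for X
  proof -
    have "kills d r (ShO C X) \<longleftrightarrow> kills d r X" if "r \<in> G d" for d r
      using kills_ShO[OF G_carrier[OF that] \<open>X \<in> Obj C\<close>] .
    then show ?thesis using that ShO_Obj[OF that] unfolding kernel_def by blast
  qed
  show "case t of (f, g, h) \<Rightarrow> Dom C f \<in> kernel U \<longrightarrow> Cod C f \<in> kernel U \<longrightarrow> Cod C g \<in> kernel U"
    if "t \<in> Tri C" for t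
  proof -
    have "Cod C g \<in> kernel U" if T: "(f, g, h) \<in> Tri C"
        and K: "Dom C f \<in> kernel U" "Cod C f \<in> kernel U" for f g h
    proof -
      note T' = TriD[OF T]
      obtain d r where r: "r \<in> G d" "r \<in> U" "kills d r (Dom C f)" using K(1)
          by (auto simp: kernel_def)
      obtain e s where s: "s \<in> G e" "s \<in> U" "kills e s (Cod C f)" using K(2)
          by (auto simp: kernel_def)
      have c: "r \<in> carrier R" "s \<in> carrier R" using r s G_carrier by blast+
      have gH: "g \<in> Hom C (Cod C f) (Cod C g)" "Ide C (Cod C f) \<in> Hom C (Cod C f) (Cod C f)"
        and hH: "h \<in> Hom C (Cod C g) (ShO C (Dom C f))"
          "Ide C (ShO C (Dom C f)) \<in> Hom C (ShO C (Dom C f)) (ShO C (Dom C f))"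
        using T' by (auto simp: Hom_iff)
      have sg: "\<phi> s e (Cod C g) \<cdot>\<^bsub>C\<^esub> g = Zer C (Cod C f) (ShO_pow C e (Cod C g))"
        using kills_factor[OF c(2) gH(2,1) s(3)] T' by simp
      have "kills d r (ShO C (Dom C f))" using kills_ShO[OF c(1), of "Dom C f" d] r(3) T' by simp
      then have rh: "\<phi> r d (ShO C (Dom C f)) \<cdot>\<^bsub>C\<^esub> h
          = Zer C (Cod C g) (ShO_pow C d (ShO C (Dom C f)))"
        using kills_factor[OF c(1) hH] T' by simp
      show ?thesis
        using kills_cone[OF T s(1) r(1) sg rh] homogeneous_mult[OF r(1) s(1)] mult[OF r(1) s(1) r(2)
            s(2)] T'
        by (auto simp: kernel_def)
    qed
    then show ?thesis using that by blast
  qed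
  show "X \<in> kernel U" if B: "is_biproduct C X Y B" and K: "B \<in> kernel U" for X Y B
  proof -
    obtain d r where r: "r \<in> G d" "r \<in> U" "kills d r B" using K by (auto simp: kernel_def)
    obtain i p where ip: "X \<in> Obj C" "i \<in> Hom C X B" "p \<in> Hom C B X" "p \<cdot>\<^bsub>C\<^esub> i = Ide C X"
      using B unfolding is_biproduct_def by blast
    have "kills d r X"
      using kills_factor[OF G_carrier[OF r(1)] ip(2,3) r(3)] ip G_carrier[OF r(1)]
          by (simp add: kills_def)
    then show ?thesis using r ip by (auto simp: kernel_def)
  qed
qed

text \<open>Vanishing at \<open>P\<close> implies vanishing at all smaller primes, because an
  element outside \<open>P\<close> is outside these too.\<close>

lemma local_kernel_eq:
  assumes P: "P \<in> Spec R G"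
  shows "local_kernel R G C \<phi> P = kernel (- P)"
proof -
  have "(\<forall>Q\<in>Spec R G. Q \<subseteq> P \<longrightarrow> localisation_vanishes R G (End_star C \<phi> X) Q) \<longleftrightarrow>
      (\<exists>d. \<exists>r\<in>G d. r \<in> - P \<and> kills d r X)" if X: "X \<in> Obj C" for X
    using localisation_vanishes_iff[OF _ X] P by blast
  then show ?thesis by (auto simp: local_kernel_def kernel_def)
qed

lemma thick_local_kernel: "P \<in> Spec R G \<Longrightarrow> thick C (kernel (- P))"
  using Spec_one denominators_mult(2) by (intro thick_kernel) auto

section \<open>Nakayama's lemma\<close>

context
  fixes X :: 'o
  assumes X: "X \<in> Obj C"
begin

text \<open>Scalar multiplication within single degrees: for \<open>r\<close> of degree
  \<open>d\<close> and \<open>f\<close> placed in degree \<open>n\<close> this is the only term of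
  \<open>graded_cmp\<close>. Single arrows are easier to handle than finitely supported
  families.\<close>

definition smul :: "int \<Rightarrow> 'r \<Rightarrow> int \<Rightarrow> 'm \<Rightarrow> 'm" where
  "smul d r n f = ShA_pow C n (\<phi> r d X) \<cdot>\<^bsub>C\<^esub> f"

lemma smul_Hom:
  assumes "r \<in> carrier R" "f \<in> Hom C X (ShO_pow C n X)"
  shows "smul d r n f \<in> Hom C X (ShO_pow C (n + d) X)"
  using assms X by (simp add: smul_def Hom_iff ShO_pow_add)

lemma smul_mult:
  assumes r: "r \<in> G d" and s: "s \<in> G e" and f: "f \<in> Hom C X (ShO_pow C n X)"
  shows "smul (d + e) (r \<otimes> s) n f = smul d r (n + e) (smul e s n f)"
proof -
  have c: "r \<in> carrier R" "s \<in> carrier R" using r s G_carrier by blast+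
  have "ShA_pow C n (\<phi> (r \<otimes> s) (d + e) X) = ShA_pow C (n + e) (\<phi> r d X) \<cdot>\<^bsub>C\<^esub> ShA_pow C n (\<phi> s e X)"
    unfolding act_mult[OF r s X] using c X ShA_pow_Cmp[of "\<phi> s e X" "ShA_pow C e (\<phi> r d X)" n]
    by (simp add: ShA_pow_add)
  then show ?thesis unfolding smul_def using c X f by (simp add: Hom_iff ShO_pow_add)
qed

lemma smul_add_left:
  assumes "r \<in> carrier R" "s \<in> carrier R" "f \<in> Hom C X (ShO_pow C n X)"
  shows "smul d (r \<oplus> s) n f = Add C (smul d r n f) (smul d s n f)"
  unfolding smul_def act_add[OF assms(1,2) X]
  using ShA_pow_Add[OF action_Hom[OF assms(1) X] action_Hom[OF assms(2) X]]
    Cmp_Add_left[OF assms(3) ShA_pow_Hom[OF action_Hom[OF assms(1) X]] ShA_pow_Hom[OF action_Hom[OF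
        assms(2) X]]]
  by simp

lemma smul_add_right:
  assumes "r \<in> carrier R" "f \<in> Hom C X (ShO_pow C n X)" "g \<in> Hom C X (ShO_pow C n X)"
  shows "smul d r n (Add C f g) = Add C (smul d r n f) (smul d r n g)"
  unfolding smul_def
  by (rule Cmp_Add_right[OF assms(2,3) ShA_pow_Hom[OF action_Hom[OF assms(1) X]]])

lemma smul_Zer:
  assumes "r \<in> carrier R"
  shows "smul d r n (Zer C X (ShO_pow C n X)) = Zer C X (ShO_pow C (n + d) X)"
  unfolding smul_def using assms X by (simp add: ShO_pow_add)

lemma smul_zero:
  assumes "f \<in> Hom C X (ShO_pow C n X)"
  shows "smul d \<zero> n f = Zer C X (ShO_pow C (n + d) X)"
proof -
  \<comment> \<open>\<open>\<zero>\<close> is homogeneous of every degree; viewed in degree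
    \<open>d + 1\<close> it acts as zero in degree \<open>d\<close>.\<close>
  have "\<phi> \<zero> d X = Zer C X (ShO_pow C d X)"
    by (rule action_degree[OF G_zero[of "d + 1"] _ X]) simp
  then show ?thesis unfolding smul_def using assms X by (simp add: Hom_iff ShO_pow_add)
qed

lemma smul_minus:
  assumes "r \<in> carrier R" "f \<in> Hom C X (ShO_pow C n X)"
  shows "smul d (\<ominus> r) n f = neg C (smul d r n f)"
proof (rule Add_eq_Zer[OF smul_Hom[OF assms]])
  show "smul d (\<ominus> r) n f \<in> Hom C X (ShO_pow C (n + d) X)" using assms by (intro smul_Hom) auto
  show "Add C (smul d r n f) (smul d (\<ominus> r) n f) = Zer C X (ShO_pow C (n + d) X)"
    using smul_add_left[of r "\<ominus> r" f n d] assms smul_zero by (simp add: r_neg)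
qed

lemma smul_one:
  assumes "f \<in> Hom C X (ShO_pow C n X)"
  shows "smul 0 \<one> n f = f"
  using assms X act_one[OF X] by (simp add: smul_def Hom_iff)

text \<open>The sign is absorbed into the coefficient, which keeps its degree and stays in
  \<open>I\<close>.\<close>

lemma smul_swap:
  assumes "r \<in> G d" "s \<in> G e" "I = carrier R \<or> ideal I R" "r \<in> I"
  obtains r' where "r' \<in> G d" "r' \<in> I" "s \<otimes> r = r' \<otimes> s"
proof (cases "s \<otimes> r = r \<otimes> s")
  case True
  then show ?thesis using that assms by blast
next
  case False
  have c: "r \<in> carrier R" "s \<in> carrier R" using assms G_carrier by blast+
  have "\<ominus> r \<in> I" using assms c additive_subgroup.a_inv_closed[OF ideal.axioms(1)] by auto
  moreover have "s \<otimes> r = \<ominus> r \<otimes> s"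
    using False homogeneous_swap[OF assms(2,1)] c by (auto simp: l_minus)
  ultimately show ?thesis using that G_minus[OF assms(1)] by blast
qed

text \<open>The degree \<open>n\<close> part of the submodule that the list generates with
  coefficients in \<open>I\<close>. Taking one coefficient per entry, along the list, lets
  Nakayama's lemma split off the first generator.\<close>

primrec span :: "'r set \<Rightarrow> (int \<times> 'm) list \<Rightarrow> int \<Rightarrow> 'm set" where
  "span I [] n = {Zer C X (ShO_pow C n X)}"
| "span I (km # ms) n = {Add C (smul (n - fst km) c (fst km) (snd km)) g | c g.
     c \<in> I \<and> c \<in> G (n - fst km) \<and> g \<in> span I ms n}"

definition homogeneous_list :: "(int \<times> 'm) list \<Rightarrow> bool" where
  "homogeneous_list ms \<longleftrightarrow> (\<forall>(k, m)\<in>set ms. m \<in> Hom C X (ShO_pow C k X))"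

lemma homogeneous_list_Cons:
  "homogeneous_list (km # ms) \<longleftrightarrow> snd km \<in> Hom C X (ShO_pow C (fst km) X) \<and> homogeneous_list ms"
  by (auto simp: homogeneous_list_def)

lemma smul_Hom':
  assumes "c \<in> G d" "m \<in> Hom C X (ShO_pow C k X)"
  shows "smul (n - k) c k m \<in> Hom C X (ShO_pow C n X)"
  using smul_Hom[OF G_carrier[OF assms(1)] assms(2), of "n - k"] by simp

lemma span_Hom: "homogeneous_list ms \<Longrightarrow> f \<in> span I ms n \<Longrightarrow> f \<in> Hom C X (ShO_pow C n X)"
proof (induction ms arbitrary: f)
  case Nil
  then show ?case using X Zer_Hom by simp
next
  case (Cons km ms)
  then show ?case by (auto simp: homogeneous_list_Cons intro!: Add_Hom smul_Hom')
qed

lemma span_Zer: "homogeneous_list ms \<Longrightarrow> \<zero> \<in> I \<Longrightarrow> Zer C X (ShO_pow C n X) \<in> span I ms n"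
proof (induction ms)
  case (Cons km ms)
  have "smul (n - fst km) \<zero> (fst km) (snd km) = Zer C X (ShO_pow C n X)"
    using smul_zero[of "snd km" "fst km" "n - fst km"] Cons by (simp add: homogeneous_list_Cons)
  then have "Zer C X (ShO_pow C n X) = Add C (smul (n - fst km) \<zero> (fst km) (snd km)) (Zer C X
      (ShO_pow C n X))"
    using X by (simp add: Add_Zer[OF Zer_Hom])
  then show ?case using Cons G_zero by (auto simp: homogeneous_list_Cons)
qed simp

lemma Add_interchange:
  assumes "a \<in> Hom C Y Z" "b \<in> Hom C Y Z" "c \<in> Hom C Y Z" "d \<in> Hom C Y Z"
  shows "Add C (Add C a b) (Add C c d) = Add C (Add C a c) (Add C b d)"
proof -
  have "Add C (Add C a b) (Add C c d) = Add C a (Add C (Add C b c) d)"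
    using Add_assoc[OF assms(1,2) Add_Hom[OF assms(3,4)]] Add_assoc[OF assms(2-4)] by simp
  also have "\<dots> = Add C (Add C a c) (Add C b d)"
    using Add_commute[OF assms(2,3)] Add_assoc[OF assms(1,3) Add_Hom[OF assms(2,4)]] Add_assoc[OF
        assms(3,2,4)] by simp
  finally show ?thesis .
qed

lemma span_Add:
  assumes "I = carrier R \<or> ideal I R"
  shows "homogeneous_list ms \<Longrightarrow> f \<in> span I ms n \<Longrightarrow> g \<in> span I ms n \<Longrightarrow> Add C f g \<in> span I ms n"
proof (induction ms arbitrary: f g)
  case Nil
  then show ?case using X by (simp add: Add_Zer[OF Zer_Hom])
next
  case (Cons km ms)
  obtain c f' where f: "f = Add C (smul (n - fst km) c (fst km) (snd km)) f'" "c \<in> I"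
      "c \<in> G (n - fst km)" "f' \<in> span I ms n"
    using Cons.prems(2) by auto
  obtain d g' where g: "g = Add C (smul (n - fst km) d (fst km) (snd km)) g'" "d \<in> I"
      "d \<in> G (n - fst km)" "g' \<in> span I ms n"
    using Cons.prems(3) by auto
  have h: "snd km \<in> Hom C X (ShO_pow C (fst km) X)" "homogeneous_list ms"
    using Cons.prems(1) by (simp_all add: homogeneous_list_Cons)
  have cd: "c \<oplus> d \<in> I" "c \<oplus> d \<in> G (n - fst km)"
    using assms f g additive_subgroup.a_closed[OF ideal.axioms(1)] G_add by auto
  have "Add C f g = Add C (smul (n - fst km) (c \<oplus> d) (fst km) (snd km)) (Add C f' g')"
    unfolding f(1) g(1) smul_add_left[OF G_carrier[OF f(3)] G_carrier[OF g(3)] h(1)]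
    using smul_Hom'[OF f(3) h(1)] smul_Hom'[OF g(3) h(1)] span_Hom[OF h(2)] f(4) g(4)
    by (intro Add_interchange) auto
  then show ?case using cd Cons.IH[OF h(2) f(4) g(4)] by auto
qed

text \<open>Two coefficient sets are kept apart so that the lemma serves both for \<open>Q\<close>
  mapped to itself and, with \<open>r\<close> in \<open>Q\<close>, for all coefficients mapped into
  \<open>Q\<close>.\<close>

lemma span_smul:
  assumes r: "r \<in> G d" and IJ: "\<And>c. c \<in> I \<Longrightarrow> c \<in> carrier R \<Longrightarrow> r \<otimes> c \<in> J"
  shows "homogeneous_list ms \<Longrightarrow> f \<in> span I ms n \<Longrightarrow> smul d r n f \<in> span J ms (n + d)"
proof (induction ms arbitrary: f)
  case Nil
  then show ?case using smul_Zer[OF G_carrier[OF r]] by simp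
next
  case (Cons km ms)
  obtain c f' where f: "f = Add C (smul (n - fst km) c (fst km) (snd km)) f'" "c \<in> I"
      "c \<in> G (n - fst km)" "f' \<in> span I ms n"
    using Cons.prems(2) by auto
  have h: "snd km \<in> Hom C X (ShO_pow C (fst km) X)" "homogeneous_list ms"
    using Cons.prems(1) by (simp_all add: homogeneous_list_Cons)
  have "smul d r n f = Add C (smul d r n (smul (n - fst km) c (fst km) (snd km))) (smul d r n f')"
    unfolding f(1) by (rule smul_add_right[OF G_carrier[OF r] smul_Hom'[OF f(3) h(1)] span_Hom[OF
        h(2) f(4)]])
  also have "smul d r n (smul (n - fst km) c (fst km) (snd km))
      = smul (n + d - fst km) (r \<otimes> c) (fst km) (snd km)"
    using smul_mult[OF r f(3) h(1)] by (simp add: algebra_simps)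
  finally show ?case
    using IJ[OF f(2) G_carrier[OF f(3)]] homogeneous_mult[OF r f(3)] Cons.IH[OF h(2) f(4)]
    by (auto simp: algebra_simps)
qed

lemma span_member:
  assumes I: "I = carrier R \<or> ideal I R"
  shows "homogeneous_list ms \<Longrightarrow> (k, m) \<in> set ms \<Longrightarrow> c \<in> I \<Longrightarrow> c \<in> G (n - k) \<Longrightarrow> smul (n - k) c k m
      \<in> span I ms n"
proof (induction ms)
  case (Cons km ms)
  have z: "\<zero> \<in> I" using I additive_subgroup.zero_closed[OF ideal.axioms(1)] by auto
  have h: "snd km \<in> Hom C X (ShO_pow C (fst km) X)" "homogeneous_list ms"
    using Cons.prems(1) by (simp_all add: homogeneous_list_Cons)
  show ?case
  proof (cases "(k, m) = km")
    case True
    have "smul (n - k) c k m = Add C (smul (n - fst km) c (fst km) (snd km)) (Zer C X (ShO_pow C n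
        X))"
      using True Add_Zer(2)[OF smul_Hom'[OF Cons.prems(4)], of m k n] h by auto
    then show ?thesis
      using True Cons.prems(3,4) span_Zer[OF h(2) z, of n]
      by (auto intro!: exI[of _ c] exI[of _ "Zer C X (ShO_pow C n X)"])
  next
    case False
    then have m: "smul (n - k) c k m \<in> span I ms n" using Cons h by auto
    have "smul (n - fst km) \<zero> (fst km) (snd km) = Zer C X (ShO_pow C n X)"
      using smul_zero[OF h(1), of "n - fst km"] by simp
    then have "smul (n - k) c k m = Add C (smul (n - fst km) \<zero> (fst km) (snd km)) (smul (n - k) c k
        m)"
      using Add_Zer(1)[OF span_Hom[OF h(2) m]] by simp
    then show ?thesis using m z G_zero by auto
  qed
qed simp

text \<open>\<open>t\<close> is moved past each coefficient, which may change sign, until it meets a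
  generator.\<close>

lemma span_killed:
  assumes t: "t \<in> G d"
  shows "homogeneous_list ms \<Longrightarrow> (\<And>k m. (k, m) \<in> set ms \<Longrightarrow> smul d t k m
      = Zer C X (ShO_pow C (k + d) X)) \<Longrightarrow>
    f \<in> span I ms n \<Longrightarrow> smul d t n f = Zer C X (ShO_pow C (n + d) X)"
proof (induction ms arbitrary: f)
  case Nil
  then show ?case using smul_Zer[OF G_carrier[OF t]] by simp
next
  case (Cons km ms)
  let ?k = "fst km" and ?m = "snd km"
  obtain c f' where f: "f = Add C (smul (n - ?k) c ?k ?m) f'" "c \<in> G (n - ?k)" "f' \<in> span I ms n"
    using Cons.prems(3) by auto
  have h: "?m \<in> Hom C X (ShO_pow C ?k X)" "homogeneous_list ms"
    using Cons.prems(1) by (simp_all add: homogeneous_list_Cons)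
  obtain c' where c': "c' \<in> G (n - ?k)" "t \<otimes> c = c' \<otimes> t"
    using smul_swap[OF f(2) t, of "carrier R"] G_carrier[OF f(2)] by blast
  have k0: "smul d t ?k ?m = Zer C X (ShO_pow C (?k + d) X)" using Cons.prems(2)[of ?k ?m] by simp
  have "smul d t n (smul (n - ?k) c ?k ?m) = smul (d + (n - ?k)) (t \<otimes> c) ?k ?m"
    using smul_mult[OF t f(2) h(1)] by simp
  also have "\<dots> = smul (n - ?k) c' (?k + d) (smul d t ?k ?m)"
    unfolding c'(2) using smul_mult[OF c'(1) t h(1)] by (simp add: add.commute)
  also have "\<dots> = Zer C X (ShO_pow C (n + d) X)"
    unfolding k0 using smul_Zer[OF G_carrier[OF c'(1)], of "n - ?k" "?k + d"]
        by (simp add: add.commute)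
  finally have 1: "smul d t n (smul (n - ?k) c ?k ?m) = Zer C X (ShO_pow C (n + d) X)" .
  have 2: "smul d t n f' = Zer C X (ShO_pow C (n + d) X)"
    using Cons.IH[OF h(2) _ f(3)] Cons.prems(2) by simp
  show ?case
    unfolding f(1) smul_add_right[OF G_carrier[OF t] smul_Hom'[OF f(2) h(1)] span_Hom[OF h(2) f(3)]]
        1 2
    using X by (simp add: Add_Zer[OF Zer_Hom])
qed

text \<open>Elimination replaces the usual determinant argument, which presupposes commuting
  coefficients. If \<open>s m = c m + g\<close> for the first generator \<open>m\<close>, with
  \<open>c\<close> in \<open>Q\<close> and \<open>g\<close> in the \<open>Q\<close>-span of the
  others, then \<open>s - c\<close> is still outside \<open>Q\<close> and sends \<open>m\<close> to
  \<open>g\<close>; \<open>(s - c) s\<close> sends the other generators into their own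
  \<open>Q\<close>-span, so the induction hypothesis applies to them.\<close>

lemma graded_nakayama:
  assumes Q: "Q \<in> Spec R G"
  shows "homogeneous_list ms \<Longrightarrow> s \<in> G e \<Longrightarrow> s \<notin> Q \<Longrightarrow>
    (\<And>k m. (k, m) \<in> set ms \<Longrightarrow> smul e s k m \<in> span Q ms (k + e)) \<Longrightarrow>
    \<exists>d. \<exists>t\<in>G d. t \<notin> Q \<and> (\<forall>(k, m)\<in>set ms. smul d t k m = Zer C X (ShO_pow C (k + d) X))"
proof (induction ms arbitrary: s e)
  case Nil
  then show ?case by auto
next
  case (Cons km ms)
  interpret Q: ideal Q R using Spec_ideal[OF Q] .
  let ?k = "fst km" and ?m = "snd km"
  have h: "?m \<in> Hom C X (ShO_pow C ?k X)" "homogeneous_list ms"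
    using Cons.prems(1) by (simp_all add: homogeneous_list_Cons)
  have s: "s \<in> carrier R" using Cons.prems(2) G_carrier by blast
  have "smul e s ?k ?m \<in> span Q (km # ms) (?k + e)" using Cons.prems(4)[of ?k ?m] by simp
  then obtain c g where c: "smul e s ?k ?m = Add C (smul e c ?k ?m) g" "c \<in> Q" "c \<in> G e"
      "g \<in> span Q ms (?k + e)"
    by auto
  note gH = span_Hom[OF h(2) c(4)]
  have cR: "c \<in> carrier R" using c G_carrier by blast
  let ?s = "s \<oplus> \<ominus> c"
  have s': "?s \<in> G e" using Cons.prems(2) c(3) G_add G_minus by blast
  have "?s \<notin> Q"
  proof
    assume "?s \<in> Q"
    then have "?s \<oplus> c \<in> Q" using c(2) Q.a_closed by blast
    moreover have "?s \<oplus> c = s" using s cR by (simp add: a_assoc l_neg)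
    ultimately show False using Cons.prems(3) by simp
  qed
  have s'm: "smul e ?s ?k ?m = g"
  proof -
    let ?a = "smul e c ?k ?m"
    have a: "?a \<in> Hom C X (ShO_pow C (?k + e) X)" using smul_Hom[OF cR h(1)] .
    have "smul e ?s ?k ?m = Add C (Add C ?a g) (neg C ?a)"
      using smul_add_left[OF s _ h(1), of "\<ominus> c" e] smul_minus[OF cR h(1)] c(1) cR by simp
    also have "\<dots> = g"
      using Add_commute[OF a gH] Add_assoc[OF gH a neg_Hom[OF a]]
          by (simp add: Add_neg[OF a] Add_Zer[OF gH])
    finally show ?thesis .
  qed
  \<comment> \<open>The factor \<open>s\<close> expresses \<open>m\<close> through the full list;
    the factor \<open>?s\<close> then replaces the eliminated generator by \<open>g\<close>, which
    involves only the rest.\<close>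
  have "smul (e + e) (?s \<otimes> s) k m \<in> span Q ms (k + (e + e))" if km: "(k, m) \<in> set ms" for k m
  proof -
    have m: "m \<in> Hom C X (ShO_pow C k X)" using h(2) km by (auto simp: homogeneous_list_def)
    have "smul e s k m \<in> span Q (km # ms) (k + e)" using Cons.prems(4)[of k m] km by simp
    then obtain d f where d: "smul e s k m = Add C (smul (k + e - ?k) d ?k ?m) f" "d \<in> Q"
        "d \<in> G (k + e - ?k)" "f \<in> span Q ms (k + e)"
      by auto
    obtain d' where d': "d' \<in> G (k + e - ?k)" "d' \<in> Q" "?s \<otimes> d = d' \<otimes> ?s"
      using smul_swap[OF d(3) s', of Q] Q.ideal_axioms d(2) by blast
    have "smul (e + e) (?s \<otimes> s) k m = smul e ?s (k + e) (smul e s k m)"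
      by (rule smul_mult[OF s' Cons.prems(2) m])
    also have "\<dots> = Add C (smul e ?s (k + e) (smul (k + e - ?k) d ?k ?m)) (smul e ?s (k + e) f)"
      unfolding d(1) by (rule smul_add_right[OF G_carrier[OF s'] smul_Hom'[OF d(3) h(1)] span_Hom[OF
          h(2) d(4)]])
    also have "smul e ?s (k + e) (smul (k + e - ?k) d ?k ?m)
        = smul (e + (k + e - ?k)) (?s \<otimes> d) ?k ?m"
      using smul_mult[OF s' d(3) h(1)] by simp
    also have "\<dots> = smul (k + e - ?k) d' (?k + e) g"
      unfolding d'(3) using smul_mult[OF d'(1) s' h(1)] s'm by (simp add: algebra_simps)
    finally have eq: "smul (e + e) (?s \<otimes> s) k m
        = Add C (smul (k + e - ?k) d' (?k + e) g) (smul e ?s (k + e) f)" .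
    have "smul (k + e - ?k) d' (?k + e) g \<in> span Q ms (?k + e + (k + e - ?k))"
      using d' c(4) h(2) by (intro span_smul[of _ _ Q Q]) (auto simp: Q.I_l_closed)
    moreover have "smul e ?s (k + e) f \<in> span Q ms (k + e + e)"
      using s' d(4) h(2) G_carrier[OF s'] by (intro span_smul[of _ _ Q Q]) (auto simp: Q.I_l_closed)
    ultimately show ?thesis
      unfolding eq using span_Add[of Q ms] Q.ideal_axioms h(2) by (simp add: algebra_simps)
  qed
  moreover have "?s \<otimes> s \<in> G (e + e)" "?s \<otimes> s \<notin> Q"
    using denominators_mult[OF Q s' Cons.prems(2)] \<open>?s \<notin> Q\<close> Cons.prems(3) by auto
  ultimately obtain d t where t: "t \<in> G d" "t \<notin> Q"
    "\<And>k m. (k, m) \<in> set ms \<Longrightarrow> smul d t k m = Zer C X (ShO_pow C (k + d) X)"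
    using Cons.IH[OF h(2)] by blast
  \<comment> \<open>\<open>t\<close> kills the rest and hence \<open>g\<close>, so
    \<open>t \<otimes> ?s\<close> kills \<open>?m\<close>. On the other generators \<open>t\<close>
    has to act first, whence the swap.\<close>
  obtain t' where t': "t' \<in> G e" "t \<otimes> ?s = t' \<otimes> t"
    using smul_swap[OF s' t(1), of "carrier R"] G_carrier[OF s'] by blast
  have "smul (d + e) (t \<otimes> ?s) k m = Zer C X (ShO_pow C (k + (d + e)) X)" if "(k, m) \<in> set (km # ms)"
      for k m
  proof (cases "(k, m) = km")
    case True
    then have "smul (d + e) (t \<otimes> ?s) k m = smul d t (k + e) g"
      using smul_mult[OF t(1) s' h(1)] s'm by auto
    also have "\<dots> = Zer C X (ShO_pow C (k + e + d) X)"
      using span_killed[OF t(1) h(2) t(3)] c(4) True by auto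
    finally show ?thesis by (simp add: algebra_simps)
  next
    case False
    then have km: "(k, m) \<in> set ms" using that by auto
    have m: "m \<in> Hom C X (ShO_pow C k X)" using h(2) km by (auto simp: homogeneous_list_def)
    have "smul (d + e) (t \<otimes> ?s) k m = smul e t' (k + d) (smul d t k m)"
      unfolding t'(2) using smul_mult[OF t'(1) t(1) m] by (simp add: add.commute)
    also have "\<dots> = Zer C X (ShO_pow C (k + d + e) X)"
      unfolding t(3)[OF km] by (rule smul_Zer[OF G_carrier[OF t'(1)]])
    finally show ?thesis by (simp add: algebra_simps)
  qed
  moreover have "t \<otimes> ?s \<in> G (d + e)" "t \<otimes> ?s \<notin> Q"
    using denominators_mult[OF Q t(1) s' t(2)] \<open>?s \<notin> Q\<close> by auto
  ultimately show ?case by blast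
qed

text \<open>On homogeneous elements the component is the element itself or zero; the rest is
  additivity.\<close>

lemma act_component: "r \<in> carrier R \<Longrightarrow> \<phi> r n X = \<phi> (component r n) n X"
proof (induction r rule: homogeneous_induct)
  case (homogeneous d y)
  then show ?case
    using action_degree[OF homogeneous _ X] action_degree[OF G_zero[of "n + 1"] _ X, of n]
    by (auto simp: component_homogeneous)
next
  case (add y z)
  then show ?case
    using act_add[OF _ _ X] component_add component_carrier by simp
qed

lemma End_star_abelian: "abelian_group (End_star C \<phi> X)"
proof (rule abelian_groupI, unfold End_star_simps)
  let ?Z = "\<lambda>n. Zer C X (ShO_pow C n X)"
  let ?M = "{f. (\<forall>n. f n \<in> Hom C X (ShO_pow C n X)) \<and> finite {n. f n \<noteq> ?Z n}}"
  have O: "ShO_pow C n X \<in> Obj C" for n using X by simp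
  show "?Z \<in> ?M" using X O Zer_Hom by auto
  fix f assume f: "f \<in> ?M"
  show "(\<lambda>n. Add C (?Z n) (f n)) = f" using f by (auto simp: Add_Zer)
  have "{n. neg C (f n) \<noteq> ?Z n} \<subseteq> {n. f n \<noteq> ?Z n}" using X O by auto
  then have "(\<lambda>n. neg C (f n)) \<in> ?M" using f neg_Hom finite_subset by auto
  moreover have "(\<lambda>n. Add C (neg C (f n)) (f n)) = ?Z" using f by (auto simp: Add_neg)
  ultimately show "\<exists>g\<in>?M. (\<lambda>n. Add C (g n) (f n)) = ?Z"
    by (intro bexI[of _ "\<lambda>n. neg C (f n)"])
  fix g assume g: "g \<in> ?M"
  have "{n. Add C (f n) (g n) \<noteq> ?Z n} \<subseteq> {n. f n \<noteq> ?Z n} \<union> {n. g n \<noteq> ?Z n}"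
    using X O by (auto simp: Add_Zer[OF Zer_Hom])
  then show "(\<lambda>n. Add C (f n) (g n)) \<in> ?M"
    using f g Add_Hom finite_subset[OF _ finite_UnI] by auto
  show "(\<lambda>n. Add C (f n) (g n)) = (\<lambda>n. Add C (g n) (f n))"
    using f g Add_commute by blast
  fix h assume h: "h \<in> ?M"
  show "(\<lambda>n. Add C (Add C (f n) (g n)) (h n)) = (\<lambda>n. Add C (f n) (Add C (g n) (h n)))"
    using f g h Add_assoc by blast
qed

text \<open>A degree in which the product is nonzero is the sum of a degree from the support of the
  action and one from the support of \<open>f\<close>; there are finitely many such sums.\<close>

lemma End_star_smult_closed:
  assumes r: "r \<in> carrier R" and f: "f \<in> carrier (End_star C \<phi> X)"
  shows "r \<odot>\<^bsub>End_star C \<phi> X\<^esub> f \<in> carrier (End_star C \<phi> X)"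
proof -
  let ?S = "{j. f j \<noteq> Zer C X (ShO_pow C j X)}"
  let ?N = "{n. \<exists>X\<in>Obj C. \<phi> r n X \<noteq> Zer C X (ShO_pow C n X)}"
  let ?t = "\<lambda>k j. ShA_pow C j (\<phi> r (k - j) X) \<cdot>\<^bsub>C\<^esub> f j"
  have fH: "f j \<in> Hom C X (ShO_pow C j X)" and S: "finite ?S" for j using f
      by (simp_all add: End_star_simps)
  have t: "?t k j \<in> Hom C X (ShO_pow C k X)" for k j
    using fH[of j] r X by (simp add: Hom_iff ShO_pow_add)
  have H: "graded_cmp C X (\<lambda>n. \<phi> r n X) f k \<in> Hom C X (ShO_pow C k X)" for k
  proof -
    interpret H: abelian_group "hom_group C X (ShO_pow C k X)" using hom_abelian_group X by simp
    show ?thesis unfolding graded_cmp_def using H.finsum_closed[of "?t k" ?S] t by auto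
  qed
  have "graded_cmp C X (\<lambda>n. \<phi> r n X) f k = Zer C X (ShO_pow C k X)"
    if "k \<notin> (\<lambda>(n, j). n + j) ` (?N \<times> ?S)" for k
  proof -
    interpret H: abelian_group "hom_group C X (ShO_pow C k X)" using hom_abelian_group X by simp
    have "?t k j = Zer C X (ShO_pow C k X)" if "j \<in> ?S" for j
    proof -
      have "k - j \<notin> ?N" using \<open>k \<notin> _\<close> that by force
      then have "\<phi> r (k - j) X = Zer C X (ShO_pow C (k - j) X)" using X by blast
      then show ?thesis using fH[of j] X by (simp add: Hom_iff ShO_pow_add)
    qed
    then have "(\<Oplus>\<^bsub>hom_group C X (ShO_pow C k X)\<^esub>j\<in>?S. ?t k j)
        = (\<Oplus>\<^bsub>hom_group C X (ShO_pow C k X)\<^esub>j\<in>?S. \<zero>\<^bsub>hom_group C X (ShO_pow C k X)\<^esub>)"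
      by (intro H.finsum_cong') (use H.zero_closed in \<open>auto simp del: H.zero_closed\<close>)
    then show ?thesis unfolding graded_cmp_def using H.finsum_zero by simp
  qed
  then have "{k. graded_cmp C X (\<lambda>n. \<phi> r n X) f k \<noteq> Zer C X (ShO_pow C k X)}
      \<subseteq> (\<lambda>(n, j). n + j) ` (?N \<times> ?S)"
    by blast
  then have "finite {k. graded_cmp C X (\<lambda>n. \<phi> r n X) f k \<noteq> Zer C X (ShO_pow C k X)}"
    using finite_subset S act_finite[OF r] by blast
  then show ?thesis using H by (simp add: End_star_simps)
qed

text \<open>The components of finitely many generators still generate, now degree by degree and with
  homogeneous coefficients of the complementary degree.\<close>

lemma End_star_homogeneous_generators:
  assumes fg: "fin_gen_module R (End_star C \<phi> X)"
  shows "\<exists>ms. homogeneous_list ms \<and> (\<forall>n. Hom C X (ShO_pow C n X) \<subseteq> span (carrier R) ms n)"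
proof -
  let ?M = "End_star C \<phi> X"
  interpret M: abelian_group ?M by (rule End_star_abelian)
  obtain A where A: "finite A" "A \<subseteq> carrier ?M"
    and gen: "\<And>x. x \<in> carrier ?M \<Longrightarrow> \<exists>c\<in>A \<rightarrow> carrier R. x = (\<Oplus>\<^bsub>?M\<^esub>a\<in>A. c a \<odot>\<^bsub>?M\<^esub> a)"
    using fg unfolding fin_gen_module_def by blast
  define D where "D = (\<Union>a\<in>A. (\<lambda>j. (j, a j)) ` {j. a j \<noteq> Zer C X (ShO_pow C j X)})"
  have "finite D" using A by (auto simp: D_def End_star_simps)
  then obtain ms where ms: "set ms = D" using finite_list by blast
  have hl: "homogeneous_list ms"
    using A by (auto simp: homogeneous_list_def ms D_def End_star_simps)
  have 0: "Zer C X (ShO_pow C n X) \<in> span (carrier R) ms n" for n using span_Zer[OF hl] by simp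
  have sm: "(c \<odot>\<^bsub>?M\<^esub> a) n \<in> span (carrier R) ms n" if c: "c \<in> carrier R" and a: "a \<in> A" for c a n
  proof -
    interpret H: abelian_group "hom_group C X (ShO_pow C n X)" using hom_abelian_group X by simp
    let ?t = "\<lambda>j. ShA_pow C j (\<phi> c (n - j) X) \<cdot>\<^bsub>C\<^esub> a j"
    have aH: "a j \<in> Hom C X (ShO_pow C j X)" for j using a A by (auto simp: End_star_simps)
    have tH: "?t j \<in> Hom C X (ShO_pow C n X)" for j
      using aH[of j] c X by (simp add: Hom_iff ShO_pow_add)
    have t: "?t j \<in> span (carrier R) ms n" if "a j \<noteq> Zer C X (ShO_pow C j X)" for j
    proof -
      have "?t j = smul (n - j) (component c (n - j)) j (a j)"
        unfolding smul_def act_component[OF c] ..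
      moreover have "(j, a j) \<in> set ms" using that a by (auto simp: ms D_def)
      ultimately show ?thesis
        using span_member[OF _ hl] component_spec(1)[OF c] component_carrier[OF c] by metis
    qed
    have "(\<Oplus>\<^bsub>hom_group C X (ShO_pow C n X)\<^esub>j\<in>B. ?t j) \<in> span (carrier R) ms n"
      if "finite B" "B \<subseteq> {j. a j \<noteq> Zer C X (ShO_pow C j X)}" for B
      using that
    proof (induction B rule: finite_induct)
      case empty
      then show ?case using 0 H.finsum_empty by simp
    next
      case (insert j B)
      then show ?case
        using H.finsum_insert[of B j ?t] tH t[of j] span_Add[OF _ hl, of "carrier R"] by auto
    qed
    then show ?thesis using a A by (auto simp: End_star_simps graded_cmp_def)
  qed
  have "f \<in> span (carrier R) ms n" if f: "f \<in> Hom C X (ShO_pow C n X)" for f n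
  proof -
    \<comment> \<open>A single arrow becomes an element of the module by placing it in degree
      \<open>n\<close>.\<close>
    let ?F = "\<lambda>k. if k = n then f else Zer C X (ShO_pow C k X)"
    have "finite {k. ?F k \<noteq> Zer C X (ShO_pow C k X)}" by (rule finite_subset[of _ "{n}"]) auto
    then have "?F \<in> carrier ?M" using f X Zer_Hom by (auto simp: End_star_simps)
    then obtain c where c: "c \<in> A \<rightarrow> carrier R" "?F = (\<Oplus>\<^bsub>?M\<^esub>a\<in>A. c a \<odot>\<^bsub>?M\<^esub> a)"
      using gen by blast
    have "(\<Oplus>\<^bsub>?M\<^esub>a\<in>B. c a \<odot>\<^bsub>?M\<^esub> a) n \<in> span (carrier R) ms n" if "finite B" "B \<subseteq> A" for B
      using that
    proof (induction B rule: finite_induct)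
      case empty
      then show ?case using 0 by (simp add: End_star_simps)
    next
      case (insert b B)
      have cl: "c a \<odot>\<^bsub>?M\<^esub> a \<in> carrier ?M" if "a \<in> A" for a
        using End_star_smult_closed c(1) that A by blast
      have "(\<Oplus>\<^bsub>?M\<^esub>a\<in>insert b B. c a \<odot>\<^bsub>?M\<^esub> a) = (c b \<odot>\<^bsub>?M\<^esub> b) \<oplus>\<^bsub>?M\<^esub> (\<Oplus>\<^bsub>?M\<^esub>a\<in>B. c a \<odot>\<^bsub>?M\<^esub> a)"
        using insert cl by (intro M.finsum_insert) auto
      moreover have "(c b \<odot>\<^bsub>?M\<^esub> b) n \<in> span (carrier R) ms n" using sm c(1) insert by blast
      ultimately show ?case
        using insert span_Add[OF _ hl, of "carrier R"] by (simp add: End_star_simps)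
    qed
    from this[OF A(1) order.refl] show ?thesis unfolding c(2)[symmetric] by simp
  qed
  then show ?thesis using hl by blast
qed

text \<open>If \<open>s\<close> kills the cone of \<open>r\<close>, then \<open>s\<close> times the endomorphism module is contained in \<open>r\<close> times it.\<close>

lemma nakayama_cone:
  assumes fg: "fin_gen_module R (End_star C \<phi> X)" and Q: "Q \<in> Spec R G" and r: "r \<in> G d" "r \<in> Q"
    and T: "(\<phi> r d X, g, h) \<in> Tri C" and K: "Cod C g \<in> kernel (- Q)"
  shows "X \<in> kernel (- Q)"
proof -
  note T' = TriD[OF T]
  interpret Q: ideal Q R using Spec_ideal[OF Q] .
  have rR: "r \<in> carrier R" using r G_carrier by blast
  obtain e s where s: "s \<in> G e" "s \<notin> Q" "kills e s (Cod C g)" using K by (auto simp: kernel_def)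
  have sR: "s \<in> carrier R" using s G_carrier by blast
  obtain ms where hl: "homogeneous_list ms" and gen:
      "\<And>n. Hom C X (ShO_pow C n X) \<subseteq> span (carrier R) ms n"
    using End_star_homogeneous_generators[OF fg] by blast
  have "smul e s n m \<in> span Q ms (n + e)" if m: "m \<in> Hom C X (ShO_pow C n X)" for n m
  proof -
    let ?Y = "ShO_pow C d X"
    \<comment> \<open>The shift moves the target of \<open>m\<close> to the target of the action of
      \<open>r\<close>, where the triangle can be used.\<close>
    let ?m = "ShA_pow C (d - n) m"
    have m': "?m \<in> Hom C (ShO_pow C (d - n) X) ?Y"
      using ShA_pow_Hom[OF m, of "d - n"] X by (simp add: ShO_pow_add)
    have YO: "?Y \<in> Obj C" using X by simp
    have gH: "g \<in> Hom C ?Y (Cod C g)" using T' rR X by (simp add: Hom_iff)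
    let ?b = "\<phi> s e ?Y \<cdot>\<^bsub>C\<^esub> ?m"
    have b: "?b \<in> Hom C (ShO_pow C (d - n) X) (ShO_pow C e ?Y)"
      using Cmp_Hom[OF m' action_Hom[OF sR YO]] .
    have "ShA_pow C e g \<cdot>\<^bsub>C\<^esub> ?b = \<phi> s e (Cod C g) \<cdot>\<^bsub>C\<^esub> (g \<cdot>\<^bsub>C\<^esub> ?m)"
      using act_Cmp[OF sR gH, of e] m' gH sR YO
        Cmp_assoc_Arr[of ?m "\<phi> s e ?Y" "ShA_pow C e g"] Cmp_assoc_Arr[of ?m g "\<phi> s e (Cod C g)"]
      by (simp add: Hom_iff)
    also have "\<dots> = Zer C (ShO_pow C (d - n) X) (ShO_pow C e (Cod C g))"
      using s(3) m' gH T' X by (simp add: kills_def Hom_iff)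
    finally have z: "ShA_pow C e g \<cdot>\<^bsub>C\<^esub> ?b = Zer C (ShO_pow C (d - n) X) (ShO_pow C e (Cod C g))" .
    \<comment> \<open>Shifting back by \<open>e\<close> shows that \<open>g\<close> annihilates
      \<open>?a\<close>, so \<open>?a\<close> lifts through the action of \<open>r\<close>.\<close>
    let ?a = "ShA_pow C (- e) ?b"
    have a: "?a \<in> Hom C (ShO_pow C (d - n - e) X) ?Y"
      using ShA_pow_Hom[OF b, of "- e"] X by (simp add: ShO_pow_add algebra_simps)
    have "ShA_pow C (- e) (ShA_pow C e g \<cdot>\<^bsub>C\<^esub> ?b) = g \<cdot>\<^bsub>C\<^esub> ?a"
      using b gH ShA_pow_Cmp[of ?b "ShA_pow C e g" "- e"] by (simp add: Hom_iff ShA_pow_add)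
    then have "g \<cdot>\<^bsub>C\<^esub> ?a = Zer C (ShO_pow C (d - n - e) X) (Cod C g)"
      unfolding z using X T' by (simp add: ShO_pow_add algebra_simps)
    then obtain k where k: "k \<in> Hom C (ShO_pow C (d - n - e) X) X" "\<phi> r d X \<cdot>\<^bsub>C\<^esub> k = ?a"
      using Tri_lift[OF T, of ?a "ShO_pow C (d - n - e) X"] a rR X by auto
    let ?k = "ShA_pow C (n + e - d) k"
    have k': "?k \<in> Hom C X (ShO_pow C (n + e - d) X)"
      using ShA_pow_Hom[OF k(1), of "n + e - d"] X by (simp add: ShO_pow_add)
    have "smul d r (n + e - d) ?k = ShA_pow C (n + e - d) ?a"
      unfolding smul_def k(2)[symmetric] using k(1) rR X ShA_pow_Cmp[of k "\<phi> r d X" "n + e - d"]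
      by (simp add: Hom_iff)
    also have "\<dots> = ShA_pow C (n - d) ?b"
      using b ShA_pow_add[of ?b "n + e - d" "- e"] by (simp add: Hom_iff)
    also have "\<dots> = ShA_pow C (n - d) (\<phi> s e ?Y) \<cdot>\<^bsub>C\<^esub> m"
      using ShA_pow_Cmp[of ?m "\<phi> s e ?Y" "n - d"] m m' sR YO ShA_pow_add[of m "n - d" "d - n"]
      by (simp add: Hom_iff)
    finally have rk: "smul d r (n + e - d) ?k = ShA_pow C (n - d) (\<phi> s e ?Y) \<cdot>\<^bsub>C\<^esub> m" .
    have pm: "smul d r (n + e - d) ?k = smul e s n m \<or> smul d r (n + e - d) ?k
        = neg C (smul e s n m)"
    proof -
      have eq: "ShA_pow C (n - d) (ShA_pow C d (\<phi> s e X)) = ShA_pow C n (\<phi> s e X)"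
        using sR X by (simp add: ShA_pow_add)
      have "ShA_pow C (n - d) (\<phi> s e ?Y) = ShA_pow C n (\<phi> s e X) \<or>
          ShA_pow C (n - d) (\<phi> s e ?Y) = neg C (ShA_pow C n (\<phi> s e X))"
        using act_ShO_pow[OF sR X, of e d] eq ShA_pow_neg[of "ShA_pow C d (\<phi> s e X)" "n - d"] sR X
            by auto
      then show ?thesis unfolding rk unfolding smul_def using m sR X by (auto simp: Hom_iff)
    qed
    have "smul d r (n + e - d) ?k \<in> span Q ms (n + e - d + d)"
      using gen[of "n + e - d"] k' r hl by (intro span_smul[of _ _ "carrier R"]) (auto simp:
          Q.I_r_closed)
    then have S: "smul d r (n + e - d) ?k \<in> span Q ms (n + e)" by simp
    show ?thesis
      using pm
    proof
      assume "smul d r (n + e - d) ?k = smul e s n m"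
      then show ?thesis using S by simp
    next
      assume n: "smul d r (n + e - d) ?k = neg C (smul e s n m)"
      have sm: "smul e s n m \<in> Hom C X (ShO_pow C (n + e) X)" using smul_Hom[OF sR m] .
      \<comment> \<open>The possible sign is removed by acting with minus one, which has degree 0
        and preserves the span.\<close>
      have "smul 0 (\<ominus> \<one>) (n + e) (neg C (smul e s n m)) = smul e s n m"
        using smul_minus[OF one_closed neg_Hom[OF sm], of 0] smul_one[OF neg_Hom[OF sm]] sm
        by (simp add: Hom_iff)
      moreover have "smul 0 (\<ominus> \<one>) (n + e) (neg C (smul e s n m)) \<in> span Q ms (n + e + 0)"
        using S hl unfolding n by (intro span_smul[of _ _ Q Q]) (auto simp: homogeneous_one G_minus
            Q.I_l_closed)
      ultimately show ?thesis by simp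
    qed
  qed
  then obtain c t where t: "t \<in> G c" "t \<notin> Q" "\<And>k m. (k, m) \<in> set ms \<Longrightarrow> smul c t k m
      = Zer C X (ShO_pow C (k + c) X)"
    using graded_nakayama[OF Q hl s(1,2)] hl unfolding homogeneous_list_def by blast
  \<comment> \<open>An element that kills the identity of \<open>X\<close> kills \<open>X\<close>,
    and the identity is a combination of the generators in degree 0.\<close>
  have "Ide C X \<in> span (carrier R) ms 0" using gen[of 0] Ide_Hom[OF X] by auto
  then have "smul c t 0 (Ide C X) = Zer C X (ShO_pow C c X)"
    using span_killed[OF t(1) hl t(3)] by fastforce
  then have "kills c t X" using X G_carrier[OF t(1)] by (simp add: smul_def kills_def)
  then show ?thesis using t X by (auto simp: kernel_def)
qed

end

end

section \<open>Local categories and support\<close>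

lemma cone_Tri:
  assumes "\<exists>g h. (f, g, h) \<in> Tri C"
  obtains g h where "(f, g, h) \<in> Tri C" "cone C f = Cod C g"
proof -
  have "\<exists>Z g h. (f, g, h) \<in> Tri C \<and> Z = Cod C g" using assms by blast
  from someI_ex[OF this] show ?thesis using that unfolding cone_def by blast
qed

context linear_triangulated_category
begin

lemma thick_subcategoryI: "thick C S \<Longrightarrow> thick_subcategory C S"
  by (intro thick_subcategory.intro triangulated_category_axioms thick_subcategory_axioms.intro)

lemma graded_action_quotient:
  assumes S: "thick C S"
  shows "graded_action R G (verdier C S) (quotient_action C S \<phi>)"
proof -
  interpret V: thick_subcategory C S by (rule thick_subcategoryI[OF S])
  have act: "quotient_action C S \<phi> r n X = quotient_arr C S (\<phi> r n X)" if "X \<in> Obj C" for r n X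
    using that by (simp add: quotient_action_def)
  have Obj: "X \<in> Obj C" if "X \<in> Obj (verdier C S)" for X using that by simp
  show ?thesis
  proof (intro graded_action.intro graded_commutative_ring_axioms V.shift_category_quotient
      graded_action_axioms.intro)
    fix r :: 'r and X n
    assume r: "r \<in> carrier R" and "X \<in> Obj (verdier C S)"
    then have X: "X \<in> Obj C" by (rule_tac Obj)
    show "quotient_action C S \<phi> r n X \<in> Hom (verdier C S) X (ShO_pow (verdier C S) n X)"
      unfolding act[OF X] V.ShO_pow_quotient by (rule V.quotient_Hom[OF action_Hom[OF r X]])
  next
    fix r :: 'r and d n :: int and X
    assume r: "r \<in> G d" "n \<noteq> d" and "X \<in> Obj (verdier C S)"
    then have X: "X \<in> Obj C" by (rule_tac Obj)
    show "quotient_action C S \<phi> r n X = Zer (verdier C S) X (ShO_pow (verdier C S) n X)"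
      unfolding act[OF X] V.ShO_pow_quotient action_degree[OF r X] V.verdier_simps ..
  next
    fix r s :: 'r and d e :: int and X
    assume r: "r \<in> G d" and s: "s \<in> G e" and "X \<in> Obj (verdier C S)"
    then have X: "X \<in> Obj C" by (rule_tac Obj)
    have c: "r \<in> carrier R" "s \<in> carrier R" using r s G_carrier by blast+
    show "quotient_action C S \<phi> (r \<otimes> s) (d + e) X =
        ShA_pow (verdier C S) e (quotient_action C S \<phi> r d X) \<cdot>\<^bsub>verdier C S\<^esub> quotient_action C S \<phi> s
            e X"
      unfolding act[OF X] act_mult[OF r s X] V.ShA_pow_quotient[OF act_typed(1)[OF c(1) X]]
      by (rule V.quotient_Cmp) (use c X in \<open>auto simp: ShO_pow_add add.commute\<close>)
  qed
qed

text \<open>Multiplication in the centre uses the shifted action of \<open>t\<close>, whereas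
  \<open>local_zero_arrow\<close> will produce its action on the shifted object; the sign between
  them does not affect vanishing.\<close>

lemma act_twice:
  assumes t: "t \<in> G e" and s: "s \<in> G d" and X: "X \<in> Obj C"
  shows "\<phi> t e (ShO_pow C d X) \<cdot>\<^bsub>C\<^esub> \<phi> s d X = Zer C X (ShO_pow C e (ShO_pow C d X))
      \<longleftrightarrow> kills (e + d) (t \<otimes> s) X"
proof -
  have c: "s \<in> carrier R" "t \<in> carrier R" using s t G_carrier by blast+
  let ?b = "ShA_pow C d (\<phi> t e X) \<cdot>\<^bsub>C\<^esub> \<phi> s d X"
  have b: "?b \<in> Arr C" using c X by simp
  have O: "ShO_pow C (e + d) X \<in> Obj C" using X by simp
  have "\<phi> t e (ShO_pow C d X) \<cdot>\<^bsub>C\<^esub> \<phi> s d X = ?b \<or> \<phi> t e (ShO_pow C d X) \<cdot>\<^bsub>C\<^esub> \<phi> s d X = neg C ?b"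
    using act_ShO_pow[OF c(2) X, of e d] c X by auto
  moreover have "neg C ?b = Zer C X (ShO_pow C (e + d) X) \<longleftrightarrow> ?b = Zer C X (ShO_pow C (e + d) X)"
    using neg_inject[of ?b "Zer C X (ShO_pow C (e + d) X)"] neg_Zer[OF X O] b X O by auto
  ultimately show ?thesis
    unfolding kills_def act_mult[OF t s X] using X by (auto simp: ShO_pow_add)
qed

text \<open>By naturality, \<open>r\<close> acting after \<open>g\<close> is up to sign a shift of
  the zero composite \<open>g \<cdot> \<phi> r d X\<close>, and similarly for \<open>h\<close>. So
  \<open>r\<close> annihilates both arrows, and \<open>kills_cone\<close> needs one factor
  \<open>r\<close> for each.\<close>

lemma act_cone_killed:
  assumes r: "r \<in> G d" and X: "X \<in> Obj C" and T: "(\<phi> r d X, g, h) \<in> Tri C"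
  shows "kills (d + d) (r \<otimes> r) (Cod C g)"
proof -
  have c: "r \<in> carrier R" using r G_carrier by blast
  note T' = TriD[OF T]
  let ?f = "\<phi> r d X" and ?Y = "ShO_pow C d X"
  have D: "Dom C g = ?Y" "Cod C h = ShO C X" using T' c X by auto
  have gH: "g \<in> Hom C ?Y (Cod C g)" using T' D by (simp add: Hom_iff)
  have YO: "?Y \<in> Obj C" using X by simp
  have gf: "g \<cdot>\<^bsub>C\<^esub> ?f = Zer C X (Cod C g)" using Tri_Cmp_Zer[OF T] c X by simp
  have "ShA_pow C d g \<cdot>\<^bsub>C\<^esub> ShA_pow C d ?f = Zer C ?Y (ShO_pow C d (Cod C g))"
    using ShA_pow_Cmp[of ?f g d] gf T' c X D by simp
  then have 1: "\<phi> r d (Cod C g) \<cdot>\<^bsub>C\<^esub> g = Zer C (Cod C ?f) (ShO_pow C d (Cod C g))"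
    unfolding act_Cmp[OF c gH] using act_ShO_pow[OF c X, of d d] T' c X D by auto
  have "neg C (ShA C ?f) \<cdot>\<^bsub>C\<^esub> h = Zer C (Cod C g) (ShO C ?Y)"
    using Tri_Cmp_Zer'[OF Tri_rot[OF T]] T' c X by simp
  then have "ShA C ?f \<cdot>\<^bsub>C\<^esub> h = Zer C (Cod C g) (ShO C ?Y)"
    using neg_inject[of "ShA C ?f \<cdot>\<^bsub>C\<^esub> h" "Zer C (Cod C g) (ShO C ?Y)"] T' c X by simp
  moreover have "ShO_pow C d (ShO C X) = ShO C ?Y" using X by (simp add: ShO_pow_ShO ShO_ShO_pow)
  ultimately have 2: "\<phi> r d (ShO C (Dom C ?f)) \<cdot>\<^bsub>C\<^esub> h
      = Zer C (Cod C g) (ShO_pow C d (ShO C (Dom C ?f)))"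
    using act_ShO[OF c X, of d] T' c X D by auto
  show ?thesis by (rule kills_cone[OF T r r 1 2])
qed

text \<open>The square of \<open>s\<close> kills the cone and is still outside the prime.\<close>

lemma act_weak_eq:
  assumes P: "P \<in> Spec R G" and s: "s \<in> G d" "s \<notin> P" and X: "X \<in> Obj C"
  shows "\<phi> s d X \<in> weak_eq C (kernel (- P))"
proof -
  have "\<phi> s d X \<in> Arr C" using s X G_carrier by simp
  then obtain g h where T: "(\<phi> s d X, g, h) \<in> Tri C" using Tri_exists by blast
  have "Cod C g \<in> kernel (- P)"
    using act_cone_killed[OF s(1) X T] denominators_mult[OF P s(1) s(1) s(2) s(2)] TriD[OF T]
    by (auto simp: kernel_def)
  then show ?thesis using T unfolding weak_eq_def by blast
qed

text \<open>If an arrow of \<open>V.W\<close> is annihilated by \<open>f\<close>, then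
  \<open>f\<close> factors through its cone, which some \<open>s\<close> outside \<open>P\<close>
  kills; conversely the action of such an \<open>s\<close> becomes invertible. From here on no roofs
  have to be handled.\<close>

lemma local_zero_arrow:
  assumes P: "P \<in> Spec R G" and f: "f \<in> Hom C X Y"
  shows "quotient_arr C (kernel (- P)) f = Zer (verdier C (kernel (- P))) X Y \<longleftrightarrow>
    (\<exists>d. \<exists>s\<in>G d. s \<notin> P \<and> \<phi> s d Y \<cdot>\<^bsub>C\<^esub> f = Zer C X (ShO_pow C d Y))"
proof
  interpret V: thick_subcategory C "kernel (- P)"
      by (rule thick_subcategoryI[OF thick_local_kernel[OF P]])
  note XY = Hom_Obj[OF f]
  {
    assume "V.q f = Zer V.Q X Y"
    then obtain u where u: "u \<in> V.W" "Cod C u = X" "f \<cdot>\<^bsub>C\<^esub> u = Zer C (Dom C u) Y"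
      using V.quotient_eq_Zer[OF f] by blast
    obtain c h where T: "(u, c, h) \<in> Tri C" "Cod C c \<in> kernel (- P)"
      using u(1) unfolding weak_eq_def by blast
    note T' = TriD[OF T(1)]
    obtain k where k: "k \<in> Hom C (Cod C c) Y" "k \<cdot>\<^bsub>C\<^esub> c = f"
      using Tri_extend[OF T(1), of f Y] f u by auto
    obtain d s where s: "s \<in> G d" "s \<notin> P" "kills d s (Cod C c)" using T(2)
        by (auto simp: kernel_def)
    have "c \<in> Hom C X (Cod C c)" using T' u by (simp add: Hom_iff)
    then have "\<phi> s d Y \<cdot>\<^bsub>C\<^esub> f = Zer C X (ShO_pow C d Y)"
      using kills_factor[OF G_carrier[OF s(1)] _ k(1) s(3)] k(2) by metis
    then show "\<exists>d. \<exists>s\<in>G d. s \<notin> P \<and> \<phi> s d Y \<cdot>\<^bsub>C\<^esub> f = Zer C X (ShO_pow C d Y)" using s by blast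
  next
    assume "\<exists>d. \<exists>s\<in>G d. s \<notin> P \<and> \<phi> s d Y \<cdot>\<^bsub>C\<^esub> f = Zer C X (ShO_pow C d Y)"
    then obtain d s where s: "s \<in> G d" "s \<notin> P" "\<phi> s d Y \<cdot>\<^bsub>C\<^esub> f = Zer C X (ShO_pow C d Y)" by blast
    let ?a = "\<phi> s d Y"
    have c: "s \<in> carrier R" using s G_carrier by blast
    have a: "?a \<in> Arr C" "Dom C ?a = Y" "Cod C ?a = ShO_pow C d Y" using c XY by auto
    have fA: "f \<in> Arr C" "Dom C f = X" "Cod C f = Y" using f by (auto simp: Hom_iff)
    have zA: "Zer C X Y \<in> Arr C" "Dom C (Zer C X Y) = X" "Cod C (Zer C X Y) = Y" using XY by auto
    have iso: "is_iso V.Q (V.q ?a)" by (rule V.quotient_iso[OF act_weak_eq[OF P s(1,2) XY(2)]])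
    have eq: "?a \<cdot>\<^bsub>C\<^esub> f = ?a \<cdot>\<^bsub>C\<^esub> Zer C X Y" using s(3) a XY by simp
    have "V.q ?a \<cdot>\<^bsub>V.Q\<^esub> V.q f = V.q ?a \<cdot>\<^bsub>V.Q\<^esub> V.q (Zer C X Y)"
      using V.quotient_Cmp[of f ?a] V.quotient_Cmp[of "Zer C X Y" ?a] a fA zA eq by metis
    then have "V.q f = V.q (Zer C X Y)"
      using V.quotient.is_iso_left_cancel[OF iso] V.quotient_Dom_Cod[OF fA(1)] V.quotient_Dom_Cod[OF
          zA(1)]
        V.quotient_Dom_Cod[OF a(1)] fA zA a by metis
    then show "V.q f = Zer V.Q X Y" by simp
  }
qed

text \<open>If \<open>f\<close> becomes invertible, the other two arrows of its triangle become
  zero, so each is annihilated by an element outside \<open>P\<close>; \<open>kills_cone\<close>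
  combines these into one that kills the cone.\<close>

lemma local_iso_weak_eq:
  assumes P: "P \<in> Spec R G" and f: "f \<in> Arr C"
    and iso: "is_iso (verdier C (kernel (- P))) (quotient_arr C (kernel (- P)) f)"
  shows "f \<in> weak_eq C (kernel (- P))"
proof -
  interpret V: thick_subcategory C "kernel (- P)"
      by (rule thick_subcategoryI[OF thick_local_kernel[OF P]])
  obtain g h where T: "(f, g, h) \<in> Tri C" using Tri_exists f by blast
  note T' = TriD[OF T]
  let ?X = "Dom C f" and ?Y = "Cod C f" and ?Z = "Cod C g"
  have O: "?X \<in> Obj C" "?Y \<in> Obj C" "?Z \<in> Obj C" "ShO C ?X \<in> Obj C" "ShO C ?Y \<in> Obj C" using T'
      by auto
  have gH: "g \<in> Hom C ?Y ?Z" and hH: "h \<in> Hom C ?Z (ShO C ?X)" using T' by (auto simp: Hom_iff)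
  have "V.q g = V.q (Zer C ?Y ?Z)"
  proof (rule V.quotient.is_iso_right_cancel[OF iso])
    have "g \<cdot>\<^bsub>C\<^esub> f = Zer C ?Y ?Z \<cdot>\<^bsub>C\<^esub> f" using Tri_Cmp_Zer[OF T] T' O by simp
    then show "V.q g \<cdot>\<^bsub>V.Q\<^esub> V.q f = V.q (Zer C ?Y ?Z) \<cdot>\<^bsub>V.Q\<^esub> V.q f"
      using V.quotient_Cmp[of f g] V.quotient_Cmp[of f "Zer C ?Y ?Z"] T' O by simp
  qed (use V.quotient_Dom_Cod T' O in \<open>simp_all del: V.verdier_simps\<close>)
  then obtain d s where s: "s \<in> G d" "s \<notin> P" "\<phi> s d ?Z \<cdot>\<^bsub>C\<^esub> g = Zer C ?Y (ShO_pow C d ?Z)"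
    using local_zero_arrow[OF P gH] by auto
  have "ShA C f \<cdot>\<^bsub>C\<^esub> h = Zer C ?Z (ShO C ?Y)"
    using Tri_Cmp_Zer'[OF Tri_rot[OF T]] neg_inject[of "ShA C f \<cdot>\<^bsub>C\<^esub> h" "Zer C ?Z (ShO C ?Y)"] T' O
        by simp
  then have "ShA C f \<cdot>\<^bsub>C\<^esub> h = ShA C f \<cdot>\<^bsub>C\<^esub> Zer C ?Z (ShO C ?X)" using T' O by simp
  then have e: "V.q (ShA C f) \<cdot>\<^bsub>V.Q\<^esub> V.q h = V.q (ShA C f) \<cdot>\<^bsub>V.Q\<^esub> V.q (Zer C ?Z (ShO C ?X))"
    using V.quotient_Cmp[of h "ShA C f"] V.quotient_Cmp[of "Zer C ?Z (ShO C ?X)" "ShA C f"] T' O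
        by simp
  have iso': "is_iso V.Q (V.q (ShA C f))"
    using V.quotient.is_iso_ShA[OF iso] V.ShA_quotient[OF f] by metis
  have "V.q h = V.q (Zer C ?Z (ShO C ?X))"
    by (rule V.quotient.is_iso_left_cancel[OF iso' _ _ _ _ e])
      (use V.quotient_Dom_Cod T' O in \<open>simp_all del: V.verdier_simps\<close>)
  then obtain e t where t: "t \<in> G e" "t \<notin> P" "\<phi> t e (ShO C ?X) \<cdot>\<^bsub>C\<^esub> h
      = Zer C ?Z (ShO_pow C e (ShO C ?X))"
    using local_zero_arrow[OF P hH] by auto
  have "?Z \<in> kernel (- P)"
    using kills_cone[OF T s(1) t(1) s(3) t(3)] denominators_mult[OF P t(1) s(1) t(2) s(2)] O
    by (auto simp: kernel_def)
  then show ?thesis using T unfolding weak_eq_def by blast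
qed

text \<open>\<open>cone\<close> picks some triangle of the quotient on the image of the action of
  \<open>r\<close>. It is isomorphic to the image of a triangle of \<open>C\<close>, whose first
  arrow \<open>f0\<close> need not be the action itself. The comparison goes through invertibility
  in the quotient, and Nakayama's lemma returns from the cone in \<open>C\<close> to
  \<open>X\<close>.\<close>

lemma local_cone:
  assumes fg: "\<forall>X\<in>Obj C. fin_gen_module R (End_star C \<phi> X)"
    and P: "P \<in> Spec R G" and r: "r \<in> G d" "r \<in> P" and X: "X \<in> Obj C"
  shows "cone (local_cat R G C \<phi> P) (local_action R G C \<phi> P r d X) \<in> Obj C"
    and "cone (local_cat R G C \<phi> P) (local_action R G C \<phi> P r d X) \<in> kernel (- P)
        \<longleftrightarrow> X \<in> kernel (- P)"
proof -
  interpret V: thick_subcategory C "kernel (- P)"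
      by (rule thick_subcategoryI[OF thick_local_kernel[OF P]])
  let ?f = "\<phi> r d X"
  let ?Z = "cone (local_cat R G C \<phi> P) (local_action R G C \<phi> P r d X)"
  have c: "r \<in> carrier R" using r G_carrier by blast
  have f: "?f \<in> Arr C" "Dom C ?f = X" "Cod C ?f = ShO_pow C d X" using c X by auto
  have Z: "?Z = cone V.Q (V.q ?f)"
    unfolding local_cat_def local_action_def local_kernel_eq[OF P] quotient_action_def using X
        by simp
  obtain g1 h1 where T1: "(?f, g1, h1) \<in> Tri C" using Tri_exists f by blast
  obtain g' h' where T: "(V.q ?f, g', h') \<in> Tri V.Q" "?Z = Cod V.Q g'"
    using cone_Tri[of "V.q ?f" V.Q] V.Tri_quotient[OF T1] Z by metis
  obtain f0 g0 h0 where T0: "(f0, g0, h0) \<in> Tri C"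
      "tri_iso V.Q (V.q f0, V.q g0, V.q h0) (V.q ?f, g', h')"
    using T(1) unfolding V.Tri_quotient_iff by blast
  note T0' = TriD[OF T0(1)]
  obtain a b c where iso: "is_iso V.Q a" "is_iso V.Q b" "is_iso V.Q c"
    and H: "a \<in> Hom V.Q (Dom V.Q (V.q f0)) (Dom V.Q (V.q ?f))"
      "b \<in> Hom V.Q (Cod V.Q (V.q f0)) (Cod V.Q (V.q ?f))"
      "c \<in> Hom V.Q (Cod V.Q (V.q g0)) (Cod V.Q g')"
    and eq: "b \<cdot>\<^bsub>V.Q\<^esub> V.q f0 = V.q ?f \<cdot>\<^bsub>V.Q\<^esub> a"
    using T0(2) unfolding tri_iso_def prod.case by blast
  have a: "Dom V.Q a = Dom C f0" "Cod V.Q a = X"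
      and b: "Dom V.Q b = Cod C f0" "Cod V.Q b = ShO_pow C d X"
    and cc: "Dom V.Q c = Cod C g0" "Cod V.Q c = ?Z"
    using H V.quotient_Dom_Cod[of f0] V.quotient_Dom_Cod[of g0] V.quotient_Dom_Cod[OF f(1)] T0' f
        T(2)
    unfolding Hom_iff by metis+
  have ZZ: "?Z \<in> kernel (- P) \<longleftrightarrow> Cod C g0 \<in> kernel (- P)"
    using V.quotient.zero_obj_iso[OF iso(3)] V.zero_obj_quotient cc by metis
  have "?Z \<in> Obj V.Q" using V.quotient.Cod_Obj[of c] H(3) cc unfolding Hom_iff by metis
  then show "?Z \<in> Obj C" by simp
  show "?Z \<in> kernel (- P) \<longleftrightarrow> X \<in> kernel (- P)"
  proof
    assume "?Z \<in> kernel (- P)"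
    then have "f0 \<in> V.W" using ZZ V.weak_eq_iff[OF T0(1)] by blast
    then have "is_iso V.Q (V.q f0)" by (rule V.quotient_iso)
    then have "is_iso V.Q (V.q ?f \<cdot>\<^bsub>V.Q\<^esub> a)"
      using V.quotient.is_iso_Cmp[OF _ iso(2)] eq b V.quotient_Dom_Cod[OF T0'(1)] by metis
    then have "is_iso V.Q (V.q ?f)"
      using V.quotient.is_iso_Cmp_cancel[OF _ iso(1)] V.quotient_Dom_Cod[OF f(1)] a f by metis
    then have "?f \<in> V.W" by (rule local_iso_weak_eq[OF P f(1)])
    then have "Cod C g1 \<in> kernel (- P)" using V.weak_eq_iff[OF T1] by blast
    then show "X \<in> kernel (- P)" by (rule nakayama_cone[OF X bspec[OF fg X] P r T1])
  next
    assume K: "X \<in> kernel (- P)"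
    then have "ShO_pow C d X \<in> kernel (- P)" using V.thick_ShO_pow[OF X] by simp
    then have "Dom C f0 \<in> kernel (- P)" "Cod C f0 \<in> kernel (- P)"
      using K V.quotient.zero_obj_iso[OF iso(1)] V.quotient.zero_obj_iso[OF iso(2)]
          V.zero_obj_quotient a b by metis+
    then show "?Z \<in> kernel (- P)" using V.thick_cone[OF T0(1)] ZZ by blast
  qed
qed

lemma local_koszul:
  assumes fg: "\<forall>X\<in>Obj C. fin_gen_module R (End_star C \<phi> X)" and P: "P \<in> Spec R G"
  shows "X \<in> Obj C \<Longrightarrow> (\<forall>(d, r)\<in>set ds. r \<in> G d \<and> r \<in> P) \<Longrightarrow>
    koszul_list (local_cat R G C \<phi> P) (local_action R G C \<phi> P) X ds \<in> kernel (- P) \<longleftrightarrow> X \<in> kernel (-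
        P)"
proof (induction ds arbitrary: X)
  case (Cons dr ds)
  have r: "snd dr \<in> G (fst dr)" "snd dr \<in> P" using Cons.prems(2) by auto
  show ?case using Cons.IH local_cone[OF fg P r Cons.prems(1)] Cons.prems(2) by simp
qed simp

lemma generators_mem:
  assumes "homogeneous_generators R G P ds"
  shows "\<forall>(d, r)\<in>set ds. r \<in> G d \<and> r \<in> P"
proof -
  have hom: "\<forall>(d, r)\<in>set ds. r \<in> G d" and P: "P = Idl (snd ` set ds)"
    using assms by (simp_all add: homogeneous_generators_def)
  have "snd ` set ds \<subseteq> carrier R" using hom G_carrier by fastforce
  then have "snd ` set ds \<subseteq> P" unfolding P by (rule genideal_self)
  then show ?thesis using hom by fastforce
qed

text \<open>The Koszul object in the definition is formed in the quotient on some chosen list of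
  generators, which exists by noetherianity. Each of its cones vanishes exactly if the preceding
  object does, so the choice is immaterial.\<close>

lemma supp_eq:
  assumes noeth: "noetherian_ring R" and fg: "\<forall>X\<in>Obj C. fin_gen_module R (End_star C \<phi> X)"
    and X: "X \<in> Obj C"
  shows "supp R G C \<phi> X = {P \<in> Spec R G. X \<notin> kernel (- P)}"
proof -
  have "zero_obj (local_cat R G C \<phi> P) (koszul_at R G C \<phi> X P) \<longleftrightarrow> X \<in> kernel (- P)"
      if P: "P \<in> Spec R G" for P
  proof -
    interpret V: thick_subcategory C "kernel (- P)"
        by (rule thick_subcategoryI[OF thick_local_kernel[OF P]])
    let ?ds = "SOME ds. homogeneous_generators R G P ds"
    have "homogeneous_ideal R G P" using P by (simp add: Spec_def)
    then have gen: "homogeneous_generators R G P ?ds"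
      by (rule someI_ex[OF homogeneous_generators_exist[OF noeth]])
    show ?thesis
      using local_koszul[OF fg P X generators_mem[OF gen]] V.zero_obj_quotient
      unfolding koszul_at_def koszul_def local_cat_def local_kernel_eq[OF P] by blast
  qed
  then show ?thesis by (auto simp: supp_def)
qed

section \<open>Torsion objects at a prime\<close>

text \<open>\<open>t\<close> accounts for passing to the local category at \<open>P\<close>,
  \<open>s\<close> for localising the endomorphism module at \<open>Q\<close>.\<close>

definition products :: "'r set \<Rightarrow> 'r set \<Rightarrow> 'r set" where
  "products P Q = {t \<otimes> s | t s d e. t \<in> G d \<and> t \<notin> P \<and> s \<in> G e \<and> s \<notin> Q}"

lemma thick_products:
  assumes P: "P \<in> Spec R G" and Q: "Q \<in> Spec R G"
  shows "thick C (kernel (products P Q))"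
proof (rule thick_kernel)
  have "\<one> \<otimes> \<one> \<in> products P Q"
    unfolding products_def using homogeneous_one Spec_one[OF P] Spec_one[OF Q] by blast
  then show "\<one> \<in> products P Q" by simp
  show "x \<otimes> y \<in> products P Q" if x: "x \<in> products P Q" and y: "y \<in> products P Q" for x y
  proof -
    interpret P: ideal P R using Spec_ideal[OF P] .
    obtain t s d e where ts: "x = t \<otimes> s" "t \<in> G d" "t \<notin> P" "s \<in> G e" "s \<notin> Q"
      using x unfolding products_def by blast
    obtain t' s' d' e' where ts': "y = t' \<otimes> s'" "t' \<in> G d'" "t' \<notin> P" "s' \<in> G e'" "s' \<notin> Q"
      using y unfolding products_def by blast
    have c: "t \<in> carrier R" "s \<in> carrier R" "t' \<in> carrier R" "s' \<in> carrier R"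
      using ts ts' G_carrier by blast+
    \<comment> \<open>\<open>t'\<close> is moved past \<open>s\<close>; a possible sign goes into
      \<open>t''\<close>, which stays outside \<open>P\<close>.\<close>
    have "\<ominus> t' \<notin> P" using ts'(3) c P.a_inv_closed[of "\<ominus> t'"] by auto
    then obtain t'' where t'': "t'' \<in> G d'" "t'' \<notin> P" "s \<otimes> t' = t'' \<otimes> s"
      using homogeneous_swap[OF ts(4) ts'(2)] ts'(2,3) G_minus[OF ts'(2)] c by (metis l_minus)
    have c'': "t'' \<in> carrier R" using t'' G_carrier by blast
    have "x \<otimes> y = t \<otimes> ((s \<otimes> t') \<otimes> s')" unfolding ts(1) ts'(1) using c by (simp add: m_assoc)
    also have "\<dots> = (t \<otimes> t'') \<otimes> (s \<otimes> s')" unfolding t''(3) using c c'' by (simp add: m_assoc)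
    finally show ?thesis
      unfolding products_def
      using denominators_mult[OF P ts(2) t''(1) ts(3) t''(2)] denominators_mult[OF Q ts(4) ts'(4)
          ts(5) ts'(5)]
      by blast
  qed
qed

text \<open>By \<open>local_zero_arrow\<close>, \<open>s\<close> annihilates \<open>X\<close> in the
  local category exactly if \<open>t \<otimes> s\<close> kills \<open>X\<close> in \<open>C\<close>
  for some \<open>t\<close> outside \<open>P\<close>. This brings the torsion condition back to
  \<open>C\<close>.\<close>

lemma Gamma_obj_eq:
  assumes P: "P \<in> Spec R G"
  shows "Gamma_obj R G C \<phi> P = {X \<in> Obj C. \<forall>Q\<in>Spec R G. \<not> P \<subseteq> Q \<longrightarrow> X \<in> kernel (products P Q)}"
proof -
  let ?N = "kernel (- P)"
  interpret V: thick_subcategory C ?N by (rule thick_subcategoryI[OF thick_local_kernel[OF P]])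
  interpret A: graded_action R G V.Q "quotient_action C ?N \<phi>"
    by (rule graded_action_quotient[OF thick_local_kernel[OF P]])
  have "localisation_vanishes R G (End_star V.Q (quotient_action C ?N \<phi>) X) Q
      \<longleftrightarrow> X \<in> kernel (products P Q)"
    if X: "X \<in> Obj C" and Q: "Q \<in> Spec R G" for X Q
  proof -
    have XQ: "X \<in> Obj V.Q" using X by simp
    have "A.kills d s X \<longleftrightarrow> (\<exists>e. \<exists>t\<in>G e. t \<notin> P \<and> kills (e + d) (t \<otimes> s) X)" if s: "s \<in> G d" for d s
    proof -
      have "A.kills d s X \<longleftrightarrow> V.q (\<phi> s d X) = Zer V.Q X (ShO_pow C d X)"
        unfolding A.kills_def V.ShO_pow_quotient using X by (simp add: quotient_action_def)
      then show ?thesis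
        using local_zero_arrow[OF P action_Hom[OF G_carrier[OF s] X]] act_twice[OF _ s X] by blast
    qed
    then have "localisation_vanishes R G (End_star V.Q (quotient_action C ?N \<phi>) X) Q \<longleftrightarrow>
        (\<exists>d. \<exists>s\<in>G d. s \<notin> Q \<and> (\<exists>e. \<exists>t\<in>G e. t \<notin> P \<and> kills (e + d) (t \<otimes> s) X))"
      unfolding A.localisation_vanishes_iff[OF Q XQ] by blast
    also have "\<dots> \<longleftrightarrow> X \<in> kernel (products P Q)"
    proof
      assume "\<exists>d. \<exists>s\<in>G d. s \<notin> Q \<and> (\<exists>e. \<exists>t\<in>G e. t \<notin> P \<and> kills (e + d) (t \<otimes> s) X)"
      then obtain d s e t where *: "s \<in> G d" "s \<notin> Q" "t \<in> G e" "t \<notin> P" "kills (e + d) (t \<otimes> s) X"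
          by blast
      then have "t \<otimes> s \<in> products P Q" unfolding products_def by blast
      then show "X \<in> kernel (products P Q)" using * X homogeneous_mult[OF *(3,1)]
          by (auto simp: kernel_def)
    next
      assume "X \<in> kernel (products P Q)"
      then obtain n x where x: "x \<in> G n" "x \<in> products P Q" "kills n x X" by (auto simp: kernel_def)
      obtain t s e d where *: "x = t \<otimes> s" "t \<in> G e" "t \<notin> P" "s \<in> G d" "s \<notin> Q"
        using x(2) unfolding products_def by blast
      \<comment> \<open>The product may be zero and then has every degree, so \<open>n\<close> need
        not be \<open>e + d\<close>.\<close>
      have "kills (e + d) (t \<otimes> s) X" using kills_all_degrees[OF x(1) X x(3)] *(1) by simp
      then show "\<exists>d. \<exists>s\<in>G d. s \<notin> Q \<and> (\<exists>e. \<exists>t\<in>G e. t \<notin> P \<and> kills (e + d) (t \<otimes> s) X)" using * by blast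
    qed
    finally show ?thesis .
  qed
  then show ?thesis
    unfolding Gamma_obj_def local_cat_def local_action_def local_kernel_eq[OF P] by auto
qed

lemma thick_Gamma_obj:
  assumes P: "P \<in> Spec R G"
  shows "thick C (Gamma_obj R G C \<phi> P)"
proof -
  let ?F = "\<lambda>Q. kernel (products P Q)"
  have F: "thick C (?F Q)" if "Q \<in> Spec R G" for Q by (rule thick_products[OF P that])
  \<comment> \<open>Membership in \<open>Obj C\<close> is built in because the index set
    \<open>A\<close> may be empty.\<close>
  have "thick C {X \<in> Obj C. \<forall>Q\<in>A. X \<in> ?F Q}" if A: "A \<subseteq> Spec R G" for A
    unfolding thick_def
  proof (intro conjI allI impI ballI)
    show "{X \<in> Obj C. \<forall>Q\<in>A. X \<in> ?F Q} \<subseteq> Obj C" by blast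
    show "Z \<in> {X \<in> Obj C. \<forall>Q\<in>A. X \<in> ?F Q}" if "zero_obj C Z" for Z
      using that A F unfolding zero_obj_iff thick_def by blast
    show "X \<in> {X \<in> Obj C. \<forall>Q\<in>A. X \<in> ?F Q} \<longleftrightarrow> ShO C X \<in> {X \<in> Obj C. \<forall>Q\<in>A. X \<in> ?F Q}"
      if X: "X \<in> Obj C" for X
      using ShO_Obj[OF X] X A F unfolding thick_def by blast
    show "case t of (f, g, h) \<Rightarrow> Dom C f \<in> {X \<in> Obj C. \<forall>Q\<in>A. X \<in> ?F Q} \<longrightarrow>
        Cod C f \<in> {X \<in> Obj C. \<forall>Q\<in>A. X \<in> ?F Q} \<longrightarrow> Cod C g \<in> {X \<in> Obj C. \<forall>Q\<in>A. X \<in> ?F Q}"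
      if t: "t \<in> Tri C" for t
    proof -
      obtain f g h where fgh: "t = (f, g, h)" by (cases t)
      have "Cod C g \<in> Obj C" using TriD[of f g h] t fgh by simp
      moreover have "Cod C g \<in> ?F Q" if "Q \<in> A" "Dom C f \<in> ?F Q" "Cod C f \<in> ?F Q" for Q
        using thick_subcategory.thick_cone[OF thick_subcategoryI[OF F], of Q f g h] that A t fgh
            by blast
      ultimately show ?thesis unfolding fgh by auto
    qed
    show "X \<in> {X \<in> Obj C. \<forall>Q\<in>A. X \<in> ?F Q}"
      if B: "is_biproduct C X Y B" "B \<in> {X \<in> Obj C. \<forall>Q\<in>A. X \<in> ?F Q}" for X Y B
    proof -
      have "X \<in> Obj C" using B(1) by (simp add: is_biproduct_def)
      moreover have "X \<in> ?F Q" if "Q \<in> A" for Q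
        using thick_subcategory.thick_summand[OF thick_subcategoryI[OF F] B(1), of Q] that A B(2)
            by blast
      ultimately show ?thesis by blast
    qed
  qed
  from this[of "{Q \<in> Spec R G. \<not> P \<subseteq> Q}"]
  have "thick C {X \<in> Obj C. \<forall>Q\<in>{Q \<in> Spec R G. \<not> P \<subseteq> Q}. X \<in> ?F Q}" by blast
  moreover have "{X \<in> Obj C. \<forall>Q\<in>{Q \<in> Spec R G. \<not> P \<subseteq> Q}. X \<in> ?F Q} = Gamma_obj R G C \<phi> P"
    unfolding Gamma_obj_eq[OF P] by blast
  ultimately show ?thesis by simp
qed

lemma kernel_subset_Gamma:
  assumes P: "P \<in> Spec R G"
  shows "kernel (- P) \<subseteq> Gamma_obj R G C \<phi> P"
proof
  fix X assume "X \<in> kernel (- P)"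
  then obtain d s where s: "X \<in> Obj C" "s \<in> G d" "s \<notin> P" "kills d s X" by (auto simp: kernel_def)
  have "s \<otimes> \<one> \<in> products P Q" if "Q \<in> Spec R G" for Q
    unfolding products_def using s homogeneous_one Spec_one[OF that] by blast
  then have "s \<in> products P Q" if "Q \<in> Spec R G" for Q using G_carrier[OF s(2)] that by simp
  then show "X \<in> Gamma_obj R G C \<phi> P" unfolding Gamma_obj_eq[OF P] using s
      by (auto simp: kernel_def)
qed

text \<open>All degrees are required because \<open>x\<close> need not be homogeneous. The action in
  degree \<open>n\<close> sees only the component of degree \<open>n\<close>, so the ideal is graded
  and can be fed to \<open>prime_of_maximal\<close>.\<close>

lemma annihilator:
  assumes Z: "Z \<in> Obj C"
  shows "ideal {x \<in> carrier R. \<forall>n. kills n x Z} R" "graded_set {x \<in> carrier R. \<forall>n. kills n x Z}"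
proof -
  let ?A = "{x \<in> carrier R. \<forall>n. kills n x Z}"
  have car: "(\<lambda>j. \<phi> y j Z) \<in> carrier (End_star C \<phi> Z)" if y: "y \<in> carrier R" for y
  proof -
    have "{n. \<phi> y n Z \<noteq> Zer C Z (ShO_pow C n Z)} \<subseteq> {n. \<exists>X\<in>Obj C. \<phi> y n X \<noteq> Zer C X (ShO_pow C n X)}"
      using Z by blast
    then show ?thesis using action_Hom[OF y Z] finite_subset act_finite[OF y]
        by (simp add: End_star_simps)
  qed
  have mult: "\<phi> (x \<otimes> y) n Z = (x \<odot>\<^bsub>End_star C \<phi> Z\<^esub> (\<lambda>j. \<phi> y j Z)) n"
    if "x \<in> carrier R" "y \<in> carrier R" for x y n
    using act_mult_all[OF that Z] by (simp add: End_star_simps)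
  have l: "x \<otimes> y \<in> ?A" if x: "x \<in> ?A" and y: "y \<in> carrier R" for x y
  proof -
    have "x \<odot>\<^bsub>End_star C \<phi> Z\<^esub> (\<lambda>j. \<phi> y j Z) = \<zero>\<^bsub>End_star C \<phi> Z\<^esub>"
      using smult_killed[OF Z car[OF y]] x by blast
    then show ?thesis using x y mult[of x y] by (auto simp: kills_def End_star_simps)
  qed
  have r: "y \<otimes> x \<in> ?A" if x: "x \<in> ?A" and y: "y \<in> carrier R" for x y
  proof -
    have "(\<lambda>j. \<phi> x j Z) = \<zero>\<^bsub>End_star C \<phi> Z\<^esub>" using x by (auto simp: kills_def End_star_simps)
    then have "y \<odot>\<^bsub>End_star C \<phi> Z\<^esub> (\<lambda>j. \<phi> x j Z) = \<zero>\<^bsub>End_star C \<phi> Z\<^esub>" using smult_zero[OF Z] by simp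
    then show ?thesis using x y mult[of y x] by (auto simp: kills_def End_star_simps)
  qed
  have a: "x \<oplus> y \<in> ?A" if "x \<in> ?A" "y \<in> ?A" for x y
    using that act_add[OF _ _ Z] Z by (auto simp: kills_def Add_Zer[OF Zer_Hom])
  show "ideal ?A R"
  proof (rule idealI[OF ring_axioms])
    show "subgroup ?A (add_monoid R)"
    proof (rule add.subgroupI)
      have "kills n \<zero> Z" for n
        unfolding kills_def by (rule action_degree[OF G_zero[of "n + 1"] _ Z]) simp
      then show "?A \<noteq> {}" by auto
      show "\<ominus> x \<in> ?A" if x: "x \<in> ?A" for x
      proof -
        have "x \<otimes> \<ominus> \<one> \<in> ?A" using l[OF x] by simp
        moreover have "x \<otimes> \<ominus> \<one> = \<ominus> x" using x by (simp add: r_minus)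
        ultimately show ?thesis by simp
      qed
    qed (use a in auto)
  qed (use l r in blast)+
  show "graded_set ?A"
    unfolding graded_set_def
  proof (intro ballI allI)
    fix x n assume x: "x \<in> ?A"
    then have "kills n (component x n) Z" using act_component[OF Z, of x n] by (simp add: kills_def)
    then show "component x n \<in> ?A"
      using kills_all_degrees[OF component_spec(1) Z] x component_carrier by blast
  qed
qed

text \<open>The homogeneous elements acting on \<open>Z\<close> with cone in \<open>N\<close> form a multiplicative set. If it missed
  the annihilator of \<open>Z\<close>, a prime separating the two would contradict that \<open>Z\<close> is \<open>P\<close>-torsion locally at \<open>P\<close>;
  hence \<open>N\<close> contains the cone of a zero map out of \<open>Z\<close>.\<close>

lemma Gamma_cone:
  assumes noeth: "noetherian_ring R" and P: "P \<in> Spec R G"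
    and N: "thick C N" "kernel (- P) \<subseteq> N" and Z: "Z \<in> Gamma_obj R G C \<phi> P"
    and r: "r \<in> G d" "r \<in> P" and T: "(\<phi> r d Z, g, h) \<in> Tri C" "Cod C g \<in> N"
  shows "Z \<in> N"
proof -
  interpret N: thick_subcategory C N by (rule thick_subcategoryI[OF N(1)])
  have ZO: "Z \<in> Obj C" using Z unfolding Gamma_obj_eq[OF P] by blast
  define U where "U = {x. \<exists>n. x \<in> G n \<and> \<phi> x n Z \<in> weak_eq C N}"
  have rU: "r \<in> U" using r T unfolding U_def weak_eq_def by blast
  have PU: "t \<in> U" if "t \<in> G n" "t \<notin> P" for t n
  proof -
    have "weak_eq C (kernel (- P)) \<subseteq> weak_eq C N" using N(2) unfolding weak_eq_def by blast
    then show ?thesis using act_weak_eq[OF P that ZO] that(1) unfolding U_def by blast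
  qed
  let ?A = "{x \<in> carrier R. \<forall>n. kills n x Z}"
  have "?A \<inter> U \<noteq> {}"
  proof
    assume disj: "?A \<inter> U = {}"
    have mult: "x \<otimes> y \<in> U" if xy: "x \<in> U" "y \<in> U" for x y
    proof -
      obtain m n where x: "x \<in> G m" "\<phi> x m Z \<in> weak_eq C N" and y: "y \<in> G n" "\<phi> y n Z \<in> weak_eq C N"
        using xy unfolding U_def by blast
      have c: "x \<in> carrier R" "y \<in> carrier R" using x y G_carrier by blast+
      have "\<phi> (x \<otimes> y) (m + n) Z \<in> weak_eq C N"
        unfolding act_mult[OF x(1) y(1) ZO] using x(2) y(2) N.W_ShA_pow[of "\<phi> x m Z" n] c ZO
        by (intro N.W_Cmp) auto
      then show ?thesis using homogeneous_mult[OF x(1) y(1)] unfolding U_def by blast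
    qed
    have "\<one> \<in> U"
      unfolding U_def using homogeneous_one act_one[OF ZO] N.weak_eq_Ide[OF ZO] by auto
    moreover have "U \<subseteq> (\<Union>n. G n)" unfolding U_def by blast
    ultimately obtain Q where Q: "Q \<in> Spec R G" "?A \<subseteq> Q" "Q \<inter> U = {}"
      using prime_of_maximal[OF noeth annihilator[OF ZO] _ _ mult disj] by blast
    \<comment> \<open>\<open>r\<close> lies in \<open>P\<close> and in \<open>U\<close>, which
      \<open>Q\<close> avoids, so the torsion condition applies at \<open>Q\<close> and puts some
      \<open>t \<otimes> s\<close> into the annihilator and hence into \<open>Q\<close>. As
      \<open>s\<close> is outside \<open>Q\<close>, \<open>t\<close> lies in \<open>Q\<close>; but
      homogeneous elements outside \<open>P\<close> lie in \<open>U\<close>.\<close>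
    have "\<not> P \<subseteq> Q" using rU r(2) Q(3) by blast
    then have "Z \<in> kernel (products P Q)" using Z Q(1) unfolding Gamma_obj_eq[OF P] by blast
    then obtain n x where x: "x \<in> G n" "x \<in> products P Q" "kills n x Z" by (auto simp: kernel_def)
    obtain t s a b where ts: "x = t \<otimes> s" "t \<in> G a" "t \<notin> P" "s \<in> G b" "s \<notin> Q"
      using x(2) unfolding products_def by blast
    have "x \<in> ?A" using kills_all_degrees[OF x(1) ZO x(3)] G_carrier[OF x(1)] by blast
    then have "t \<otimes> s \<in> Q" using Q(2) ts(1) by blast
    then have "t \<in> Q" using Spec_prime[OF Q(1) G_carrier[OF ts(2)] G_carrier[OF ts(4)]] ts(5)
        by blast
    then show False using PU[OF ts(2,3)] Q(3) by blast
  qed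
  then obtain x n where x: "x \<in> ?A" "\<phi> x n Z \<in> weak_eq C N" unfolding U_def by blast
  then have "\<phi> x n Z = Zer C Z (ShO_pow C n Z)" by (simp add: kills_def)
  then have "ShO_pow C n Z \<in> N" using N.W_Zer[of Z "ShO_pow C n Z"] x(2) ZO by simp
  then show ?thesis using N.thick_ShO_pow[OF ZO] by simp
qed

section \<open>Koszul objects formed in the category itself\<close>

lemma cone_act:
  assumes "r \<in> carrier R" "X \<in> Obj C"
  obtains g h where "(\<phi> r d X, g, h) \<in> Tri C" "cone C (\<phi> r d X) = Cod C g"
  using cone_Tri[of "\<phi> r d X" C] Tri_exists[of "\<phi> r d X"] assms by auto

lemma koszul_step_thick:
  assumes N: "thick C N" and r: "r \<in> carrier R" and X: "X \<in> N"
  shows "cone C (\<phi> r d X) \<in> N"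
proof -
  interpret N: thick_subcategory C N by (rule thick_subcategoryI[OF N(1)])
  have XO: "X \<in> Obj C" using X by (rule N.thick_Obj)
  obtain g h where T: "(\<phi> r d X, g, h) \<in> Tri C" "cone C (\<phi> r d X) = Cod C g"
      using cone_act[OF r XO] .
  show ?thesis
    using N.thick_cone[OF T(1)] T(2) X N.thick_ShO_pow[OF XO, of d] r XO by simp
qed

lemma koszul_thick:
  assumes N: "thick C N"
  shows "X \<in> N \<Longrightarrow> (\<forall>(d, r)\<in>set ds. r \<in> carrier R) \<Longrightarrow> koszul_list C \<phi> X ds \<in> N"
proof (induction ds arbitrary: X)
  case (Cons dr ds)
  then show ?case using koszul_step_thick[OF N _ Cons.prems(1), of "snd dr" "fst dr"] by auto
qed simp

text \<open>The cones are undone from the last to the first by \<open>Gamma_cone\<close>, every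
  intermediate object staying in \<open>Gamma_obj\<close> because this is thick. Together with
  \<open>koszul_thick\<close> this compares an object with its Koszul object without leaving
  \<open>C\<close>.\<close>

lemma koszul_Gamma:
  assumes noeth: "noetherian_ring R" and P: "P \<in> Spec R G" and N: "thick C N" "kernel (- P) \<subseteq> N"
  shows "Z \<in> Gamma_obj R G C \<phi> P \<Longrightarrow> (\<forall>(d, r)\<in>set ds. r \<in> G d \<and> r \<in> P) \<Longrightarrow>
    koszul_list C \<phi> Z ds \<in> N \<Longrightarrow> Z \<in> N"
proof (induction ds arbitrary: Z)
  case (Cons dr ds)
  have r: "snd dr \<in> G (fst dr)" "snd dr \<in> P" using Cons.prems(2) by auto
  note c = G_carrier[OF r(1)]
  have "cone C (\<phi> (snd dr) (fst dr) Z) \<in> N"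
    using Cons koszul_step_thick[OF thick_Gamma_obj[OF P] c Cons.prems(1)] by simp
  moreover have "Z \<in> Obj C" using Cons.prems(1) unfolding Gamma_obj_eq[OF P] by blast
  ultimately show ?case
    using cone_act[OF c, of Z] Gamma_cone[OF noeth P N Cons.prems(1) r] by metis
qed simp

text \<open>The first generator outside \<open>Q\<close> produces a cone killed by its square, which
  is outside \<open>Q\<close>; the later cones stay in the thick subcategory.\<close>

lemma koszul_outside:
  assumes Q: "Q \<in> Spec R G"
  shows "X \<in> Obj C \<Longrightarrow> (\<forall>(d, r)\<in>set ds. r \<in> G d) \<Longrightarrow> (\<exists>(d, r)\<in>set ds. r \<notin> Q) \<Longrightarrow>
    koszul_list C \<phi> X ds \<in> kernel (- Q)"
proof (induction ds arbitrary: X)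
  case (Cons dr ds)
  have r: "snd dr \<in> G (fst dr)" using Cons.prems(2) by auto
  note c = G_carrier[OF r]
  let ?Y = "cone C (\<phi> (snd dr) (fst dr) X)"
  obtain g h where T: "(\<phi> (snd dr) (fst dr) X, g, h) \<in> Tri C" "?Y = Cod C g"
    using cone_act[OF c Cons.prems(1)] .
  show ?case
  proof (cases "snd dr \<in> Q")
    case True
    have "?Y \<in> Obj C" using T TriD[OF T(1)] by simp
    then show ?thesis using Cons True by auto
  next
    case False
    then have "?Y \<in> kernel (- Q)"
      using act_cone_killed[OF r Cons.prems(1) T(1)] denominators_mult[OF Q r r False False] T
          TriD[OF T(1)]
      by (auto simp: kernel_def)
    then have "koszul_list C \<phi> ?Y ds \<in> kernel (- Q)"
      using Cons.prems(2) G_carrier by (intro koszul_thick[OF thick_local_kernel[OF Q]]) auto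
    then show ?thesis by simp
  qed
qed simp

text \<open>If a prime does not contain \<open>P\<close>, some generator is outside it. If it does,
  an element outside it is also outside \<open>P\<close>, so vanishing there would pass to
  \<open>P\<close> and by \<open>koszul_Gamma\<close> to \<open>Z\<close>.\<close>

lemma supp_koszul:
  assumes noeth: "noetherian_ring R" and fg: "\<forall>X\<in>Obj C. fin_gen_module R (End_star C \<phi> X)"
    and P: "P \<in> Spec R G" and gen: "homogeneous_generators R G P ds"
    and Z: "Z \<in> Gamma_obj R G C \<phi> P" "Z \<notin> kernel (- P)"
  shows "koszul_list C \<phi> Z ds \<in> Obj C" "supp R G C \<phi> (koszul_list C \<phi> Z ds) = {Q \<in> Spec R G. P \<subseteq> Q}"
proof -
  let ?X = "koszul_list C \<phi> Z ds"
  have hom: "\<forall>(d, r)\<in>set ds. r \<in> G d" using gen by (simp add: homogeneous_generators_def)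
  then have car: "\<forall>(d, r)\<in>set ds. r \<in> carrier R" using G_carrier by fastforce
  have PI: "P = Idl (snd ` set ds)" using gen by (simp add: homogeneous_generators_def)
  note inP = generators_mem[OF gen]
  have ZO: "Z \<in> Obj C" using Z unfolding Gamma_obj_eq[OF P] by blast
  have "?X \<in> Gamma_obj R G C \<phi> P" by (rule koszul_thick[OF thick_Gamma_obj[OF P] Z(1) car])
  then show XO: "?X \<in> Obj C" unfolding Gamma_obj_eq[OF P] by blast
  have K: "?X \<in> kernel (- Q) \<longleftrightarrow> \<not> P \<subseteq> Q" if Q: "Q \<in> Spec R G" for Q
  proof
    assume K: "?X \<in> kernel (- Q)"
    show "\<not> P \<subseteq> Q"
    proof
      assume "P \<subseteq> Q"
      then have "?X \<in> kernel (- P)" using K by (auto simp: kernel_def)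
      then show False
        using koszul_Gamma[OF noeth P thick_local_kernel[OF P] subset_refl Z(1) inP] Z(2) by blast
    qed
  next
    assume "\<not> P \<subseteq> Q"
    then have "\<not> snd ` set ds \<subseteq> Q" using genideal_minimal[OF Spec_ideal[OF Q]] PI by blast
    then have "\<exists>(d, r)\<in>set ds. r \<notin> Q" by auto
    then show "?X \<in> kernel (- Q)" by (rule koszul_outside[OF Q ZO hom])
  qed
  show "supp R G C \<phi> ?X = {Q \<in> Spec R G. P \<subseteq> Q}"
    unfolding supp_eq[OF noeth fg XO] using K by auto
qed

end

section \<open>Thick subcategories of the torsion categories\<close>

lemma full_sub_simps [simp]:
  "Obj (full_sub D S) = S" "ShO (full_sub D S) = ShO D" "Dom (full_sub D S) = Dom D"
  "Cod (full_sub D S) = Cod D"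
  by (simp_all add: full_sub_def Let_def)

lemma Hom_full_sub: "X \<in> S \<Longrightarrow> Y \<in> S \<Longrightarrow> Hom (full_sub D S) X Y = Hom D X Y"
  by (auto simp: Hom_def full_sub_def Let_def)

lemma zero_obj_full_sub: "zero_obj D Z \<Longrightarrow> Z \<in> S \<Longrightarrow> S \<subseteq> Obj D \<Longrightarrow> zero_obj (full_sub D S) Z"
  unfolding zero_obj_def by (auto simp: Hom_full_sub subset_iff)

lemma is_biproduct_full_sub:
  "is_biproduct D X Y B \<Longrightarrow> X \<in> S \<Longrightarrow> Y \<in> S \<Longrightarrow> B \<in> S \<Longrightarrow> is_biproduct (full_sub D S) X Y B"
  unfolding is_biproduct_def by (simp add: Hom_full_sub) (simp add: full_sub_def Let_def)

context linear_triangulated_category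
begin

text \<open>The quotient functor is the identity on objects, so the preimage of \<open>S\<close> is
  \<open>S\<close> itself. Triangles and biproducts of \<open>C\<close> are transported to
  \<open>Gamma\<close> and thickness is used there; the objects vanishing at \<open>P\<close> are
  zero objects of \<open>Gamma\<close>.\<close>

lemma Gamma_thick_lift:
  assumes P: "P \<in> Spec R G" and S: "thick (Gamma R G C \<phi> P) S"
  shows "thick C S" "kernel (- P) \<subseteq> S"
proof -
  let ?N = "kernel (- P)" and ?\<Gamma> = "Gamma_obj R G C \<phi> P"
  interpret V: thick_subcategory C ?N by (rule thick_subcategoryI[OF thick_local_kernel[OF P]])
  interpret \<Gamma>: thick_subcategory C ?\<Gamma> by (rule thick_subcategoryI[OF thick_Gamma_obj[OF P]])
  have F: "Gamma R G C \<phi> P = full_sub V.Q ?\<Gamma>"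
    unfolding Gamma_def local_cat_def local_kernel_eq[OF P] ..
  note S' = S[unfolded F thick_def full_sub_simps V.verdier_simps]
  have sub: "S \<subseteq> ?\<Gamma>" using S' by blast
  have GO: "?\<Gamma> \<subseteq> Obj V.Q" using \<Gamma>.thick_Obj by auto
  have NS: "X \<in> S" if "X \<in> ?N" for X
  proof -
    have "X \<in> ?\<Gamma>" using that kernel_subset_Gamma[OF P] by blast
    then have "zero_obj (full_sub V.Q ?\<Gamma>) X"
      using zero_obj_full_sub[OF _ _ GO] V.zero_obj_quotient that by blast
    then show ?thesis using S' by blast
  qed
  then show "?N \<subseteq> S" by blast
  show "thick C S"
    unfolding thick_def
  proof (intro conjI allI impI ballI)
    show "S \<subseteq> Obj C" using sub \<Gamma>.thick_Obj by blast
    show "Z \<in> S" if "zero_obj C Z" for Z using NS V.thick_zero that by blast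
    show "X \<in> S \<longleftrightarrow> ShO C X \<in> S" if "X \<in> Obj C" for X
      using S' sub \<Gamma>.thick_ShO[OF that] by blast
    show "case t of (f, g, h) \<Rightarrow> Dom C f \<in> S \<longrightarrow> Cod C f \<in> S \<longrightarrow> Cod C g \<in> S" if t: "t \<in> Tri C" for t
    proof -
      have "Cod C g \<in> S" if T: "(f, g, h) \<in> Tri C" and fS: "Dom C f \<in> S" "Cod C f \<in> S" for f g h
      proof -
        note T' = TriD[OF T]
        \<comment> \<open>A triangle of the full subcategory needs the endpoints of all three arrows
          in \<open>?\<Gamma>\<close>, the suspension included.\<close>
        have "Cod C g \<in> ?\<Gamma>" "ShO C (Dom C f) \<in> ?\<Gamma>"
          using \<Gamma>.thick_cone[OF T] \<Gamma>.thick_ShO[of "Dom C f"] sub fS T' by auto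
        then have "(V.q f, V.q g, V.q h) \<in> Tri (full_sub V.Q ?\<Gamma>)"
          using V.Tri_quotient[OF T] V.quotient_Dom_Cod[OF T'(1)] V.quotient_Dom_Cod[OF T'(2)]
            V.quotient_Dom_Cod[OF T'(3)] T' fS sub
          by (simp add: full_sub_def Let_def subset_iff del: V.verdier_simps)
        moreover have "Dom V.Q (V.q f) \<in> S" "Cod V.Q (V.q f) \<in> S"
          using V.quotient_Dom_Cod[OF T'(1)] fS by simp_all
        ultimately have "Cod V.Q (V.q g) \<in> S" using S' by blast
        then show ?thesis using V.quotient_Dom_Cod[OF T'(2)] by simp
      qed
      then show ?thesis using t by blast
    qed
    show "X \<in> S" if B: "is_biproduct C X Y B" and BS: "B \<in> S" for X Y B
    proof -
      have BG: "B \<in> ?\<Gamma>" using BS sub by blast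
      \<comment> \<open>Thickness yields only the first summand, but the biproduct belongs to the
        full subcategory only if both summands do.\<close>
      have "is_biproduct C Y X B"
      proof -
        obtain i j p r where O: "X \<in> Obj C" "Y \<in> Obj C" "B \<in> Obj C"
            and H: "i \<in> Hom C X B" "j \<in> Hom C Y B"
          "p \<in> Hom C B X" "r \<in> Hom C B Y"
          and E: "p \<cdot>\<^bsub>C\<^esub> i = Ide C X" "r \<cdot>\<^bsub>C\<^esub> j = Ide C Y" "r \<cdot>\<^bsub>C\<^esub> i = Zer C X Y"
              "p \<cdot>\<^bsub>C\<^esub> j = Zer C Y X"
          "Add C (i \<cdot>\<^bsub>C\<^esub> p) (j \<cdot>\<^bsub>C\<^esub> r) = Ide C B"
          using B unfolding is_biproduct_def by blast
        have "Add C (j \<cdot>\<^bsub>C\<^esub> r) (i \<cdot>\<^bsub>C\<^esub> p) = Ide C B"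
          using E(5) Add_commute[OF Cmp_Hom[OF H(3,1)] Cmp_Hom[OF H(4,2)]] by simp
        then show ?thesis unfolding is_biproduct_def using O H E by blast
      qed
      then have "X \<in> ?\<Gamma>" "Y \<in> ?\<Gamma>" using \<Gamma>.thick_summand B BG by blast+
      then have "is_biproduct (full_sub V.Q ?\<Gamma>) X Y B"
        using is_biproduct_full_sub[OF V.quotient_biproduct[OF B]] BG by blast
      then show ?thesis using S' BS by blast
    qed
  qed
qed

end

theorem proposition7p5:
  fixes R :: "('r, 'k) ring_scheme" and G :: "int \<Rightarrow> 'r set"
    and T :: "('o, 'm) tcat" and \<phi> :: "'r \<Rightarrow> int \<Rightarrow> 'o \<Rightarrow> 'm"
  assumes "noetherian_ring R"
    and "linear_triangulated_category R G T \<phi>"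
    and "\<And>X. X \<in> Obj T \<Longrightarrow> fin_gen_module R (End_star T \<phi> X)"
    and "\<not> stratified R G T \<phi>"
  shows "\<exists>X\<in>Obj T. \<exists>Y\<in>Obj T. supp R G T \<phi> X = supp R G T \<phi> Y \<and> Thick T X \<noteq> Thick T Y"
proof -
  interpret linear_triangulated_category R G T \<phi> by (rule assms(2))
  have fg: "\<forall>X\<in>Obj T. fin_gen_module R (End_star T \<phi> X)" using assms(3) by blast
  obtain P S where P: "P \<in> Spec R G" and S: "thick (Gamma R G T \<phi> P) S"
    and ne: "S \<noteq> {Z. zero_obj (Gamma R G T \<phi> P) Z}" "S \<noteq> Obj (Gamma R G T \<phi> P)"
    using assms(4) unfolding stratified_def minimal_tcat_def by blast
  interpret V: thick_subcategory T "kernel (- P)"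
      by (rule thick_subcategoryI[OF thick_local_kernel[OF P]])
  note lift = Gamma_thick_lift[OF P S]
  have O: "Obj (Gamma R G T \<phi> P) = Gamma_obj R G T \<phi> P" by (simp add: Gamma_def)
  have sub: "S \<subseteq> Gamma_obj R G T \<phi> P" using S unfolding thick_def O by blast
  \<comment> \<open>A thick subcategory contains all zero objects, so \<open>S\<close> can differ
    from their set only by a nonzero object.\<close>
  obtain X' where X': "X' \<in> S" "\<not> zero_obj (Gamma R G T \<phi> P) X'"
    using S ne(1) unfolding thick_def by blast
  have "X' \<notin> kernel (- P)"
  proof
    assume "X' \<in> kernel (- P)"
    then have "zero_obj V.Q X'" using V.zero_obj_quotient by blast
    then have "zero_obj (Gamma R G T \<phi> P) X'"
      unfolding Gamma_def local_cat_def local_kernel_eq[OF P]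
      using X'(1) sub by (intro zero_obj_full_sub) (auto simp: Gamma_obj_eq[OF P])
    then show False using X'(2) by blast
  qed
  moreover obtain Y' where Y': "Y' \<in> Gamma_obj R G T \<phi> P" "Y' \<notin> S"
    using ne(2) sub unfolding O by blast
  moreover have "Y' \<notin> kernel (- P)" using Y'(2) lift(2) by blast
  moreover obtain ds where ds: "homogeneous_generators R G P ds"
    using homogeneous_generators_exist[OF assms(1), of P] P unfolding Spec_def by blast
  moreover have "X' \<in> Gamma_obj R G T \<phi> P" using X'(1) sub by blast
  ultimately have XO: "koszul_list T \<phi> X' ds \<in> Obj T" and YO: "koszul_list T \<phi> Y' ds \<in> Obj T"
    and supp: "supp R G T \<phi> (koszul_list T \<phi> X' ds) = supp R G T \<phi> (koszul_list T \<phi> Y' ds)"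
    using supp_koszul[OF assms(1) fg P] by blast+
  note inP = generators_mem[OF ds]
  then have car: "\<forall>(d, r)\<in>set ds. r \<in> carrier R" using G_carrier by fastforce
  have "Thick T (koszul_list T \<phi> X' ds) \<noteq> Thick T (koszul_list T \<phi> Y' ds)"
  proof
    assume "Thick T (koszul_list T \<phi> X' ds) = Thick T (koszul_list T \<phi> Y' ds)"
    moreover have "Thick T (koszul_list T \<phi> X' ds) \<subseteq> S"
      unfolding Thick_def using lift(1) koszul_thick[OF lift(1) X'(1) car] by blast
    moreover have "koszul_list T \<phi> Y' ds \<in> Thick T (koszul_list T \<phi> Y' ds)"
      unfolding Thick_def by blast
    ultimately have "koszul_list T \<phi> Y' ds \<in> S" by blast
    \<comment> \<open>Here \<open>koszul_Gamma\<close> is applied with \<open>S\<close> instead of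
      the local kernel: the Koszul object of \<open>Y'\<close> can lie in \<open>S\<close> only if
      \<open>Y'\<close> does.\<close>
    then have "Y' \<in> S" by (rule koszul_Gamma[OF assms(1) P lift Y'(1) inP])
    then show False using Y'(2) by blast
  qed
  then show ?thesis using XO YO supp by blast
qed

end
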